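(* There exist universal constants $C_4,C_5,C_6>0$ such that the following holds. Let $n\ge 2$, let $\{p_i,w_i\}_{i=1}^N$ be a weighted complex projective $4$-design in $\mathbb{C}^n$, let $1\le r\le n$, and let $m\ge C_4\, n r\log n$ be an integer. Let $a_1,\dots,a_m\in\mathbb{C}^n$ be drawn independently from $\{p_i,w_i\}_{i=1}^N$ (each $a_j$ equals the design element $w_i$ with probability $p_i$), set $A_j=\sqrt{n(n+1)}\,a_ja_j^*$, and let $\mathcal{A}:\mathcal{H}_n\to\mathbb{R}^m$ be the linear map $\mathcal{A}(Z)=\big(\mathrm{tr}(ZA_j)\big)_{j=1}^m$. Then with probability at least $1-e^{-C_5 m}$ the following holds simultaneously for all $X\in\mathcal{H}_n$ of rank at most $r$, all $\eta\ge0$ and all $\epsilon\in\mathbb{R}^m$ with $\|\epsilon\|_{\ell_2}\le\eta$: setting $b=\mathcal{A}(X)+\epsilon$, any solution $X^\#$ of the convex optimization problem $$\underset{Z\in\mathcal{H}_n}{\text{minimize}}\ \|Z\|_1\quad\text{subject to}\quad \|\mathcal{A}(Z)-b\|_{\ell_2}\le\eta$$ satisfies $$\|X-X^\#\|_2\le\frac{C_6\,\eta}{\sqrt m}.$$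
   Context: $\mathcal{H}_n$ is the real vector space of Hermitian $n\times n$ complex matrices. For $Z\in\mathcal{H}_n$, $\|Z\|_1$ is the nuclear norm (sum of singular values) and $\|Z\|_2$ is the Frobenius norm. $\|\cdot\|_{\ell_2}$ is the Euclidean norm. "Universal" means that the constants do not depend on $n,r,m,N$, the design, or any other parameter. Weighted complex projective $t$-design: a finite set $\{w_1,\dots,w_N\}\subset\mathbb{C}^n$ of vectors with $\|w_i\|_{\ell_2}=1$, together with weights $p_i\ge0$, $\sum_{i=1}^Np_i=1$, such that $$\sum_{i=1}^N p_i (w_iw_i^* )^{\otimes t}=\int_{\mathbb{C}P^{n-1}}(ww^* )^{\otimes t}\,\mathrm{d}w,$$ where the integral is with respect to the unique unitarily invariant probability measure on $\mathbb{C}P^{n-1}$ and the integrand is computed using any unit-norm representative $w\in\mathbb{C}^n$. Equivalently, the right-hand side equals $\binom{n+t-1}{t}^{-1}P_{\mathrm{Sym}^t}$, where $P_{\mathrm{Sym}^t}$ is the orthogonal projector onto the totally symmetric subspace of $(\mathbb{C}^n)^{\otimes t}$. *)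

theory Defs
  imports
    "HOL-Probability.Probability"
    "Jordan_Normal_Form.Schur_Decomposition"
    "Jordan_Normal_Form.DL_Rank"
begin

unbundle no vec_syntax
no_notation inner (infix "\<bullet>" 70)
hide_const (open) Finite_Cartesian_Product.vec Finite_Cartesian_Product.mat

(* The dimension n is bound inside the statement, so vectors and matrices are those of
   Jordan_Normal_Form, whose dimension is a value. *)

definition l2_norm :: "'a :: real_normed_vector vec \<Rightarrow> real" where
  "l2_norm v = L2_set (\<lambda>i. norm (v $ i)) {..<dim_vec v}"

definition frobenius_norm :: "complex mat \<Rightarrow> real" where
  "frobenius_norm A = L2_set (\<lambda>ij. norm (A $$ ij)) ({..<dim_row A} \<times> {..<dim_col A})"

(* The eigenvalues of the positive semidefinite matrix A^* A are nonnegative reals;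
   proots counts them with multiplicity. *)
definition singular_values :: "complex mat \<Rightarrow> real multiset" where
  "singular_values A = image_mset (\<lambda>z. sqrt (Re z)) (proots (char_poly (mat_adjoint A * A)))"

definition nuclear_norm :: "complex mat \<Rightarrow> real" where
  "nuclear_norm A = sum_mset (singular_values A)"

definition hermitian_mats :: "nat \<Rightarrow> complex mat set" where
  "hermitian_mats n = {A \<in> carrier_mat n n. mat_adjoint A = A}"

definition unitary_mats :: "nat \<Rightarrow> complex mat set" where
  "unitary_mats n = {U \<in> carrier_mat n n. mat_adjoint U * U = 1\<^sub>m n}"

definition trace_mat :: "complex mat \<Rightarrow> complex" where
  "trace_mat A = (\<Sum>i<dim_row A. A $$ (i, i))"

(* v v^* *)
definition outer_self :: "complex vec \<Rightarrow> complex mat" where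
  "outer_self v = mat (dim_vec v) (dim_vec v) (\<lambda>(i, j). v $ i * cnj (v $ j))"

definition kronecker :: "complex mat \<Rightarrow> complex mat \<Rightarrow> complex mat" where
  "kronecker A B = mat (dim_row A * dim_row B) (dim_col A * dim_col B)
     (\<lambda>(i, j). A $$ (i div dim_row B, j div dim_col B) * B $$ (i mod dim_row B, j mod dim_col B))"

primrec tensor_power :: "complex mat \<Rightarrow> nat \<Rightarrow> complex mat" where
  "tensor_power A 0 = 1\<^sub>m 1"
| "tensor_power A (Suc t) = kronecker A (tensor_power A t)"

definition unit_sphere :: "nat \<Rightarrow> complex vec set" where
  "unit_sphere n = {v \<in> carrier_vec n. l2_norm v = 1}"

definition complex_line :: "complex vec \<Rightarrow> complex vec set" where
  "complex_line v = range (\<lambda>c. c \<cdot>\<^sub>v v)"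

(* Complex projective space of dimension n - 1: the one-dimensional subspaces of C^n. *)
definition proj_space :: "nat \<Rightarrow> complex vec set set" where
  "proj_space n = complex_line ` unit_sphere n"

(* The Borel sets of the sphere, via the coordinates. *)
definition sphere_measurable :: "nat \<Rightarrow> complex vec measure" where
  "sphere_measurable n = vimage_algebra (unit_sphere n)
     (\<lambda>v. \<lambda>i\<in>{..<n}. v $ i) (PiM {..<n} (\<lambda>_. borel))"

(* The quotient sigma-algebra along sphere -> projective space.  As this quotient map has a
   Borel section (make the first nonzero coordinate positive), it is the Borel
   sigma-algebra of the quotient topology. *)
definition proj_measurable :: "nat \<Rightarrow> complex vec set measure" where
  "proj_measurable n = sigma (proj_space n)
     {S. S \<subseteq> proj_space n \<and> {v \<in> unit_sphere n. complex_line v \<in> S} \<in> sets (sphere_measurable n)}"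

definition unitarily_invariant_prob :: "nat \<Rightarrow> complex vec set measure \<Rightarrow> bool" where
  "unitarily_invariant_prob n \<mu> \<longleftrightarrow>
     prob_space \<mu> \<and> space \<mu> = proj_space n \<and> sets \<mu> = sets (proj_measurable n) \<and>
     (\<forall>U \<in> unitary_mats n. \<forall>S \<in> sets \<mu>. emeasure \<mu> ((\<lambda>L. (\<lambda>v. U *\<^sub>v v) ` L) ` S) = emeasure \<mu> S)"

(* The choice is immaterial: see outer_self_unit_rep. *)
definition unit_rep :: "complex vec set \<Rightarrow> complex vec" where
  "unit_rep L = (SOME v. v \<in> L \<and> l2_norm v = 1)"

(* There is exactly one unitarily invariant probability measure, so the existential quantifier
   only names it.  The moment identity between (n^t x n^t)-matrices is stated entrywise. *)
definition weighted_projective_design ::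
  "nat \<Rightarrow> nat \<Rightarrow> nat \<Rightarrow> (nat \<Rightarrow> real) \<Rightarrow> (nat \<Rightarrow> complex vec) \<Rightarrow> bool" where
  "weighted_projective_design t n N p w \<longleftrightarrow>
     (\<forall>i<N. w i \<in> carrier_vec n \<and> l2_norm (w i) = 1) \<and>
     (\<forall>i<N. p i \<ge> 0) \<and> (\<Sum>i<N. p i) = 1 \<and>
     (\<exists>\<mu>. unitarily_invariant_prob n \<mu> \<and>
        (\<forall>j < n ^ t. \<forall>k < n ^ t.
           (\<Sum>i<N. complex_of_real (p i) * tensor_power (outer_self (w i)) t $$ (j, k)) =
           (LINT L|\<mu>. tensor_power (outer_self (unit_rep L)) t $$ (j, k))))"

(* The law of a single draw, and of m independent draws a 0, ..., a (m - 1).  Outside {..<m}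
   the value of a is the dummy 0. *)
definition draw_pmf :: "nat \<Rightarrow> (nat \<Rightarrow> real) \<Rightarrow> (nat \<Rightarrow> complex vec) \<Rightarrow> complex vec pmf" where
  "draw_pmf N p w = map_pmf w (embed_pmf (\<lambda>i. if i < N then p i else 0))"

definition draws_pmf ::
  "nat \<Rightarrow> nat \<Rightarrow> nat \<Rightarrow> (nat \<Rightarrow> real) \<Rightarrow> (nat \<Rightarrow> complex vec) \<Rightarrow> (nat \<Rightarrow> complex vec) pmf" where
  "draws_pmf m n N p w = Pi_pmf {..<m} (0\<^sub>v n) (\<lambda>_. draw_pmf N p w)"

definition measurement_mat :: "nat \<Rightarrow> complex vec \<Rightarrow> complex mat" where
  "measurement_mat n v = complex_of_real (sqrt (real n * (real n + 1))) \<cdot>\<^sub>m outer_self v"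

(* The traces are real for Hermitian Z: see trace_hermitian_measurement_real. *)
definition measurement_map :: "nat \<Rightarrow> nat \<Rightarrow> (nat \<Rightarrow> complex vec) \<Rightarrow> complex mat \<Rightarrow> real vec" where
  "measurement_map n m a Z = Matrix.vec m (\<lambda>j. Re (trace_mat (Z * measurement_mat n (a j))))"

definition nuclear_norm_solution ::
  "nat \<Rightarrow> nat \<Rightarrow> (nat \<Rightarrow> complex vec) \<Rightarrow> real vec \<Rightarrow> real \<Rightarrow> complex mat \<Rightarrow> bool" where
  "nuclear_norm_solution n m a b \<eta> X' \<longleftrightarrow>
     is_arg_min nuclear_norm
       (\<lambda>Z. Z \<in> hermitian_mats n \<and> l2_norm (measurement_map n m a Z - b) \<le> \<eta>) X'"

lemma pmf_draw_index:
  assumes "\<forall>i<N. p i \<ge> 0" "(\<Sum>i<N. p i) = 1"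
  shows "pmf (embed_pmf (\<lambda>i::nat. if i < N then p i else 0)) i = (if i < N then p i else 0)"
proof (rule pmf_embed_pmf)
  show "0 \<le> (if i < N then p i else 0)" for i using assms by auto
  have "(\<integral>\<^sup>+ i. ennreal (if i < N then p i else 0) \<partial>count_space UNIV) =
        (\<Sum>i<N. ennreal (if i < N then p i else 0))"
    by (rule nn_integral_count_space'[of "{..<N}"]) auto
  also have "\<dots> = ennreal (\<Sum>i<N. if i < N then p i else 0)"
    using assms(1) by (intro sum_ennreal) auto
  also have "(\<Sum>i<N. if i < N then p i else 0) = 1" using assms(2) by simp
  finally show "(\<integral>\<^sup>+ i. ennreal (if i < N then p i else 0) \<partial>count_space UNIV) = 1" by simp
qed

lemma l2_norm_smult: "l2_norm (c \<cdot>\<^sub>v (v :: complex vec)) = cmod c * l2_norm v"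
proof -
  have "l2_norm (c \<cdot>\<^sub>v v) = L2_set (\<lambda>i. cmod c * norm (v $ i)) {..<dim_vec v}"
    unfolding l2_norm_def by (auto intro!: L2_set_cong simp: norm_mult)
  then show ?thesis by (simp add: l2_norm_def L2_set_right_distrib)
qed

lemma outer_self_unit_rep:
  assumes "v \<in> unit_sphere n"
  shows "outer_self (unit_rep (complex_line v)) = outer_self v"
proof -
  have v: "l2_norm v = 1" using assms by (simp add: unit_sphere_def)
  have "v = 1 \<cdot>\<^sub>v v" by auto
  then have "v \<in> complex_line v" unfolding complex_line_def by blast
  then have "unit_rep (complex_line v) \<in> complex_line v \<and> l2_norm (unit_rep (complex_line v)) = 1"
    unfolding unit_rep_def using v by (rule someI[of _ v, OF conjI])
  then obtain c where c: "unit_rep (complex_line v) = c \<cdot>\<^sub>v v" "l2_norm (c \<cdot>\<^sub>v v) = 1"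
    unfolding complex_line_def by auto
  then have "cmod c = 1" using v by (simp add: l2_norm_smult)
  then have "c * cnj c = 1" by (simp flip: complex_norm_square)
  then have "(c * x) * cnj (c * y) = x * cnj y" for x y
  proof -
    have "(c * x) * cnj (c * y) = (c * cnj c) * (x * cnj y)" by (simp add: mult_ac)
    then show ?thesis using \<open>c * cnj c = 1\<close> by simp
  qed
  then show ?thesis unfolding c(1) outer_self_def by (intro cong_mat) auto
qed

lemma trace_hermitian_measurement_real:
  assumes "Z \<in> hermitian_mats n" "v \<in> carrier_vec n"
  shows "Im (trace_mat (Z * measurement_mat n v)) = 0"
proof -
  let ?s = "complex_of_real (sqrt (real n * (real n + 1)))"
  have dim: "dim_row Z = n" "dim_col Z = n" "dim_vec v = n" and adj: "mat_adjoint Z = Z"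
    using assms by (auto simp: hermitian_mats_def)
  have Z: "cnj (Z $$ (i, j)) = Z $$ (j, i)" if "i < n" "j < n" for i j
  proof -
    have "mat_adjoint Z $$ (j, i) = cnj (Z $$ (i, j))"
      using that dim by (simp add: mat_adjoint_def mat_of_rows_def)
    then show ?thesis using adj by simp
  qed
  have tr: "trace_mat (Z * measurement_mat n v) =
      (\<Sum>i<n. \<Sum>j<n. Z $$ (i, j) * (?s * (v $ j * cnj (v $ i))))"
    unfolding trace_mat_def measurement_mat_def outer_self_def using dim
    by (auto simp: scalar_prod_def atLeast0LessThan intro!: sum.cong)
  have "cnj (trace_mat (Z * measurement_mat n v)) =
      (\<Sum>i<n. \<Sum>j<n. Z $$ (j, i) * (?s * (v $ i * cnj (v $ j))))"
    unfolding tr by (auto simp: Z mult_ac intro!: sum.cong)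
  also have "\<dots> = trace_mat (Z * measurement_mat n v)"
    unfolding tr by (rule sum.swap)
  finally show ?thesis by (simp add: complex_eq_iff)
qed

end

theory Submission
  imports Defs
begin

text \<open>
  The proof follows Mendelson's small ball method. If \<open>X'\<close> minimises the nuclear norm, then
  \<open>D = X' - X\<close> is a descent direction of the nuclear norm at \<open>X\<close>, and both \<open>X\<close> and \<open>X'\<close> are
  feasible, so \<open>\<A>(D)\<close> has norm at most \<open>2 \<eta>\<close>. It remains to bound \<open>\<A>(D)\<close> from below on all
  descent directions of Frobenius norm 1 at once.

  For a single \<open>D\<close>, the second and fourth moments of \<open>tr (D A)\<close> under a 4-design show that
  \<open>\<bar>tr (D A)\<bar>\<close> exceeds a constant with probability bounded below. The uniform deviation over all
  \<open>D\<close> is concentrated around its mean by bounded differences; symmetrisation and contraction bound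
  the mean by that of \<open>sup tr (D H)\<close> with \<open>H = \<Sum> \<epsilon>\<^sub>j A\<^sub>j\<close>. On descent directions
  \<open>tr (D H)\<close> is at most \<open>3 sqrt r\<close> times the operator norm of \<open>H\<close>, which a noncommutative Khintchine
  inequality, combined with Rudelson's self-bounding argument, controls by \<open>sqrt (m n ln n)\<close>.

  The moments come from infinitesimal unitary invariance: differentiating the degree 4 moments
  along unitary rotations yields a recursion that determines them.
\<close>

section \<open>Spectral decomposition of Hermitian matrices\<close>

text \<open>Four moments say little about the tails of the squares of tr (D A), which can reach n (n
  + 1); bounded differences applied to their sum would be far too weak. Only a lower bound is
  wanted, so the truncated \<open>ramp\<close> replaces the square: boundedness serves
  concentration, the Lipschitz property serves contraction, and
  \<open>ramp t \<le> 16 * t\<^sup>2\<close> leads back to squares. The Khintchine estimate for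
  fixed vectors contains the operator norm of the sum of the measurement matrices, which is random.
  Its mean is at most a multiple of m plus twice the mean being estimated, an inequality that can be
  solved because m is at least of order n ln n. The integral over projective space is never
  evaluated: the measure enters through its invariance alone, and the recursion closes in the power
  sums of the eigenvalues of D. Vectors and matrices are functions on the naturals of which only the
  values below n count; the dimension is thus a plain parameter, and compactness comes from the
  product topology.\<close>

type_synonym cvec = "nat \<Rightarrow> complex"
type_synonym cmat = "nat \<Rightarrow> nat \<Rightarrow> complex"

definition ip :: "nat \<Rightarrow> cvec \<Rightarrow> cvec \<Rightarrow> complex" where
  "ip n u v = (\<Sum>i<n. cnj (u i) * v i)"

abbreviation ip_sq :: "nat \<Rightarrow> cvec \<Rightarrow> cvec \<Rightarrow> real" where
  "ip_sq n u v \<equiv> (cmod (ip n u v))\<^sup>2"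

definition sqn :: "nat \<Rightarrow> cvec \<Rightarrow> real" where
  "sqn n u = (\<Sum>i<n. (cmod (u i))\<^sup>2)"

definition mv :: "nat \<Rightarrow> cmat \<Rightarrow> cvec \<Rightarrow> nat \<Rightarrow> complex" where
  "mv n M v = (\<lambda>i. \<Sum>j<n. M i j * v j)"

definition hermitian :: "nat \<Rightarrow> cmat \<Rightarrow> bool" where
  "hermitian n M \<longleftrightarrow> (\<forall>i<n. \<forall>j<n. M j i = cnj (M i j))"

lemma mult_cnj_eq: "z * cnj z = (of_real (cmod z))\<^sup>2" "cnj z * z = (of_real (cmod z))\<^sup>2"
  by (simp_all add: complex_norm_square mult.commute flip: of_real_power)

lemma ip_self: "ip n u u = of_real (sqn n u)"
  unfolding ip_def sqn_def of_real_sum complex_norm_square by (simp add: mult.commute)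

lemma sqn_nonneg [simp]: "0 \<le> sqn n u"
  by (simp add: sqn_def sum_nonneg)

lemma cnj_ip: "cnj (ip n u v) = ip n v u"
  by (simp add: ip_def mult.commute)

lemma ip_add_right: "ip n u (\<lambda>i. v i + w i) = ip n u v + ip n u w"
  by (simp add: ip_def algebra_simps sum.distrib)

lemma ip_diff_right: "ip n u (\<lambda>i. v i - w i) = ip n u v - ip n u w"
  by (simp add: ip_def algebra_simps sum_subtractf)

lemma ip_scale_right: "ip n u (\<lambda>i. c * v i) = c * ip n u v"
  by (simp add: ip_def sum_distrib_left algebra_simps)

lemma ip_sum_right: "ip n u (\<lambda>i. \<Sum>l\<in>A. f l i) = (\<Sum>l\<in>A. ip n u (f l))"
  unfolding ip_def sum_distrib_left by (rule sum.swap)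

lemma ip_add_left: "ip n (\<lambda>i. v i + w i) u = ip n v u + ip n w u"
  by (simp add: ip_def algebra_simps sum.distrib)

lemma ip_diff_left: "ip n (\<lambda>i. v i - w i) u = ip n v u - ip n w u"
  by (simp add: ip_def algebra_simps sum_subtractf)

lemma ip_scale_left: "ip n (\<lambda>i. c * v i) u = cnj c * ip n v u"
  by (simp add: ip_def sum_distrib_left algebra_simps)

lemma ip_sum_left: "ip n (\<lambda>i. \<Sum>l\<in>A. f l i) u = (\<Sum>l\<in>A. ip n (f l) u)"
  unfolding ip_def cnj_sum sum_distrib_right by (rule sum.swap)

lemma ip_cong: "(\<And>i. i < n \<Longrightarrow> u i = u' i) \<Longrightarrow> (\<And>i. i < n \<Longrightarrow> v i = v' i) \<Longrightarrow> ip n u v = ip n u' v'"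
  by (simp add: ip_def)

lemma sqn_cong: "(\<And>i. i < n \<Longrightarrow> u i = u' i) \<Longrightarrow> sqn n u = sqn n u'"
  by (simp add: sqn_def)

lemma mv_cong: "(\<And>i. i < n \<Longrightarrow> u i = u' i) \<Longrightarrow> mv n M u = mv n M u'"
  by (simp add: mv_def)

lemma sqn_eq_0: "sqn n u = 0 \<Longrightarrow> i < n \<Longrightarrow> u i = 0"
  by (simp add: sqn_def sum_nonneg_eq_0_iff)

lemma coord_le_sqn: "i < n \<Longrightarrow> (cmod (u i))\<^sup>2 \<le> sqn n u"
  unfolding sqn_def by (rule member_le_sum[where f = "\<lambda>i. (cmod (u i))\<^sup>2"]) auto

lemma sqn_scale: "sqn n (\<lambda>i. c * v i) = (cmod c)\<^sup>2 * sqn n v"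
  by (simp add: sqn_def sum_distrib_left norm_mult power_mult_distrib)

lemma sqn_alt: "sqn n u = Re (ip n u u)" by (simp add: ip_self)

lemma ip_hermitian:
  assumes "hermitian n M"
  shows "ip n u (mv n M v) = ip n (mv n M u) v"
proof -
  have "ip n (mv n M u) v = (\<Sum>i<n. \<Sum>j<n. cnj (M i j) * cnj (u j) * v i)"
    by (simp add: ip_def mv_def sum_distrib_right)
  also have "\<dots> = (\<Sum>j<n. \<Sum>i<n. cnj (M i j) * cnj (u j) * v i)" by (rule sum.swap)
  also have "\<dots> = ip n u (mv n M v)"
    unfolding ip_def mv_def sum_distrib_left
  proof (intro sum.cong refl)
    fix i j assume "i \<in> {..<n}" "j \<in> {..<n}"
    then have "M i j = cnj (M j i)" using assms unfolding hermitian_def by blast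
    then show "cnj (M j i) * cnj (u i) * v j = cnj (u i) * (M i j * v j)" by simp
  qed
  finally show ?thesis by simp
qed

lemma mv_add: "mv n M (\<lambda>i. u i + v i) = (\<lambda>i. mv n M u i + mv n M v i)"
  by (simp add: mv_def algebra_simps sum.distrib)

lemma mv_scale: "mv n M (\<lambda>i. c * v i) = (\<lambda>i. c * mv n M v i)"
  by (simp add: mv_def algebra_simps sum_distrib_left)

lemma mv_sum: "mv n M (\<lambda>i. \<Sum>l\<in>A. f l i) = (\<lambda>i. \<Sum>l\<in>A. mv n M (f l) i)"
  unfolding mv_def sum_distrib_left by (rule ext) (rule sum.swap)

definition orthonormal :: "nat \<Rightarrow> nat \<Rightarrow> cmat \<Rightarrow> bool" where
  "orthonormal n k u \<longleftrightarrow> (\<forall>a<k. \<forall>b<k. ip n (u a) (u b) = (if a = b then 1 else 0))"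

text \<open>One Gram-Schmidt step without normalisation. The second claim is Bessel's inequality
  with its defect; counting these defects below takes the place of dimension theory.\<close>

lemma orthonormal_residual:
  assumes u: "orthonormal n k u"
  defines "y \<equiv> \<lambda>x i. x i - (\<Sum>l<k. ip n (u l) x * u l i)"
  shows "l < k \<Longrightarrow> ip n (u l) (y x) = 0"
    and "sqn n (y x) = sqn n x - (\<Sum>l<k. ip_sq n (u l) x)"
proof -
  show 1: "ip n (u l) (y x) = 0" if "l < k" for l
  proof -
    have "ip n (u l) (y x) = ip n (u l) x - (\<Sum>m<k. ip n (u m) x * ip n (u l) (u m))"
      by (simp add: y_def ip_diff_right ip_sum_right ip_scale_right)
    also have "(\<Sum>m<k. ip n (u m) x * ip n (u l) (u m)) = (\<Sum>m<k. if m = l then ip n (u m) x else 0)"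
      using u that by (intro sum.cong) (auto simp: orthonormal_def)
    finally show ?thesis using that by simp
  qed
  have "ip n (y x) (y x) = ip n x (y x) - (\<Sum>m<k. cnj (ip n (u m) x) * ip n (u m) (y x))"
    by (subst y_def) (simp add: ip_diff_left ip_sum_left ip_scale_left)
  also have "\<dots> = ip n x (y x)" using 1 by simp
  also have "\<dots> = ip n x x - (\<Sum>m<k. ip n (u m) x * cnj (ip n (u m) x))"
    by (simp add: y_def ip_diff_right ip_sum_right ip_scale_right cnj_ip)
  finally have "complex_of_real (sqn n (y x)) =
      of_real (sqn n x - (\<Sum>l<k. ip_sq n (u l) x))"
    by (simp add: ip_self mult_cnj_eq)
  then show "sqn n (y x) = sqn n x - (\<Sum>l<k. ip_sq n (u l) x)"
    using of_real_eq_iff by blast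
qed

abbreviation unitvec :: "nat \<Rightarrow> nat \<Rightarrow> complex" where
  "unitvec i \<equiv> (\<lambda>j. if j = i then 1 else 0)"

lemma ip_unitvec: "i < n \<Longrightarrow> ip n u (unitvec i) = cnj (u i)"
  by (simp add: ip_def if_distrib cong: if_cong)

lemma ip_unitvec_left: "i < n \<Longrightarrow> ip n (unitvec i) u = u i"
  using ip_unitvec[of i n u] cnj_ip[of n u "unitvec i"] by simp

lemma sqn_unitvec: "i < n \<Longrightarrow> sqn n (unitvec i) = 1"
  using ip_unitvec[of i n "unitvec i"] by (simp add: sqn_alt)

lemma orthonormal_sum_sq:
  assumes "orthonormal n k u"
  shows "(\<Sum>i<n. \<Sum>l<k. (cmod (u l i))\<^sup>2) = real k"
proof -
  have "(\<Sum>i<n. \<Sum>l<k. (cmod (u l i))\<^sup>2) = (\<Sum>l<k. sqn n (u l))"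
    unfolding sqn_def by (rule sum.swap)
  also have "\<dots> = (\<Sum>l<k. 1)"
    using assms by (intro sum.cong refl) (auto simp: orthonormal_def sqn_alt)
  finally show ?thesis by simp
qed

text \<open>The k vectors carry total mass k over the n coordinates, so for k < n some coordinate i
  receives mass below 1. That mass is the squared length of the projection of the i-th unit vector,
  whose residual is therefore nonzero.\<close>

lemma orthonormal_extend:
  assumes u: "orthonormal n k u" and k: "k < n"
  shows "\<exists>y. sqn n y > 0 \<and> (\<forall>l<k. ip n (u l) y = 0)"
proof -
  have "\<exists>i<n. (\<Sum>l<k. (cmod (u l i))\<^sup>2) < 1"
  proof (rule ccontr)
    assume "\<not> ?thesis"
    then have "(\<Sum>i<n. 1) \<le> (\<Sum>i<n. \<Sum>l<k. (cmod (u l i))\<^sup>2)"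
      by (intro sum_mono) force
    then show False using orthonormal_sum_sq[OF u] k by simp
  qed
  then obtain i where i: "i < n" "(\<Sum>l<k. (cmod (u l i))\<^sup>2) < 1" by blast
  show ?thesis
    using orthonormal_residual[OF u, where x = "unitvec i"] i
    by (intro exI[of _ "\<lambda>a. unitvec i a - (\<Sum>l<k. ip n (u l) (unitvec i) * u l a)"])
      (simp add: sqn_unitvec ip_unitvec)
qed

text \<open>The residuals of the n unit vectors have total squared length n - n = 0. Hence every
  unit vector, and so every vector, lies in the span.\<close>

lemma orthonormal_complete:
  assumes u: "orthonormal n n u" and i: "i < n"
  shows "x i = (\<Sum>l<n. ip n (u l) x * u l i)"
proof -
  define s where "s = (\<lambda>i. \<Sum>l<n. (cmod (u l i))\<^sup>2)"
  let ?y = "\<lambda>i a. unitvec i a - (\<Sum>l<n. ip n (u l) (unitvec i) * u l a)"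
  have y: "sqn n (?y i) = 1 - s i" if "i < n" for i
    using orthonormal_residual(2)[OF u, where x = "unitvec i"] that
    by (simp add: sqn_unitvec ip_unitvec s_def)
  have "(\<Sum>i<n. sqn n (?y i)) = (\<Sum>i<n. 1 - s i)" using y by (intro sum.cong) auto
  also have "\<dots> = 0" using orthonormal_sum_sq[OF u] by (simp add: sum_subtractf s_def)
  finally have "sqn n (?y i) = 0" if "i < n" for i
    using that by (subst (asm) sum_nonneg_eq_0_iff) auto
  then have e: "unitvec i a = (\<Sum>l<n. cnj (u l i) * u l a)" if "i < n" "a < n" for i a
    using sqn_eq_0[of n "?y i" a] that by (simp add: ip_unitvec)
  have "(\<Sum>l<n. ip n (u l) x * u l i) = (\<Sum>l<n. \<Sum>a<n. cnj (u l a) * u l i * x a)"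
    unfolding ip_def sum_distrib_right by (simp add: mult_ac)
  also have "\<dots> = (\<Sum>a<n. \<Sum>l<n. cnj (u l a) * u l i * x a)" by (rule sum.swap)
  also have "\<dots> = (\<Sum>a<n. (unitvec a i) * x a)"
    using e i by (intro sum.cong refl) (auto simp flip: sum_distrib_right)
  also have "\<dots> = (\<Sum>a<n. if a = i then x a else 0)" by (intro sum.cong) auto
  finally show ?thesis using i by simp
qed

lemma compact_complex_box: "compact {x :: nat \<Rightarrow> complex. \<forall>i. cmod (x i) \<le> (if i < n then 1 else 0)}"
proof -
  \<comment> \<open>Coordinates from n on are pinned to 0; the set is then a product of compact
    discs, compact by Tychonoff.\<close>
  have eq: "{x :: nat \<Rightarrow> complex. \<forall>i. cmod (x i) \<le> (if i < n then 1 else 0)} =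
      PiE UNIV (\<lambda>i. cball 0 (if i < n then 1 else 0))"
    by (auto simp: PiE_def Pi_def split: if_splits)
  have "compactin (product_topology (\<lambda>_. euclidean) UNIV) (PiE UNIV (\<lambda>i::nat. cball (0::complex) (if i < n then 1 else 0)))"
    by (subst compactin_PiE) auto
  then show ?thesis unfolding eq by (simp add: euclidean_product_topology)
qed

text \<open>The new eigenvector maximises the Rayleigh quotient on the orthogonal complement of the old ones.\<close>

lemma next_eigenvector:
  assumes herm: "hermitian n M" and k: "k < n" and u: "orthonormal n k u"
    and eig: "\<And>l i. l < k \<Longrightarrow> i < n \<Longrightarrow> mv n M (u l) i = of_real (e l) * u l i"
  shows "\<exists>x (\<mu>::real). sqn n x = 1 \<and> (\<forall>l<k. ip n (u l) x = 0) \<and>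
    (\<forall>i<n. mv n M x i = of_real \<mu> * x i)"
proof -
  define q where "q = (\<lambda>x. Re (ip n x (mv n M x)))"
  define V where "V = {x. (\<forall>i. cmod (x i) \<le> (if i < n then 1 else 0))} \<inter>
    ({x. sqn n x = 1} \<inter> (\<Inter>l\<in>{..<k}. {x. ip n (u l) x = 0}))"
  have cont: "continuous_on UNIV (\<lambda>x::nat \<Rightarrow> complex. x i)" for i
    by (rule continuous_on_product_coordinates)
  have c1: "continuous_on UNIV (sqn n)"
    unfolding sqn_def[abs_def] by (intro continuous_intros cont)
  have c2: "continuous_on UNIV (ip n (u l))" for l
    unfolding ip_def[abs_def] by (intro continuous_intros cont)
  have c3: "continuous_on UNIV q"
    unfolding ip_def q_def mv_def by (intro continuous_intros cont)
  have "closed ({x. sqn n x = 1} \<inter> (\<Inter>l\<in>{..<k}. {x. ip n (u l) x = 0}))"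
    by (intro closed_Int closed_INT ballI closed_Collect_eq c1 c2 continuous_on_const)
  then have comp: "compact V"
    unfolding V_def by (intro compact_Int_closed compact_complex_box)
  have norm: "(\<lambda>i. if i < n then of_real (1 / sqrt (sqn n y)) * y i else 0) \<in> V"
    (is "?z \<in> V") if y: "sqn n y > 0" "\<forall>l<k. ip n (u l) y = 0" for y
  proof -
    have sq: "sqn n ?z = 1"
    proof -
      have "sqn n ?z = sqn n (\<lambda>i. of_real (1 / sqrt (sqn n y)) * y i)" by (rule sqn_cong) simp
      also have "\<dots> = 1" using y by (subst sqn_scale) (simp add: power_divide norm_divide)
      finally show ?thesis .
    qed
    have ob: "ip n (u l) ?z = 0" if "l < k" for l
    proof -
      have "ip n (u l) ?z = ip n (u l) (\<lambda>i. of_real (1 / sqrt (sqn n y)) * y i)"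
        by (rule ip_cong) auto
      then show ?thesis using y that by (simp only: ip_scale_right) simp
    qed
    have "cmod (?z i) \<le> 1" if "i < n" for i
    proof -
      have "(cmod (?z i))\<^sup>2 \<le> 1\<^sup>2" using coord_le_sqn[OF that, of ?z] unfolding sq by simp
      then show ?thesis by (rule power2_le_imp_le) simp
    qed
    then show ?thesis using sq ob by (auto simp: V_def)
  qed
  have "V \<noteq> {}" using norm orthonormal_extend[OF u k] by blast
  then obtain x where x: "x \<in> V" and max: "\<And>y. y \<in> V \<Longrightarrow> q y \<le> q x"
    using continuous_attains_sup[OF comp _ continuous_on_subset[OF c3]] by blast
  define \<mu> where "\<mu> = q x"
  have x1: "sqn n x = 1" and xo: "\<forall>l<k. ip n (u l) x = 0" using x by (auto simp: V_def)
  \<comment> \<open>Maximality on the unit vectors of \<open>V\<close> becomes, by homogeneity, an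
    inequality on the whole orthogonal complement, which admits the unnormalised perturbation
    below.\<close>
  have ray: "q y \<le> \<mu> * sqn n y" if y: "\<forall>l<k. ip n (u l) y = 0" for y
  proof (cases "sqn n y = 0")
    case True
    then have "q y = 0" using sqn_eq_0[OF True] by (simp add: q_def ip_def)
    then show ?thesis using True by simp
  next
    case False
    then have pos: "sqn n y > 0" using sqn_nonneg[of n y] by linarith
    let ?c = "of_real (1 / sqrt (sqn n y))"
    let ?z = "\<lambda>i. if i < n then ?c * y i else 0"
    have "q ?z = q (\<lambda>i. ?c * y i)"
      unfolding q_def by (intro arg_cong[of _ _ Re] ip_cong) (auto simp: mv_def)
    also have "ip n (\<lambda>i. ?c * y i) (mv n M (\<lambda>i. ?c * y i)) = of_real (1 / sqn n y) * ip n y (mv n M y)"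
      unfolding mv_scale ip_scale_right ip_scale_left mult.assoc[symmetric] using pos
      by (simp flip: of_real_mult)
    then have "q (\<lambda>i. ?c * y i) = q y / sqn n y" unfolding q_def by (simp add: Re_divide_of_real)
    finally have "q y / sqn n y \<le> \<mu>" using max[OF norm[OF pos y]] by (simp add: \<mu>_def)
    then show ?thesis using pos by (simp add: field_simps)
  qed
  define y where "y = (\<lambda>i. mv n M x i - of_real \<mu> * x i)"
  \<comment> \<open>The orthogonal complement of eigenvectors is invariant under a Hermitian matrix,
    so the defect \<open>y\<close> is an admissible direction.\<close>
  have yo: "ip n (u l) y = 0" if "l < k" for l
  proof -
    have "ip n (u l) (mv n M x) = ip n (mv n M (u l)) x" by (rule ip_hermitian[OF herm])
    also have "\<dots> = ip n (\<lambda>i. of_real (e l) * u l i) x" using eig that by (intro ip_cong) auto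
    finally show ?thesis using xo that by (simp add: y_def ip_diff_right ip_scale_right ip_scale_left)
  qed
  have "sqn n y = 0"
  proof (rule ccontr)
    assume "sqn n y \<noteq> 0"
    then have s: "sqn n y > 0" using sqn_nonneg[of n y] by linarith
    define c where "c = \<mu> * sqn n y - q y"
    \<comment> \<open>Moving from \<open>x\<close> by \<open>t * y\<close> gains
      \<open>2 * t * sqn n y\<close> to first order against a second-order term
      \<open>t\<^sup>2 * c\<close>. This \<open>t\<close> keeps \<open>t * c\<close> at most
      \<open>sqn n y\<close>, so the gain wins; the added 1 covers c = 0.\<close>
    define t where "t = sqn n y / (\<bar>c\<bar> + 1)"
    have c1: "\<bar>c\<bar> + 1 > 0" by linarith
    have t: "t > 0" using s c1 unfolding t_def by (rule divide_pos_pos)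
    let ?z = "\<lambda>i. x i + of_real t * y i"
    have "\<forall>l<k. ip n (u l) ?z = 0" using xo yo by (simp add: ip_add_right ip_scale_right)
    from ray[OF this] have r: "q ?z \<le> \<mu> * sqn n ?z" .
    have h: "Re (ip n x (mv n M y)) = Re (ip n y (mv n M x))"
      unfolding ip_hermitian[OF herm, of x y] cnj_ip[of n y, symmetric] by simp
    have h2: "Re (ip n x y) = Re (ip n y x)" unfolding cnj_ip[of n y, symmetric] by simp
    have qz: "q ?z = \<mu> + 2 * t * Re (ip n y (mv n M x)) + t\<^sup>2 * q y"
      unfolding q_def \<mu>_def mv_add mv_scale
      by (simp add: ip_add_right ip_add_left ip_scale_right ip_scale_left h power2_eq_square algebra_simps)
    have sz: "sqn n ?z = 1 + 2 * t * Re (ip n y x) + t\<^sup>2 * sqn n y"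
      unfolding sqn_alt using x1 unfolding sqn_alt
      by (simp add: ip_add_right ip_add_left ip_scale_right ip_scale_left h2 power2_eq_square algebra_simps)
    have "sqn n y = Re (ip n y (mv n M x)) - \<mu> * Re (ip n y x)"
      unfolding sqn_alt by (subst (2) y_def) (simp add: ip_diff_right ip_scale_right)
    then have eq: "Re (ip n y (mv n M x)) = sqn n y + \<mu> * Re (ip n y x)" by simp
    have "2 * t * sqn n y \<le> t\<^sup>2 * c"
      using r unfolding qz sz c_def eq by (simp add: algebra_simps)
    then have "t * (2 * sqn n y) \<le> t * (t * c)" by (simp add: power2_eq_square mult_ac)
    then have "2 * sqn n y \<le> t * c" using t by (simp only: mult_le_cancel_left_pos)
    also have "t * c \<le> t * (\<bar>c\<bar> + 1)" using t by (intro mult_left_mono) auto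
    also have "\<dots> = sqn n y" using c1 by (simp add: t_def)
    finally show False using s by simp
  qed
  then have "\<forall>i<n. mv n M x i = of_real \<mu> * x i"
    using sqn_eq_0[of n y] by (auto simp: y_def)
  then show ?thesis using x1 xo by blast
qed

definition spectral :: "nat \<Rightarrow> cmat \<Rightarrow> (nat \<Rightarrow> real) \<Rightarrow> cmat \<Rightarrow> bool" where
  "spectral n M e u \<longleftrightarrow> orthonormal n n u \<and> (\<forall>l<n. \<forall>i<n. mv n M (u l) i = of_real (e l) * u l i)"

theorem spectral_exists:
  assumes herm: "hermitian n M"
  shows "\<exists>e u. spectral n M e u"
proof -
  have "\<exists>e u. orthonormal n k u \<and> (\<forall>l<k. \<forall>i<n. mv n M (u l) i = of_real (e l) * u l i)"
    if "k \<le> n" for k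
    using that
  proof (induction k)
    case 0
    then show ?case by (auto simp: orthonormal_def)
  next
    case (Suc k)
    then obtain e u where IH: "orthonormal n k u"
      "\<forall>l<k. \<forall>i<n. mv n M (u l) i = of_real (e l) * u l i" by auto
    with Suc.prems obtain x \<mu> where x: "sqn n x = 1" "\<forall>l<k. ip n (u l) x = 0"
      "\<forall>i<n. mv n M x i = of_real \<mu> * x i"
      using next_eigenvector[OF herm _ IH(1), of e] by auto
    have x': "\<forall>l<k. ip n x (u l) = 0" using x(2) cnj_ip[of n _ x] by (metis complex_cnj_zero)
    have "orthonormal n (Suc k) (u(k := x))"
      using IH(1) x x' by (auto simp: orthonormal_def less_Suc_eq ip_self)
    moreover have "\<forall>l<Suc k. \<forall>i<n. mv n M ((u(k := x)) l) i = of_real ((e(k := \<mu>)) l) * (u(k := x)) l i"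
      using IH(2) x(3) by (auto simp: less_Suc_eq)
    ultimately show ?case by blast
  qed
  then show ?thesis unfolding spectral_def by blast
qed

lemma parseval:
  assumes u: "orthonormal n n u"
  shows "ip n x y = (\<Sum>l<n. ip n x (u l) * ip n (u l) y)"
proof -
  have "ip n x y = ip n x (\<lambda>i. \<Sum>l<n. ip n (u l) y * u l i)"
    by (rule ip_cong) (use orthonormal_complete[OF u] in auto)
  then show ?thesis by (simp add: ip_sum_right ip_scale_right mult.commute[of "ip n x (u _)"])
qed

lemma parseval_sqn:
  assumes u: "orthonormal n n u"
  shows "sqn n x = (\<Sum>l<n. ip_sq n (u l) x)"
proof -
  have "complex_of_real (sqn n x) = of_real (\<Sum>l<n. ip_sq n (u l) x)"
    unfolding ip_self[symmetric] parseval[OF u, of x x]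
    by (auto simp: mult_cnj_eq simp flip: cnj_ip[of n x] intro!: sum.cong)
  then show ?thesis using of_real_eq_iff by blast
qed

lemma spectral_ip_right:
  assumes "spectral n M e u" "l < n"
  shows "ip n x (mv n M (u l)) = of_real (e l) * ip n x (u l)"
proof -
  have "ip n x (mv n M (u l)) = ip n x (\<lambda>i. of_real (e l) * u l i)"
    using assms by (intro ip_cong) (auto simp: spectral_def)
  then show ?thesis by (simp add: ip_scale_right)
qed

lemma spectral_ip_left:
  assumes "spectral n M e u" "l < n" "hermitian n M"
  shows "ip n (u l) (mv n M y) = of_real (e l) * ip n (u l) y"
  using arg_cong[OF spectral_ip_right[OF assms(1,2), of y], of cnj]
  by (simp add: cnj_ip ip_hermitian[OF assms(3)])

lemma spectral_ip:
  assumes "spectral n M e u" "hermitian n M"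
  shows "ip n x (mv n M y) = (\<Sum>l<n. of_real (e l) * ip n x (u l) * ip n (u l) y)"
proof -
  have "orthonormal n n u" using assms(1) by (simp add: spectral_def)
  then show ?thesis
    by (subst parseval[of n u]) (auto simp: spectral_ip_left[OF assms(1) _ assms(2)] intro!: sum.cong)
qed

section \<open>Expectations, concentration and symmetrisation\<close>

text \<open>Every \<open>pmf\<close> in use has finite support, so expectations are finite sums and
  integrability is automatic.\<close>

abbreviation EE :: "'a pmf \<Rightarrow> ('a \<Rightarrow> real) \<Rightarrow> real" where
  "EE p f \<equiv> measure_pmf.expectation p f"

lemma EE_eq_sum: "finite (set_pmf p) \<Longrightarrow> EE p f = (\<Sum>x\<in>set_pmf p. pmf p x * f x)"
  by (subst integral_measure_pmf[of "set_pmf p"]) auto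

lemma EE_mono:
  "finite (set_pmf p) \<Longrightarrow> (\<And>x. x \<in> set_pmf p \<Longrightarrow> f x \<le> g x) \<Longrightarrow> EE p f \<le> EE p g"
  by (auto simp: EE_eq_sum intro!: sum_mono mult_left_mono)

lemma EE_cong: "(\<And>x. x \<in> set_pmf p \<Longrightarrow> f x = g x) \<Longrightarrow> EE p f = EE p g"
  by (intro integral_cong_AE) (auto simp: AE_measure_pmf_iff)

lemma EE_nonneg: "(\<And>x. x \<in> set_pmf p \<Longrightarrow> 0 \<le> f x) \<Longrightarrow> 0 \<le> EE p f"
  by (intro integral_nonneg_AE) (auto simp: AE_measure_pmf_iff)

lemma EE_add: "finite (set_pmf p) \<Longrightarrow> EE p (\<lambda>x. f x + g x) = EE p f + EE p g"
  by (simp add: integrable_measure_pmf_finite)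

lemma EE_diff: "finite (set_pmf p) \<Longrightarrow> EE p (\<lambda>x. f x - g x) = EE p f - EE p g"
  by (simp add: integrable_measure_pmf_finite)

lemma EE_sum: "finite (set_pmf p) \<Longrightarrow> EE p (\<lambda>x. \<Sum>i\<in>A. f i x) = (\<Sum>i\<in>A. EE p (f i))"
  by (simp add: integrable_measure_pmf_finite)

lemma EE_scale: "EE p (\<lambda>x. c * f x) = c * EE p f"
  by simp

lemma EE_const: "EE p (\<lambda>x. c) = c"
  by simp

lemma EE_swap:
  assumes "finite (set_pmf p)" "finite (set_pmf q)"
  shows "EE p (\<lambda>x. EE q (f x)) = EE q (\<lambda>y. EE p (\<lambda>x. f x y))"
  by (simp add: assms EE_eq_sum sum_distrib_left mult_ac sum.swap[of _ "set_pmf p"])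

lemma EE_pair:
  assumes "finite (set_pmf p)" "finite (set_pmf q)"
  shows "EE (pair_pmf p q) f = EE p (\<lambda>x. EE q (\<lambda>y. f (x, y)))"
  using assms
  by (auto simp: EE_eq_sum sum_distrib_left sum.cartesian_product pmf_pair mult_ac intro!: sum.cong)

lemma finite_set_Pi_pmf:
  assumes "finite A" "\<And>x. x \<in> A \<Longrightarrow> finite (set_pmf (p x))"
  shows "finite (set_pmf (Pi_pmf A dflt p))"
  using assms by (simp add: set_Pi_pmf finite_PiE_dflt)

lemma EE_Pi_insert:
  assumes "finite A" "x \<notin> A" "\<And>a. a \<in> insert x A \<Longrightarrow> finite (set_pmf (p a))"
  shows "EE (Pi_pmf (insert x A) dflt p) F = EE (p x) (\<lambda>y. EE (Pi_pmf A dflt p) (\<lambda>f. F (f(x := y))))"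
  using assms by (simp add: Pi_pmf_insert EE_pair finite_set_Pi_pmf case_prod_beta)

lemma set_Pi_pmf_insert:
  assumes "finite A" "x \<notin> A"
  shows "set_pmf (Pi_pmf (insert x A) dflt p) = (\<lambda>(y, f). f(x := y)) ` (set_pmf (p x) \<times> set_pmf (Pi_pmf A dflt p))"
  using assms by (simp add: Pi_pmf_insert)

section \<open>Exponential moments and bounded differences\<close>

lemma hoeffding_mgf:
  fixes f :: "'a \<Rightarrow> real"
  assumes fin: "finite (set_pmf p)" and s: "s > 0"
    and range: "\<And>x y. x \<in> set_pmf p \<Longrightarrow> y \<in> set_pmf p \<Longrightarrow> f x - f y \<le> c"
  shows "EE p (\<lambda>x. exp (s * (f x - EE p f))) \<le> exp (s\<^sup>2 * c\<^sup>2 / 8)"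
proof -
  \<comment> \<open>Only the oscillation of \<open>f\<close> is bounded. The minimum over the finite
    support serves as left end of an interval of length \<open>c\<close>, as Hoeffding's lemma
    requires.\<close>
  define a where "a = Min (f ` set_pmf p)"
  have ne: "f ` set_pmf p \<noteq> {}" by (simp add: set_pmf_not_empty)
  have "a \<in> f ` set_pmf p" unfolding a_def using fin ne by (intro Min_in) auto
  then obtain y where y: "y \<in> set_pmf p" "a = f y" by auto
  have lo: "a \<le> f x" if "x \<in> set_pmf p" for x unfolding a_def using fin that by auto
  interpret interval_bounded_random_variable "measure_pmf p" f a "a + c"
    using lo range[OF _ y(1)] y(2)
    by unfold_locales (auto simp: AE_measure_pmf_iff algebra_simps)
  have "ennreal (EE p (\<lambda>x. exp (s * (f x - EE p f)))) = (\<integral>\<^sup>+x. ennreal (exp (s * (f x - EE p f))) \<partial>measure_pmf p)"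
    by (subst nn_integral_eq_integral) (auto simp: integrable_measure_pmf_finite[OF fin])
  also have "\<dots> \<le> ennreal (exp (s\<^sup>2 * (a + c - a)\<^sup>2 / 8))"
    using Hoeffdings_lemma_nn_integral[OF s] by simp
  finally show ?thesis by (simp add: ennreal_le_iff)
qed

text \<open>Averaging out one coordinate splits \<open>F\<close> into its conditional mean
  \<open>g\<close>, which inherits the bounded differences in the remaining coordinates, and a
  centred remainder of oscillation at most \<open>c\<close>, which Hoeffding's lemma controls.
  Differences are required only for points and replacement values in the support.\<close>

lemma bounded_differences_mgf:
  fixes F :: "('i \<Rightarrow> 'a) \<Rightarrow> real"
  assumes "finite A" and s: "s > 0" and "\<And>x. x \<in> A \<Longrightarrow> finite (set_pmf (p x))"
    and "\<And>f x y. f \<in> set_pmf (Pi_pmf A dflt p) \<Longrightarrow> x \<in> A \<Longrightarrow> y \<in> set_pmf (p x) \<Longrightarrow> \<bar>F (f(x := y)) - F f\<bar> \<le> c"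
  shows "EE (Pi_pmf A dflt p) (\<lambda>f. exp (s * (F f - EE (Pi_pmf A dflt p) F))) \<le> exp (s\<^sup>2 * c\<^sup>2 * card A / 8)"
  using assms(1,3,4)
proof (induction A arbitrary: F)
  case empty
  then show ?case by simp
next
  case (insert x A)
  let ?P = "Pi_pmf A dflt p"
  have fin: "finite (set_pmf (p a))" if "a \<in> insert x A" for a using insert.prems(1) that by blast
  have finP: "finite (set_pmf ?P)" using insert.hyps fin by (intro finite_set_Pi_pmf) auto
  define g where "g = (\<lambda>f. EE (p x) (\<lambda>y. F (f(x := y))))"
  have mem: "f(x := y) \<in> set_pmf (Pi_pmf (insert x A) dflt p)" if "f \<in> set_pmf ?P" "y \<in> set_pmf (p x)" for f y
    unfolding set_Pi_pmf_insert[OF insert.hyps] using that by force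
  have E: "EE (Pi_pmf (insert x A) dflt p) G = EE ?P (\<lambda>f. EE (p x) (\<lambda>y. G (f(x := y))))" for G
    by (subst EE_Pi_insert[OF insert.hyps]) (auto intro!: fin EE_swap finP)
  have m: "EE (Pi_pmf (insert x A) dflt p) F = EE ?P g" by (simp add: E g_def)
  have gd: "\<bar>g (f(a := z)) - g f\<bar> \<le> c" if "f \<in> set_pmf ?P" "a \<in> A" "z \<in> set_pmf (p a)" for f a z
  proof -
    have ax: "a \<noteq> x" using insert.hyps that by auto
    have d: "\<bar>F (f(a := z, x := y)) - F (f(x := y))\<bar> \<le> c" if "y \<in> set_pmf (p x)" for y
      unfolding fun_upd_twist[OF ax]
      by (rule insert.prems(2)[OF mem[OF \<open>f \<in> _\<close> that]]) (use \<open>a \<in> A\<close> \<open>z \<in> _\<close> in auto)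
    have "g (f(a := z)) - g f = EE (p x) (\<lambda>y. F (f(a := z, x := y)) - F (f(x := y)))"
      unfolding g_def by (subst EE_diff) (auto intro: fin)
    moreover have "\<dots> \<le> EE (p x) (\<lambda>y. c)" using d by (intro EE_mono fin) fastforce+
    moreover have "EE (p x) (\<lambda>y. - c) \<le> EE (p x) (\<lambda>y. F (f(a := z, x := y)) - F (f(x := y)))"
      using d by (intro EE_mono fin) fastforce+
    ultimately show ?thesis by auto
  qed
  have inner: "EE (p x) (\<lambda>y. exp (s * (F (f(x := y)) - g f))) \<le> exp (s\<^sup>2 * c\<^sup>2 / 8)" if f: "f \<in> set_pmf ?P" for f
  proof -
    have "F (f(x := y)) - F (f(x := z)) \<le> c" if "y \<in> set_pmf (p x)" "z \<in> set_pmf (p x)" for y z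
      using insert.prems(2)[OF mem[OF f that(2)] insertI1 that(1)] unfolding fun_upd_upd by (rule abs_le_D1)
    from hoeffding_mgf[OF fin s, of x "\<lambda>y. F (f(x := y))" c, OF _ this] show ?thesis by (simp add: g_def)
  qed
  have "EE (Pi_pmf (insert x A) dflt p) (\<lambda>f. exp (s * (F f - EE ?P g))) =
      EE ?P (\<lambda>f. exp (s * (g f - EE ?P g)) * EE (p x) (\<lambda>y. exp (s * (F (f(x := y)) - g f))))"
    unfolding E EE_scale[symmetric]
    by (intro EE_cong) (simp flip: exp_add add: algebra_simps)
  also have "\<dots> \<le> EE ?P (\<lambda>f. exp (s * (g f - EE ?P g)) * exp (s\<^sup>2 * c\<^sup>2 / 8))"
    using inner by (intro EE_mono finP mult_left_mono) auto
  also have "\<dots> = EE ?P (\<lambda>f. exp (s * (g f - EE ?P g))) * exp (s\<^sup>2 * c\<^sup>2 / 8)" by simp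
  also have "\<dots> \<le> exp (s\<^sup>2 * c\<^sup>2 * card A / 8) * exp (s\<^sup>2 * c\<^sup>2 / 8)"
    by (intro mult_right_mono insert.IH fin gd) auto
  also have "\<dots> = exp (s\<^sup>2 * c\<^sup>2 * card (insert x A) / 8)"
    using insert.hyps by (simp flip: exp_add add: algebra_simps add_divide_distrib)
  finally show ?case by (simp add: m)
qed

lemma markov_exp:
  assumes "finite (set_pmf p)" "s > 0"
  shows "measure_pmf.prob p {x. F x \<ge> a} \<le> exp (- s * a) * EE p (\<lambda>x. exp (s * F x))"
proof -
  have "measure_pmf.prob p {x. F x \<ge> a} = EE p (indicator {x. F x \<ge> a})" by simp
  also have "\<dots> \<le> EE p (\<lambda>x. exp (- s * a) * exp (s * F x))"
  proof (intro EE_mono assms)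
    fix x
    show "indicator {x. F x \<ge> a} x \<le> exp (- s * a) * exp (s * F x)"
      using assms(2) by (auto simp: indicator_def simp flip: exp_add)
  qed
  also have "\<dots> = exp (- s * a) * EE p (\<lambda>x. exp (s * F x))" by simp
  finally show ?thesis .
qed

theorem mcdiarmid:
  fixes F :: "('i \<Rightarrow> 'a) \<Rightarrow> real"
  assumes A: "finite A" "A \<noteq> {}" and fin: "\<And>x. x \<in> A \<Longrightarrow> finite (set_pmf (p x))" and c: "c > 0" and t: "t > 0"
    and d: "\<And>f x y. f \<in> set_pmf (Pi_pmf A dflt p) \<Longrightarrow> x \<in> A \<Longrightarrow> y \<in> set_pmf (p x) \<Longrightarrow> \<bar>F (f(x := y)) - F f\<bar> \<le> c"
  shows "measure_pmf.prob (Pi_pmf A dflt p) {f. F f \<ge> EE (Pi_pmf A dflt p) F + t} \<le> exp (- 2 * t\<^sup>2 / (c\<^sup>2 * card A))"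
proof -
  let ?P = "Pi_pmf A dflt p"
  \<comment> \<open>The minimiser of
    \<open>- s * t + s\<^sup>2 * c\<^sup>2 * card A / 8\<close>.\<close>
  define s where "s = 4 * t / (c\<^sup>2 * card A)"
  have cA: "card A > 0" using A by (simp add: card_gt_0_iff)
  have s: "s > 0" using c t cA by (simp add: s_def)
  have "measure_pmf.prob ?P {f. F f \<ge> EE ?P F + t} = measure_pmf.prob ?P {f. F f - EE ?P F \<ge> t}"
    by (rule arg_cong[of _ _ "measure_pmf.prob ?P"]) auto
  also have "\<dots> \<le> exp (- s * t) * EE ?P (\<lambda>f. exp (s * (F f - EE ?P F)))"
    by (intro markov_exp s finite_set_Pi_pmf A fin)
  also have "\<dots> \<le> exp (- s * t) * exp (s\<^sup>2 * c\<^sup>2 * card A / 8)"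
    using d by (intro mult_left_mono bounded_differences_mgf A s fin) auto
  also have "\<dots> = exp (- 2 * t\<^sup>2 / (c\<^sup>2 * card A))"
    using c cA by (simp add: s_def power2_eq_square field_simps flip: exp_add)
  finally show ?thesis .
qed

section \<open>Symmetrisation and contraction with random signs\<close>

definition rademacher :: "real pmf" where
  "rademacher = pmf_of_set {1, -1}"

lemma set_rademacher [simp]: "set_pmf rademacher = {1, -1}"
  by (simp add: rademacher_def)

lemma EE_rademacher: "EE rademacher f = (f 1 + f (-1)) / 2"
  unfolding rademacher_def by (subst integral_pmf_of_set) auto

lemma bdd_above_of_abs: "(\<And>D. D \<in> S \<Longrightarrow> \<bar>H D\<bar> \<le> (C::real)) \<Longrightarrow> bdd_above (H ` S)"
  by (rule bdd_aboveI2[of _ _ C]) (meson abs_le_D1)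

lemma SUP_add_le:
  fixes f g :: "'d \<Rightarrow> real"
  assumes "S \<noteq> {}" and le: "\<And>D D'. D \<in> S \<Longrightarrow> D' \<in> S \<Longrightarrow> f D + g D' \<le> R"
  shows "(SUP D\<in>S. f D) + (SUP D\<in>S. g D) \<le> R"
proof -
  have "(SUP D\<in>S. f D) \<le> R - g D'" if "D' \<in> S" for D'
    using assms that by (intro cSUP_least) (auto simp: le_diff_eq)
  then have "(SUP D\<in>S. g D) \<le> R - (SUP D\<in>S. f D)"
    using assms(1) by (intro cSUP_least) (auto simp: algebra_simps)
  then show ?thesis by simp
qed

text \<open>One sign of the Ledoux-Talagrand contraction principle. For any points \<open>D\<close>
  and \<open>D'\<close> in the two suprema on the left, the right-hand side is evaluated at the same
  pair or at the swapped pair, according to the sign of \<open>t D - t D'\<close>; the swap is free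
  because the sum of the two suprema on the right is unchanged when \<open>t\<close> is
  negated.\<close>

lemma contraction:
  fixes H t :: "'d \<Rightarrow> real"
  assumes S: "S \<noteq> {}" and H: "\<And>D. D \<in> S \<Longrightarrow> \<bar>H D\<bar> \<le> C" and t: "\<And>D. D \<in> S \<Longrightarrow> \<bar>t D\<bar> \<le> B"
    and L: "L \<ge> 0" and \<psi>: "\<And>x y. \<bar>\<psi> x - \<psi> y\<bar> \<le> L * \<bar>x - y\<bar>"
  shows "(SUP D\<in>S. H D + 2 * \<psi> (t D)) + (SUP D\<in>S. H D - 2 * \<psi> (t D)) \<le>
    (SUP D\<in>S. H D + 2 * L * t D) + (SUP D\<in>S. H D - 2 * L * t D)"
proof (rule SUP_add_le[OF S])
  have Lt: "\<bar>L * t D\<bar> \<le> L * B" if "D \<in> S" for D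
    unfolding abs_mult using t[OF that] L by (simp add: mult_left_mono)
  have b1: "H D + 2 * L * t D \<le> (SUP D\<in>S. H D + 2 * L * t D)" if "D \<in> S" for D
  proof (rule cSUP_upper[OF that bdd_above_of_abs])
    show "\<bar>H D + 2 * L * t D\<bar> \<le> C + 2 * (L * B)" if "D \<in> S" for D
      using H[OF that] Lt[OF that] by linarith
  qed
  have b2: "H D - 2 * L * t D \<le> (SUP D\<in>S. H D - 2 * L * t D)" if "D \<in> S" for D
  proof (rule cSUP_upper[OF that bdd_above_of_abs])
    show "\<bar>H D - 2 * L * t D\<bar> \<le> C + 2 * (L * B)" if "D \<in> S" for D
      using H[OF that] Lt[OF that] by linarith
  qed
  fix D D' assume D: "D \<in> S" "D' \<in> S"
  have "\<psi> (t D) - \<psi> (t D') \<le> L * t D - L * t D' \<or> \<psi> (t D) - \<psi> (t D') \<le> L * t D' - L * t D"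
    using \<psi>[of "t D" "t D'"] by (auto simp: abs_if right_diff_distrib split: if_splits)
  then show "H D + 2 * \<psi> (t D) + (H D' - 2 * \<psi> (t D')) \<le>
      (SUP D\<in>S. H D + 2 * L * t D) + (SUP D\<in>S. H D - 2 * L * t D)"
    using b1[OF D(1)] b1[OF D(2)] b2[OF D(1)] b2[OF D(2)] by linarith
qed

lemma lipschitz_bound:
  fixes \<psi> :: "real \<Rightarrow> real"
  assumes "L \<ge> 0" "\<And>x y. \<bar>\<psi> x - \<psi> y\<bar> \<le> L * \<bar>x - y\<bar>" "\<bar>t\<bar> \<le> B"
  shows "\<bar>\<psi> t\<bar> \<le> \<bar>\<psi> 0\<bar> + L * B"
proof -
  have "\<bar>\<psi> t - \<psi> 0\<bar> \<le> L * \<bar>t\<bar>" using assms(2)[of t 0] by simp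
  also have "\<dots> \<le> L * B" using assms by (intro mult_left_mono)
  finally show ?thesis by linarith
qed

text \<open>An independent copy of the draw is moved outside the supremum (Jensen). The expression H
  + \<psi>(y') - \<psi>(y) is half of H + 2 \<psi>(y') plus half of H - 2 \<psi>(y), the origin of
  the factor 2. Both draws have the same law, so both halves may be evaluated at the same draw,
  where \<open>contraction\<close> applies; the sign appears only as the average of the two
  resulting suprema.\<close>

lemma symmetrization_step:
  fixes H :: "'d \<Rightarrow> real" and Y :: "'d \<Rightarrow> 'a \<Rightarrow> real"
  assumes fin: "finite (set_pmf p)" and S: "S \<noteq> {}" and H: "\<And>D. D \<in> S \<Longrightarrow> \<bar>H D\<bar> \<le> C"
    and Y: "\<And>D a. D \<in> S \<Longrightarrow> a \<in> set_pmf p \<Longrightarrow> \<bar>Y D a\<bar> \<le> B"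
    and L: "L \<ge> 0" and \<psi>: "\<And>x y. \<bar>\<psi> x - \<psi> y\<bar> \<le> L * \<bar>x - y\<bar>"
  shows "EE p (\<lambda>y. SUP D\<in>S. H D + (EE p (\<lambda>x. \<psi> (Y D x)) - \<psi> (Y D y))) \<le>
    EE (pair_pmf p rademacher) (\<lambda>z. SUP D\<in>S. H D + 2 * L * snd z * Y D (fst z))"
proof -
  define K where "K = \<bar>\<psi> 0\<bar> + L * B"
  have \<psi>K: "\<bar>\<psi> (Y D a)\<bar> \<le> K" if "D \<in> S" "a \<in> set_pmf p" for D a
    unfolding K_def by (rule lipschitz_bound[OF L \<psi> Y[OF that]])
  let ?T = "\<lambda>y y'. SUP D\<in>S. H D + (\<psi> (Y D y') - \<psi> (Y D y))"
  let ?U = "\<lambda>y. SUP D\<in>S. H D + 2 * \<psi> (Y D y)" and ?V = "\<lambda>y. SUP D\<in>S. H D - 2 * \<psi> (Y D y)"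
  have step1: "(SUP D\<in>S. H D + (EE p (\<lambda>x. \<psi> (Y D x)) - \<psi> (Y D y))) \<le> EE p (?T y)" if y: "y \<in> set_pmf p" for y
  proof (rule cSUP_least[OF S])
    fix D assume D: "D \<in> S"
    have "H D + (EE p (\<lambda>x. \<psi> (Y D x)) - \<psi> (Y D y)) = EE p (\<lambda>x. (H D - \<psi> (Y D y)) + \<psi> (Y D x))"
      by (subst EE_add[OF fin]) simp
    also have "\<dots> \<le> EE p (?T y)"
    proof (rule EE_mono[OF fin])
      fix x assume x: "x \<in> set_pmf p"
      have "H D + (\<psi> (Y D x) - \<psi> (Y D y)) \<le> ?T y x"
      proof (rule cSUP_upper[OF D bdd_above_of_abs])
        show "\<bar>H D + (\<psi> (Y D x) - \<psi> (Y D y))\<bar> \<le> C + 2 * K" if "D \<in> S" for D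
          using H[OF that] \<psi>K[OF that x] \<psi>K[OF that y] by linarith
      qed
      then show "H D - \<psi> (Y D y) + \<psi> (Y D x) \<le> ?T y x" by simp
    qed
    finally show "H D + (EE p (\<lambda>x. \<psi> (Y D x)) - \<psi> (Y D y)) \<le> EE p (?T y)" .
  qed
  have step2: "?T y x \<le> ?U x / 2 + ?V y / 2" if y: "y \<in> set_pmf p" and x: "x \<in> set_pmf p" for x y
  proof (rule cSUP_least[OF S])
    fix D assume D: "D \<in> S"
    have "H D + 2 * \<psi> (Y D x) \<le> ?U x"
    proof (rule cSUP_upper[OF D bdd_above_of_abs])
      show "\<bar>H D + 2 * \<psi> (Y D x)\<bar> \<le> C + 2 * K" if "D \<in> S" for D
        using H[OF that] \<psi>K[OF that x] by linarith
    qed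
    moreover have "H D - 2 * \<psi> (Y D y) \<le> ?V y"
    proof (rule cSUP_upper[OF D bdd_above_of_abs])
      show "\<bar>H D - 2 * \<psi> (Y D y)\<bar> \<le> C + 2 * K" if "D \<in> S" for D
        using H[OF that] \<psi>K[OF that y] by linarith
    qed
    ultimately show "H D + (\<psi> (Y D x) - \<psi> (Y D y)) \<le> ?U x / 2 + ?V y / 2" by linarith
  qed
  have "EE p (\<lambda>y. SUP D\<in>S. H D + (EE p (\<lambda>x. \<psi> (Y D x)) - \<psi> (Y D y))) \<le> EE p (\<lambda>y. EE p (?T y))"
    by (intro EE_mono fin step1)
  also have "\<dots> \<le> EE p (\<lambda>y. EE p (\<lambda>x. ?U x / 2 + ?V y / 2))"
    by (intro EE_mono fin step2)
  also have "\<dots> = EE p (\<lambda>y. (?U y + ?V y) / 2)"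
    by (simp add: EE_add[OF fin] add_divide_distrib)
  also have "\<dots> \<le> EE p (\<lambda>y. ((SUP D\<in>S. H D + 2 * L * Y D y) + (SUP D\<in>S. H D - 2 * L * Y D y)) / 2)"
  proof (rule EE_mono[OF fin])
    fix y assume y: "y \<in> set_pmf p"
    show "(?U y + ?V y) / 2 \<le> ((SUP D\<in>S. H D + 2 * L * Y D y) + (SUP D\<in>S. H D - 2 * L * Y D y)) / 2"
      by (intro divide_right_mono contraction[OF S H Y[OF _ y] L \<psi>]) auto
  qed
  also have "\<dots> = EE (pair_pmf p rademacher) (\<lambda>z. SUP D\<in>S. H D + 2 * L * snd z * Y D (fst z))"
    by (subst EE_pair) (simp_all add: fin EE_rademacher mult_ac)
  finally show ?thesis .
qed

text \<open>Coordinates are replaced one at a time, and \<open>G\<close> collects the contributions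
  of those outside \<open>A\<close>. It is generalised in the induction together with its bound,
  which keeps all suprema over bounded families.\<close>

theorem symmetrization_contraction:
  fixes G :: "'d \<Rightarrow> real" and Y :: "'d \<Rightarrow> 'a \<Rightarrow> real"
  assumes fin: "finite (set_pmf p)" and S: "S \<noteq> {}"
    and Y: "\<And>D a. D \<in> S \<Longrightarrow> a \<in> set_pmf p \<Longrightarrow> \<bar>Y D a\<bar> \<le> B"
    and L: "L \<ge> 0" and \<psi>: "\<And>x y. \<bar>\<psi> x - \<psi> y\<bar> \<le> L * \<bar>x - y\<bar>"
    and A: "finite A" and G: "\<And>D. D \<in> S \<Longrightarrow> \<bar>G D\<bar> \<le> C"
  shows "EE (Pi_pmf A dflt (\<lambda>_. p)) (\<lambda>a. SUP D\<in>S. G D + (\<Sum>j\<in>A. EE p (\<lambda>x. \<psi> (Y D x)) - \<psi> (Y D (a j)))) \<le>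
    EE (Pi_pmf A dflt' (\<lambda>_. pair_pmf p rademacher)) (\<lambda>z. SUP D\<in>S. G D + (\<Sum>j\<in>A. 2 * L * snd (z j) * Y D (fst (z j))))"
  using A G
proof (induction A arbitrary: G C)
  case empty
  then show ?case by simp
next
  case (insert x A)
  let ?P = "Pi_pmf A dflt (\<lambda>_. p)" and ?Q = "Pi_pmf A dflt' (\<lambda>_. pair_pmf p rademacher)"
  let ?d = "\<lambda>D y. EE p (\<lambda>x. \<psi> (Y D x)) - \<psi> (Y D y)"
  let ?s = "\<lambda>D z. \<Sum>j\<in>A. 2 * L * snd (z j) * Y D (fst (z j))"
  have fin2: "finite (set_pmf (pair_pmf p rademacher))" using fin by simp
  have finP: "finite (set_pmf ?P)" "finite (set_pmf ?Q)"
    using insert.hyps fin by (auto intro!: finite_set_Pi_pmf)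
  define K where "K = \<bar>\<psi> 0\<bar> + L * B"
  have \<psi>K: "\<bar>\<psi> (Y D a)\<bar> \<le> K" if "D \<in> S" "a \<in> set_pmf p" for D a
    unfolding K_def by (rule lipschitz_bound[OF L \<psi> Y[OF that]])
  have E\<psi>: "\<bar>EE p (\<lambda>x. \<psi> (Y D x))\<bar> \<le> K" if "D \<in> S" for D
  proof -
    have "EE p (\<lambda>x. \<psi> (Y D x)) \<le> EE p (\<lambda>x. K)" "EE p (\<lambda>x. - K) \<le> EE p (\<lambda>x. \<psi> (Y D x))"
      using \<psi>K[OF that] by (intro EE_mono fin; force simp: abs_le_iff)+
    then show ?thesis by auto
  qed
  have sb: "\<bar>?s D z\<bar> \<le> card A * (2 * L * B)" if "D \<in> S" "z \<in> set_pmf ?Q" for D z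
  proof -
    have "\<bar>2 * L * snd (z j) * Y D (fst (z j))\<bar> \<le> 2 * L * B" if "j \<in> A" for j
    proof -
      have "z j \<in> set_pmf p \<times> {1, -1}"
        using \<open>z \<in> _\<close> that insert.hyps by (auto simp: set_Pi_pmf PiE_dflt_def)
      then show ?thesis using Y[OF \<open>D \<in> S\<close>, of "fst (z j)"] L by (auto simp: abs_mult mult_left_mono)
    qed
    then have "\<bar>?s D z\<bar> \<le> (\<Sum>j\<in>A. 2 * L * B)"
      by (intro order.trans[OF sum_abs] sum_mono) auto
    then show ?thesis by simp
  qed
  have "EE (Pi_pmf (insert x A) dflt (\<lambda>_. p)) (\<lambda>a. SUP D\<in>S. G D + (\<Sum>j\<in>insert x A. ?d D (a j))) =
      EE p (\<lambda>y. EE ?P (\<lambda>a. SUP D\<in>S. (G D + ?d D y) + (\<Sum>j\<in>A. ?d D (a j))))"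
  proof -
    have "(\<Sum>j\<in>A. ?d D ((a(x := y)) j)) = (\<Sum>j\<in>A. ?d D (a j))" for D a y
      using insert.hyps by (intro sum.cong) auto
    then show ?thesis
      by (subst EE_Pi_insert[OF insert.hyps fin]) (simp add: insert.hyps add.assoc)
  qed
  also have "\<dots> \<le> EE p (\<lambda>y. EE ?Q (\<lambda>z. SUP D\<in>S. (G D + ?d D y) + ?s D z))"
  proof (rule EE_mono[OF fin], rule insert.IH)
    show "\<bar>G D + ?d D y\<bar> \<le> C + 2 * K" if "y \<in> set_pmf p" "D \<in> S" for y D
      using insert.prems[OF that(2)] E\<psi>[OF that(2)] \<psi>K[OF that(2,1)] by linarith
  qed
  also have "\<dots> = EE ?Q (\<lambda>z. EE p (\<lambda>y. SUP D\<in>S. (G D + ?s D z) + ?d D y))"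
    by (subst EE_swap[OF fin finP(2)]) (simp add: algebra_simps)
  also have "\<dots> \<le> EE ?Q (\<lambda>z. EE (pair_pmf p rademacher) (\<lambda>v. SUP D\<in>S. (G D + ?s D z) + 2 * L * snd v * Y D (fst v)))"
  proof (rule EE_mono[OF finP(2)])
    fix z assume z: "z \<in> set_pmf ?Q"
    show "EE p (\<lambda>y. SUP D\<in>S. (G D + ?s D z) + ?d D y) \<le>
      EE (pair_pmf p rademacher) (\<lambda>v. SUP D\<in>S. (G D + ?s D z) + 2 * L * snd v * Y D (fst v))"
    proof (rule symmetrization_step[OF fin S _ Y L \<psi>])
      show "\<bar>G D + ?s D z\<bar> \<le> C + card A * (2 * L * B)" if "D \<in> S" for D
        using insert.prems[OF that] sb[OF that z] by linarith
    qed
  qed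
  also have "\<dots> = EE (pair_pmf p rademacher) (\<lambda>v. EE ?Q (\<lambda>z. SUP D\<in>S. G D + (2 * L * snd v * Y D (fst v) + ?s D z)))"
    by (subst EE_swap[OF finP(2) fin2]) (simp add: algebra_simps)
  also have "\<dots> = EE (Pi_pmf (insert x A) dflt' (\<lambda>_. pair_pmf p rademacher))
      (\<lambda>z. SUP D\<in>S. G D + (\<Sum>j\<in>insert x A. 2 * L * snd (z j) * Y D (fst (z j))))"
  proof -
    have "?s D (z(x := v)) = ?s D z" for D z v
      using insert.hyps by (intro sum.cong) auto
    then show ?thesis
      by (subst EE_Pi_insert[OF insert.hyps fin2]) (simp add: insert.hyps add.assoc)
  qed
  finally show ?case .
qed

text \<open>A law-preserving change of one independent coordinate preserves the joint law. With
  \<open>h\<close> the flip of a sign, this gives averaging over that sign alone.\<close>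

lemma EE_Pi_flip:
  assumes A: "finite A" "j \<in> A" and fin: "\<And>x. x \<in> A \<Longrightarrow> finite (set_pmf (p x))"
    and flip: "map_pmf h (p j) = p j"
  shows "EE (Pi_pmf A dflt p) F = EE (Pi_pmf A dflt p) (\<lambda>f. F (f(j := h (f j))))"
proof -
  have ins: "A = insert j (A - {j})" using A by auto
  let ?P = "Pi_pmf (A - {j}) dflt p"
  have E: "EE (Pi_pmf A dflt p) G = EE (p j) (\<lambda>y. EE ?P (\<lambda>f. G (f(j := y))))" for G
    by (subst ins, subst EE_Pi_insert) (use A fin in auto)
  have "EE (Pi_pmf A dflt p) F = EE (map_pmf h (p j)) (\<lambda>y. EE ?P (\<lambda>f. F (f(j := y))))"
    by (simp only: flip E)
  also have "\<dots> = EE (Pi_pmf A dflt p) (\<lambda>f. F (f(j := h (f j))))"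
    by (subst E) simp
  finally show ?thesis .
qed

lemma EE_Pi_fst:
  assumes "finite A"
  shows "EE (Pi_pmf A dflt (\<lambda>_. p)) F = EE (Pi_pmf A (dflt, c) (\<lambda>_. pair_pmf p q)) (\<lambda>z. F (\<lambda>j. fst (z j)))"
proof -
  have "Pi_pmf A dflt (\<lambda>_. map_pmf fst (pair_pmf p q)) = map_pmf (\<lambda>h. fst \<circ> h) (Pi_pmf A (dflt, c) (\<lambda>_. pair_pmf p q))"
    by (rule Pi_pmf_map) (use assms in auto)
  then show ?thesis by (simp add: map_fst_pair_pmf o_def)
qed

section \<open>Unitary invariance of the moments of a design\<close>

definition qf :: "nat \<Rightarrow> cmat \<Rightarrow> cvec \<Rightarrow> complex" where
  "qf n M v = ip n v (mv n M v)"

lemma dim_tensor_power: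
  "dim_row (tensor_power A t) = dim_row A ^ t" "dim_col (tensor_power A t) = dim_col A ^ t"
  by (induction t) (auto simp: kronecker_def)

text \<open>Indices are read in base n, with the outermost tensor factor as the leading
  digit.\<close>

lemma tensor_power_Suc_index:
  assumes A: "A \<in> carrier_mat n n" and "i < n" "k < n" "j' < n ^ t" "k' < n ^ t"
  shows "i * n ^ t + j' < n ^ Suc t"
    and "tensor_power A (Suc t) $$ (i * n ^ t + j', k * n ^ t + k') = A $$ (i, k) * tensor_power A t $$ (j', k')"
proof -
  have lt: "i * n ^ t + j' < n * n ^ t" if "i < n" "j' < n ^ t" for i j'
  proof -
    have "i * n ^ t + j' < Suc i * n ^ t" using that by simp
    also have "\<dots> \<le> n * n ^ t" using that by (intro mult_right_mono) auto
    finally show ?thesis .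
  qed
  show "i * n ^ t + j' < n ^ Suc t" using lt assms by simp
  show "tensor_power A (Suc t) $$ (i * n ^ t + j', k * n ^ t + k') = A $$ (i, k) * tensor_power A t $$ (j', k')"
    using A assms(2-) lt[of i j'] lt[of k k'] unfolding tensor_power.simps
    by (simp add: kronecker_def dim_tensor_power)
qed

text \<open>\<open>A\<close> is a whole family so that a single pair of indices serves all its
  members: one entry of the moment identity can then be read for the design vectors and for all
  lines of projective space at once.\<close>

lemma tensor_power_4_entries:
  assumes A: "\<And>L. A L \<in> carrier_mat n n"
    and "j1 < n" "j2 < n" "j3 < n" "j4 < n" "k1 < n" "k2 < n" "k3 < n" "k4 < n"
  shows "\<exists>j < n ^ 4. \<exists>k < n ^ 4. \<forall>L. tensor_power (A L) 4 $$ (j, k) =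
    A L $$ (j1, k1) * (A L $$ (j2, k2) * (A L $$ (j3, k3) * A L $$ (j4, k4)))"
proof -
  let ?j1 = "j4 * n ^ 0 + 0" and ?k1 = "k4 * n ^ 0 + 0"
  let ?j2 = "j3 * n ^ 1 + ?j1" and ?k2 = "k3 * n ^ 1 + ?k1"
  let ?j3 = "j2 * n ^ 2 + ?j2" and ?k3 = "k2 * n ^ 2 + ?k2"
  let ?j4 = "j1 * n ^ 3 + ?j3" and ?k4 = "k1 * n ^ 3 + ?k3"
  have n: "(4::nat) = Suc 3" "(3::nat) = Suc 2" "(2::nat) = Suc 1" "(1::nat) = Suc 0" by simp_all
  have J1: "?j1 < n ^ 1" "?k1 < n ^ 1" using assms by auto
  have J2: "?j2 < n ^ 2" "?k2 < n ^ 2"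
    using tensor_power_Suc_index(1)[OF A \<open>j3 < n\<close> \<open>j3 < n\<close> J1(1) J1(1)]
      tensor_power_Suc_index(1)[OF A \<open>k3 < n\<close> \<open>k3 < n\<close> J1(2) J1(2)] by (simp_all only: n)
  have J3: "?j3 < n ^ 3" "?k3 < n ^ 3"
    using tensor_power_Suc_index(1)[OF A \<open>j2 < n\<close> \<open>j2 < n\<close> J2(1) J2(1)]
      tensor_power_Suc_index(1)[OF A \<open>k2 < n\<close> \<open>k2 < n\<close> J2(2) J2(2)] by (simp_all only: n)
  have J4: "?j4 < n ^ 4" "?k4 < n ^ 4"
    using tensor_power_Suc_index(1)[OF A \<open>j1 < n\<close> \<open>j1 < n\<close> J3(1) J3(1)]
      tensor_power_Suc_index(1)[OF A \<open>k1 < n\<close> \<open>k1 < n\<close> J3(2) J3(2)] by (simp_all only: n)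
  have "tensor_power (A L) 4 $$ (?j4, ?k4) =
    A L $$ (j1, k1) * (A L $$ (j2, k2) * (A L $$ (j3, k3) * A L $$ (j4, k4)))" for L
  proof -
    have "tensor_power (A L) 4 $$ (?j4, ?k4) = A L $$ (j1, k1) * tensor_power (A L) 3 $$ (?j3, ?k3)"
      using tensor_power_Suc_index(2)[OF A assms(2,6) J3] by (simp only: n)
    also have "tensor_power (A L) 3 $$ (?j3, ?k3) = A L $$ (j2, k2) * tensor_power (A L) 2 $$ (?j2, ?k2)"
      using tensor_power_Suc_index(2)[OF A assms(3,7) J2] by (simp only: n)
    also have "tensor_power (A L) 2 $$ (?j2, ?k2) = A L $$ (j3, k3) * tensor_power (A L) 1 $$ (?j1, ?k1)"
      using tensor_power_Suc_index(2)[OF A assms(4,8) J1] by (simp only: n)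
    also have "tensor_power (A L) 1 $$ (?j1, ?k1) = A L $$ (j4, k4) * tensor_power (A L) 0 $$ (0, 0)"
      using tensor_power_Suc_index(2)[OF A assms(5,9), of 0 0 0] by (simp only: n) simp
    finally show ?thesis by simp
  qed
  then show ?thesis using J4 by blast
qed

section \<open>Unitary action and measurability on projective space\<close>

lemma space_sphere_measurable [simp]: "space (sphere_measurable n) = unit_sphere n"
  by (simp add: sphere_measurable_def)

lemma space_proj_measurable [simp]: "space (proj_measurable n) = proj_space n"
  unfolding proj_measurable_def by (subst space_measure_of) auto

lemma sets_proj_measurableI:
  assumes "S \<subseteq> proj_space n" "{v \<in> unit_sphere n. complex_line v \<in> S} \<in> sets (sphere_measurable n)"
  shows "S \<in> sets (proj_measurable n)"
  unfolding proj_measurable_def using assms by (intro in_measure_of) auto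

lemma coord_measurable:
  assumes "i < n"
  shows "(\<lambda>v. v $ i) \<in> borel_measurable (sphere_measurable n)"
proof -
  have 1: "(\<lambda>v. \<lambda>i\<in>{..<n}. v $ i) \<in> measurable (sphere_measurable n) (PiM {..<n} (\<lambda>_. borel :: complex measure))"
    unfolding sphere_measurable_def by (rule measurable_vimage_algebra1) (auto simp: space_PiM)
  have 2: "(\<lambda>x. x i) \<in> measurable (PiM {..<n} (\<lambda>_. borel :: complex measure)) borel"
    using assms by (intro measurable_component_singleton) auto
  have "(\<lambda>v. (\<lambda>i\<in>{..<n}. v $ i) i) \<in> measurable (sphere_measurable n) (borel :: complex measure)"
    by (rule measurable_compose[OF 1 2])
  then show ?thesis using assms by simp
qed

lemma complex_line_in_proj: "v \<in> unit_sphere n \<Longrightarrow> complex_line v \<in> proj_space n"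
  by (simp add: proj_space_def)

lemma proj_function_measurable:
  fixes g :: "complex vec set \<Rightarrow> complex"
  assumes "(\<lambda>v. g (complex_line v)) \<in> borel_measurable (sphere_measurable n)"
  shows "g \<in> borel_measurable (proj_measurable n)"
proof (rule measurableI)
  fix B :: "complex set" assume B: "B \<in> sets borel"
  have "{v \<in> unit_sphere n. complex_line v \<in> g -` B \<inter> space (proj_measurable n)} =
      (\<lambda>v. g (complex_line v)) -` B \<inter> space (sphere_measurable n)"
    by (auto simp: complex_line_in_proj)
  then show "g -` B \<inter> space (proj_measurable n) \<in> sets (proj_measurable n)"
    using measurable_sets[OF assms B] by (intro sets_proj_measurableI) auto
qed auto

lemma mat_mult_vec_mv:
  assumes "v \<in> carrier_vec n" "i < n"
  shows "(mat n n (\<lambda>(i, j). M i j) *\<^sub>v v) $ i = mv n M (vec_index v) i"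
  using assms by (auto simp: mv_def scalar_prod_def atLeast0LessThan intro!: sum.cong)

definition unitary_fun :: "nat \<Rightarrow> cmat \<Rightarrow> bool" where
  "unitary_fun n M \<longleftrightarrow> (\<forall>i<n. \<forall>j<n. (\<Sum>a<n. cnj (M a i) * M a j) = (if i = j then 1 else 0))"

lemma unitary_fun_mat:
  assumes "unitary_fun n M"
  shows "mat n n (\<lambda>(i, j). M i j) \<in> unitary_mats n"
proof -
  let ?U = "mat n n (\<lambda>(i, j). M i j)"
  have "mat_adjoint ?U * ?U = 1\<^sub>m n"
  proof (rule eq_matI)
    fix i j assume "i < dim_row (1\<^sub>m n :: complex mat)" "j < dim_col (1\<^sub>m n :: complex mat)"
    then have ij: "i < n" "j < n" by auto
    have "(mat_adjoint ?U * ?U) $$ (i, j) = (\<Sum>a<n. cnj (M a i) * M a j)"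
      using ij by (auto simp: mat_adjoint_def scalar_prod_def atLeast0LessThan mat_of_rows_def intro!: sum.cong)
    then show "(mat_adjoint ?U * ?U) $$ (i, j) = 1\<^sub>m n $$ (i, j)"
      using assms ij by (simp add: unitary_fun_def)
  qed (auto simp: mat_adjoint_def)
  then show ?thesis by (simp add: unitary_mats_def)
qed

lemma unitary_fun_sqn:
  assumes "unitary_fun n M"
  shows "sqn n (mv n M v) = sqn n v"
proof -
  have "ip n (mv n M v) (mv n M v) = (\<Sum>a<n. \<Sum>i<n. \<Sum>j<n. (cnj (M a i) * M a j) * (cnj (v i) * v j))"
    unfolding ip_def mv_def cnj_sum sum_product by (simp add: mult_ac)
  also have "\<dots> = (\<Sum>i<n. \<Sum>a<n. \<Sum>j<n. (cnj (M a i) * M a j) * (cnj (v i) * v j))" by (rule sum.swap)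
  also have "\<dots> = (\<Sum>i<n. \<Sum>j<n. \<Sum>a<n. (cnj (M a i) * M a j) * (cnj (v i) * v j))"
    by (intro sum.cong refl sum.swap)
  also have "\<dots> = (\<Sum>i<n. \<Sum>j<n. if i = j then cnj (v i) * v j else 0)"
    using assms by (intro sum.cong refl) (auto simp: unitary_fun_def simp flip: sum_distrib_right)
  also have "\<dots> = ip n v v" by (simp add: ip_def)
  finally show ?thesis by (simp add: sqn_alt)
qed

lemma unit_sphere_iff: "v \<in> unit_sphere n \<longleftrightarrow> v \<in> carrier_vec n \<and> sqn n (vec_index v) = 1"
  by (auto simp: unit_sphere_def l2_norm_def L2_set_def sqn_def)

definition act :: "nat \<Rightarrow> cmat \<Rightarrow> complex vec \<Rightarrow> complex vec" where
  "act n M v = mat n n (\<lambda>(i, j). M i j) *\<^sub>v v"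

lemma sqn_act: "v \<in> carrier_vec n \<Longrightarrow> sqn n (vec_index (act n M v)) = sqn n (mv n M (vec_index v))"
  unfolding act_def by (intro sqn_cong mat_mult_vec_mv)

lemma act_carrier [simp]: "act n M v \<in> carrier_vec n"
  unfolding act_def by (rule carrier_vecI) simp

lemma act_sphere:
  assumes "unitary_fun n M" "v \<in> unit_sphere n"
  shows "act n M v \<in> unit_sphere n"
  using assms sqn_act[of v n M] unitary_fun_sqn[OF assms(1), of "vec_index v"]
  by (auto simp: unit_sphere_iff)

lemma act_line:
  assumes "v \<in> carrier_vec n"
  shows "act n M ` complex_line v = complex_line (act n M v)"
  unfolding complex_line_def act_def image_image
  using assms by (intro image_cong refl mult_mat_vec) auto

lemma act_measurable:
  assumes "unitary_fun n M"
  shows "act n M \<in> measurable (sphere_measurable n) (sphere_measurable n)"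
proof -
  have "(\<lambda>v. \<lambda>i\<in>{..<n}. act n M v $ i) \<in> measurable (sphere_measurable n) (PiM {..<n} (\<lambda>_. borel))"
  proof (rule measurable_restrict)
    fix i assume i: "i \<in> {..<n}"
    have "(\<lambda>v. \<Sum>j<n. M i j * v $ j) \<in> borel_measurable (sphere_measurable n)"
      by (intro borel_measurable_sum borel_measurable_times borel_measurable_const coord_measurable) auto
    then show "(\<lambda>v. act n M v $ i) \<in> borel_measurable (sphere_measurable n)"
      using i by (subst measurable_cong[where g = "\<lambda>v. \<Sum>j<n. M i j * v $ j"])
        (auto simp: act_def mat_mult_vec_mv unit_sphere_iff mv_def simp del: index_mult_mat_vec)
  qed
  then have "act n M \<in> measurable (sphere_measurable n)
      (vimage_algebra (unit_sphere n) (\<lambda>v. \<lambda>i\<in>{..<n}. v $ i) (PiM {..<n} (\<lambda>_. borel)))"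
    using act_sphere[OF assms] by (intro measurable_vimage_algebra2) auto
  then show ?thesis unfolding sphere_measurable_def .
qed

lemma line_act_measurable:
  assumes M: "unitary_fun n M"
  shows "(\<lambda>L. act n M ` L) \<in> measurable (proj_measurable n) (proj_measurable n)"
proof -
  have "(\<lambda>L. act n M ` L) \<in> measurable (proj_measurable n)
     (sigma (proj_space n) {S. S \<subseteq> proj_space n \<and> {v \<in> unit_sphere n. complex_line v \<in> S} \<in> sets (sphere_measurable n)})"
  proof (rule measurable_measure_of)
    show "(\<lambda>L. act n M ` L) \<in> space (proj_measurable n) \<rightarrow> proj_space n"
      using act_sphere[OF M] act_line[of _ n M] by (auto simp: proj_space_def unit_sphere_iff)
    fix S assume S: "S \<in> {S. S \<subseteq> proj_space n \<and> {v \<in> unit_sphere n. complex_line v \<in> S} \<in> sets (sphere_measurable n)}"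
    have "{v \<in> unit_sphere n. complex_line v \<in> (\<lambda>L. act n M ` L) -` S \<inter> space (proj_measurable n)} =
       act n M -` {v \<in> unit_sphere n. complex_line v \<in> S} \<inter> space (sphere_measurable n)"
      using act_sphere[OF M] act_line[of _ n M] by (auto simp: complex_line_in_proj unit_sphere_iff)
    also have "\<dots> \<in> sets (sphere_measurable n)"
      using S by (intro measurable_sets[OF act_measurable[OF M]]) auto
    finally show "(\<lambda>L. act n M ` L) -` S \<inter> space (proj_measurable n) \<in> sets (proj_measurable n)"
      by (intro sets_proj_measurableI) auto
  qed auto
  then show ?thesis by (simp only: proj_measurable_def)
qed

text \<open>For square matrices a left inverse is a right inverse; hence the adjoint of a unitary
  matrix is unitary too, although \<open>unitary_fun\<close> states only one of the two
  products.\<close>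

lemma act_adjoint:
  assumes M: "unitary_fun n M" and v: "v \<in> carrier_vec n"
  defines "M' \<equiv> \<lambda>i j. cnj (M j i)"
  shows "act n M' (act n M v) = v" "act n M (act n M' v) = v" "unitary_fun n M'"
proof -
  let ?U = "mat n n (\<lambda>(i, j). M i j)" and ?V = "mat n n (\<lambda>(i, j). M' i j)"
  have VU: "?V * ?U = 1\<^sub>m n"
    using M by (intro eq_matI) (auto simp: M'_def scalar_prod_def unitary_fun_def atLeast0LessThan)
  have UV: "?U * ?V = 1\<^sub>m n"
    by (rule mat_mult_left_right_inverse[OF _ _ VU]) auto
  show "act n M' (act n M v) = v"
    unfolding act_def using v VU by (subst assoc_mult_mat_vec[symmetric]) auto
  show "act n M (act n M' v) = v"
    unfolding act_def using v UV by (subst assoc_mult_mat_vec[symmetric]) auto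
  have "(\<Sum>a<n. M i a * cnj (M j a)) = (if i = j then 1 else 0)" if "i < n" "j < n" for i j
    using arg_cong[OF UV, of "\<lambda>A. A $$ (i, j)"] that
    by (simp add: M'_def scalar_prod_def atLeast0LessThan)
  then show "unitary_fun n M'" by (auto simp: unitary_fun_def M'_def)
qed

text \<open>Invariance is given for direct images of sets, while \<open>distr\<close> measures
  preimages. The preimage under \<open>M\<close> is the image under its adjoint, which is again
  unitary.\<close>

lemma invariant_distr:
  assumes inv: "unitarily_invariant_prob n \<mu>" and M: "unitary_fun n M"
  shows "distr \<mu> \<mu> (\<lambda>L. act n M ` L) = \<mu>"
proof (rule measure_eqI)
  let ?M' = "\<lambda>i j. cnj (M j i)"
  have sp: "space \<mu> = proj_space n" and st: "sets \<mu> = sets (proj_measurable n)"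
    using inv by (auto simp: unitarily_invariant_prob_def)
  have meas: "(\<lambda>L. act n M ` L) \<in> measurable \<mu> \<mu>"
    using line_act_measurable[OF M] measurable_cong_sets[OF st st] by blast
  have L: "act n ?M' ` act n M ` L = L" "act n M ` act n ?M' ` L = L" "act n ?M' ` L \<in> proj_space n"
    if Lp: "L \<in> proj_space n" for L
  proof -
    obtain v where v: "L = complex_line v" "v \<in> unit_sphere n" using Lp unfolding proj_space_def by blast
    then have vc: "v \<in> carrier_vec n" by (simp add: unit_sphere_iff)
    have a: "act n M v \<in> carrier_vec n" "act n ?M' v \<in> carrier_vec n"
      by auto
    show "act n ?M' ` act n M ` L = L" "act n M ` act n ?M' ` L = L"
      unfolding v(1) using act_line[OF vc] act_line[OF a(1)] act_line[OF a(2)] act_adjoint[OF M vc] by auto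
    show "act n ?M' ` L \<in> proj_space n"
      unfolding v(1) act_line[OF vc]
      by (intro complex_line_in_proj act_sphere[OF act_adjoint(3)[OF M vc] v(2)])
  qed
  fix S assume S: "S \<in> sets (distr \<mu> \<mu> (\<lambda>L. act n M ` L))"
  then have S': "S \<in> sets \<mu>" and sub: "S \<subseteq> proj_space n" using sets.sets_into_space[of S \<mu>] sp by auto
  have eq: "(\<lambda>L. act n M ` L) -` S \<inter> space \<mu> = (\<lambda>L. act n ?M' ` L) ` S"
  proof (intro equalityI subsetI)
    fix L assume "L \<in> (\<lambda>L. act n M ` L) -` S \<inter> space \<mu>"
    then show "L \<in> (\<lambda>L. act n ?M' ` L) ` S"
      using L(1)[of L] sp by (intro image_eqI[of _ _ "act n M ` L"]) auto
  next
    fix L assume "L \<in> (\<lambda>L. act n ?M' ` L) ` S"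
    then show "L \<in> (\<lambda>L. act n M ` L) -` S \<inter> space \<mu>"
      using L(2,3) sub sp by auto
  qed
  have ad: "mat n n (\<lambda>(i, j). ?M' i j) \<in> unitary_mats n"
    by (rule unitary_fun_mat[OF act_adjoint(3)[OF M, of "0\<^sub>v n"]]) auto
  have "emeasure (distr \<mu> \<mu> (\<lambda>L. act n M ` L)) S = emeasure \<mu> ((\<lambda>L. act n ?M' ` L) ` S)"
    using emeasure_distr[OF meas S'] eq by simp
  also have "\<dots> = emeasure \<mu> S"
    using inv ad S' unfolding unitarily_invariant_prob_def act_def by blast
  finally show "emeasure (distr \<mu> \<mu> (\<lambda>L. act n M ` L)) S = emeasure \<mu> S" .
qed simp

section \<open>From design averages to integrals over projective space\<close>

lemma qf_outer:
  assumes "v \<in> carrier_vec n"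
  shows "qf n Z (vec_index v) = (\<Sum>k<n. \<Sum>j<n. Z k j * outer_self v $$ (j, k))"
  using assms unfolding qf_def ip_def mv_def sum_distrib_left
  by (intro sum.cong refl) (auto simp: outer_self_def)

lemma product4_expand:
  fixes f1 f2 f3 f4 :: "'a \<Rightarrow> 'c::comm_semiring_1"
  shows "sum f1 I * sum f2 I * sum f3 I * sum f4 I =
    (\<Sum>a\<in>I. \<Sum>b\<in>I. \<Sum>c\<in>I. \<Sum>d\<in>I. f1 a * f2 b * f3 c * f4 d)"
  by (simp add: mult.assoc flip: sum_distrib_left sum_distrib_right)

definition design_sum :: "nat \<Rightarrow> (nat \<Rightarrow> real) \<Rightarrow> (nat \<Rightarrow> complex vec) \<Rightarrow> (cvec \<Rightarrow> complex) \<Rightarrow> complex" where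
  "design_sum N p w F = (\<Sum>i<N. of_real (p i) * F (vec_index (w i)))"

lemma qf_mv:
  "qf n Z (mv n M v) = qf n (\<lambda>i j. \<Sum>a<n. \<Sum>b<n. cnj (M a i) * Z a b * M b j) v"
proof -
  have "qf n Z (mv n M v) = (\<Sum>a<n. \<Sum>i<n. \<Sum>b<n. \<Sum>j<n. cnj (v i) * (cnj (M a i) * Z a b * M b j * v j))"
    unfolding qf_def ip_def mv_def cnj_sum sum_product unfolding sum_distrib_left by (simp add: mult_ac)
  also have "\<dots> = (\<Sum>i<n. \<Sum>a<n. \<Sum>b<n. \<Sum>j<n. cnj (v i) * (cnj (M a i) * Z a b * M b j * v j))"
    by (rule sum.swap)
  also have "\<dots> = (\<Sum>i<n. \<Sum>a<n. \<Sum>j<n. \<Sum>b<n. cnj (v i) * (cnj (M a i) * Z a b * M b j * v j))"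
    by (intro sum.cong refl sum.swap)
  also have "\<dots> = (\<Sum>i<n. \<Sum>j<n. \<Sum>a<n. \<Sum>b<n. cnj (v i) * (cnj (M a i) * Z a b * M b j * v j))"
    by (intro sum.cong refl sum.swap)
  also have "\<dots> = qf n (\<lambda>i j. \<Sum>a<n. \<Sum>b<n. cnj (M a i) * Z a b * M b j) v"
    unfolding qf_def ip_def mv_def by (simp add: sum_distrib_left sum_distrib_right)
  finally show ?thesis .
qed

text \<open>A product of four quadratic forms is linear in the entries of the fourth tensor power of
  \<open>outer_self v\<close>, so its design average equals an integral over projective space.
  There, replacing v by M v is a measure-preserving change of variable; in the forms it replaces Z
  by the conjugated matrix \<open>T Z\<close>.\<close>

theorem design_invariant:
  assumes des: "weighted_projective_design 4 n N p w" and M: "unitary_fun n M"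
  shows "design_sum N p w (\<lambda>v. qf n Z1 (mv n M v) * qf n Z2 (mv n M v) * qf n Z3 (mv n M v) * qf n Z4 (mv n M v)) =
    design_sum N p w (\<lambda>v. qf n Z1 v * qf n Z2 v * qf n Z3 v * qf n Z4 v)"
proof -
  have w: "w i \<in> carrier_vec n" if "i < N" for i
    using des that by (simp add: weighted_projective_design_def)
  obtain \<mu> where inv: "unitarily_invariant_prob n \<mu>" and mom: "\<And>j k. j < n ^ 4 \<Longrightarrow> k < n ^ 4 \<Longrightarrow>
    (\<Sum>i<N. of_real (p i) * tensor_power (outer_self (w i)) 4 $$ (j, k)) =
           (LINT L|\<mu>. tensor_power (outer_self (unit_rep L)) 4 $$ (j, k))"
    using des unfolding weighted_projective_design_def by blast
  interpret prob_space \<mu> using inv by (simp add: unitarily_invariant_prob_def)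
  have sp: "space \<mu> = proj_space n" and st: "sets \<mu> = sets (proj_measurable n)"
    using inv by (auto simp: unitarily_invariant_prob_def)
  \<comment> \<open>An entry of \<open>outer_self v\<close> depends only on the line of
    \<open>v\<close>. The value 0 outside the index range keeps these functions measurable, and
    bounded on projective space, for every index.\<close>
  define oL where "oL = (\<lambda>L (j, k). if j < n \<and> k < n then outer_self (unit_rep L) $$ (j, k) else 0)"
  have O_line: "oL (complex_line v) (j, k) = v $ j * cnj (v $ k)" if "v \<in> unit_sphere n" "j < n" "k < n" for v j k
    using that outer_self_unit_rep[OF that(1)] by (auto simp: oL_def outer_self_def unit_sphere_iff)
  have O_meas: "(\<lambda>L. oL L x) \<in> borel_measurable \<mu>" for x
  proof (cases x)
    case (Pair j k)
    have "(\<lambda>L. oL L x) \<in> borel_measurable (proj_measurable n)"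
    proof (cases "j < n \<and> k < n")
      case True
      show ?thesis
      proof (rule proj_function_measurable)
        have "(\<lambda>v. v $ j * cnj (v $ k)) \<in> borel_measurable (sphere_measurable n)"
          using True by (intro borel_measurable_times coord_measurable
              measurable_compose[OF coord_measurable borel_measurable_continuous_onI[OF continuous_on_cnj[OF continuous_on_id]]]) auto
        then show "(\<lambda>v. oL (complex_line v) x) \<in> borel_measurable (sphere_measurable n)"
          using True Pair by (subst measurable_cong[where g = "\<lambda>v. v $ j * cnj (v $ k)"]) (auto simp: O_line)
      qed
    qed (auto simp: oL_def Pair)
    then show ?thesis using measurable_cong_sets[OF st refl] by blast
  qed
  have O_bound: "cmod (oL L x) \<le> 1" if L: "L \<in> space \<mu>" for L x
  proof -
    obtain v where v: "L = complex_line v" "v \<in> unit_sphere n" using L sp unfolding proj_space_def by blast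
    have c: "cmod (v $ j) \<le> 1" if "j < n" for j
    proof -
      have "(cmod (v $ j))\<^sup>2 \<le> 1\<^sup>2" using coord_le_sqn[OF that, of "vec_index v"] v(2) by (simp add: unit_sphere_iff)
      then show ?thesis by (rule power2_le_imp_le) simp
    qed
    show ?thesis
    proof (cases "fst x < n \<and> snd x < n")
      case True
      then show ?thesis
        using O_line[OF v(2), of "fst x" "snd x"] c v(1) by (simp add: norm_mult mult_le_one)
    next
      case False
      then show ?thesis by (cases x) (auto simp: oL_def)
    qed
  qed
  let ?I = "{..<n} \<times> {..<n}"
  have int: "integrable \<mu> (\<lambda>L. oL L x1 * oL L x2 * oL L x3 * oL L x4)" for x1 x2 x3 x4
  proof (rule integrable_const_bound[of _ 1])
    show "AE L in \<mu>. cmod (oL L x1 * oL L x2 * oL L x3 * oL L x4) \<le> 1"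
      using O_bound by (intro AE_I2) (simp add: norm_mult mult_le_one)
  qed (intro borel_measurable_times O_meas)
  \<comment> \<open>The quadratic form of \<open>Z\<close> as a function of the line. The indices
    are transposed because the form is the trace of \<open>Z\<close> times
    \<open>outer_self v\<close>.\<close>
  define h where "h = (\<lambda>Z L. \<Sum>x\<in>?I. Z (snd x) (fst x) * oL L x)"
  have h_unit: "h Z (complex_line v) = qf n Z (vec_index v)" if "v \<in> unit_sphere n" for Z v
  proof -
    have "qf n Z (vec_index v) = (\<Sum>k<n. \<Sum>j<n. Z k j * oL (complex_line v) (j, k))"
      using that by (subst qf_outer) (auto simp: unit_sphere_iff O_line outer_self_def intro!: sum.cong)
    also have "\<dots> = (\<Sum>j<n. \<Sum>k<n. Z k j * oL (complex_line v) (j, k))" by (rule sum.swap)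
    also have "\<dots> = h Z (complex_line v)" by (simp add: h_def sum.cartesian_product case_prod_beta)
    finally show ?thesis ..
  qed
  have h_meas: "h Z \<in> borel_measurable \<mu>" for Z
    unfolding h_def by (intro borel_measurable_sum borel_measurable_times borel_measurable_const O_meas)
  have main: "design_sum N p w (\<lambda>v. qf n A v * qf n B v * qf n C v * qf n D v) = (LINT L|\<mu>. h A L * h B L * h C L * h D L)"
    for A B C D
  proof -
    let ?c = "\<lambda>x1 x2 x3 x4. A (snd x1) (fst x1) * B (snd x2) (fst x2) * C (snd x3) (fst x3) * D (snd x4) (fst x4)"
    let ?W = "\<lambda>i x. outer_self (w i) $$ x"
    let ?pW = "\<lambda>i x1 x2 x3 x4. of_real (p i) * (?W i x1 * ?W i x2 * ?W i x3 * ?W i x4)"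
    let ?S = "\<lambda>g. \<Sum>x1\<in>?I. \<Sum>x2\<in>?I. \<Sum>x3\<in>?I. \<Sum>x4\<in>?I. ?c x1 x2 x3 x4 * g x1 x2 x3 x4"
    have q: "qf n Z (vec_index (w i)) = (\<Sum>x\<in>?I. Z (snd x) (fst x) * ?W i x)" if "i < N" for i Z
      by (subst qf_outer[OF w[OF that]], subst sum.swap) (simp add: sum.cartesian_product case_prod_beta)
    have m: "(\<Sum>i<N. ?pW i x1 x2 x3 x4) =
        (LINT L|\<mu>. oL L x1 * oL L x2 * oL L x3 * oL L x4)"
      if x: "x1 \<in> ?I" "x2 \<in> ?I" "x3 \<in> ?I" "x4 \<in> ?I" for x1 x2 x3 x4
    proof -
      \<comment> \<open>The sum type joins design vectors and lines into one family, so that the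
        same \<open>j\<close> and \<open>k\<close> result for both; zero matrices keep the remaining
        members in the carrier.\<close>
      define A where "A = (\<lambda>s. case s of Inl i \<Rightarrow> if i < N then outer_self (w i) else 0\<^sub>m n n
        | Inr L \<Rightarrow> if L \<in> space \<mu> then outer_self (unit_rep L) else 0\<^sub>m n n)"
      have u: "unit_rep L \<in> carrier_vec n" if L: "L \<in> space \<mu>" for L
      proof -
        obtain v where v: "L = complex_line v" "v \<in> unit_sphere n" using L sp unfolding proj_space_def by blast
        have "dim_row (outer_self (unit_rep L)) = n"
          unfolding v(1) outer_self_unit_rep[OF v(2)] using v(2) by (simp add: outer_self_def unit_sphere_iff)
        then show ?thesis by (intro carrier_vecI) (simp add: outer_self_def)
      qed
      have "A s \<in> carrier_mat n n" for s
        using w u by (cases s) (auto simp: A_def outer_self_def)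
      from tensor_power_4_entries[of A n "fst x1" "fst x2" "fst x3" "fst x4" "snd x1" "snd x2" "snd x3" "snd x4", OF this]
      obtain j k where jk: "j < n ^ 4" "k < n ^ 4"
        "\<And>s. tensor_power (A s) 4 $$ (j, k) = A s $$ x1 * (A s $$ x2 * (A s $$ x3 * A s $$ x4))"
        using x by (auto simp: mem_Times_iff)
      have jkl: "tensor_power (outer_self (w i)) 4 $$ (j, k) = ?W i x1 * (?W i x2 * (?W i x3 * ?W i x4))" if "i < N" for i
        using jk(3)[of "Inl i"] that by (simp add: A_def)
      have jkr: "tensor_power (outer_self (unit_rep L)) 4 $$ (j, k) = oL L x1 * (oL L x2 * (oL L x3 * oL L x4))"
        if "L \<in> space \<mu>" for L
        using jk(3)[of "Inr L"] that x by (auto simp: A_def oL_def)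
      have "(\<Sum>i<N. ?pW i x1 x2 x3 x4) =
          (\<Sum>i<N. of_real (p i) * tensor_power (outer_self (w i)) 4 $$ (j, k))"
        by (intro sum.cong refl) (simp add: jkl mult_ac)
      also have "\<dots> = (LINT L|\<mu>. tensor_power (outer_self (unit_rep L)) 4 $$ (j, k))"
        by (rule mom[OF jk(1,2)])
      also have "\<dots> = (LINT L|\<mu>. oL L x1 * oL L x2 * oL L x3 * oL L x4)"
        by (intro Bochner_Integration.integral_cong refl) (simp add: jkr mult_ac)
      finally show ?thesis .
    qed
    have "design_sum N p w (\<lambda>v. qf n A v * qf n B v * qf n C v * qf n D v) =
      (\<Sum>i<N. ?S (?pW i))"
      unfolding design_sum_def
    proof (intro sum.cong refl)
      fix i assume "i \<in> {..<N}"
      then have i: "i < N" by simp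
      show "of_real (p i) * (qf n A (vec_index (w i)) * qf n B (vec_index (w i)) * qf n C (vec_index (w i)) * qf n D (vec_index (w i))) =
        ?S (?pW i)"
        unfolding q[OF i] unfolding product4_expand unfolding sum_distrib_left by (simp add: mult_ac)
    qed
    also have "\<dots> = ?S (\<lambda>x1 x2 x3 x4. \<Sum>i<N. ?pW i x1 x2 x3 x4)"
      unfolding sum_distrib_left
      by (subst sum.swap, intro sum.cong refl, subst sum.swap, intro sum.cong refl, subst sum.swap, intro sum.cong refl, rule sum.swap)
    also have "\<dots> = ?S (\<lambda>x1 x2 x3 x4. LINT L|\<mu>. oL L x1 * oL L x2 * oL L x3 * oL L x4)"
      by (intro sum.cong refl arg_cong2[where f = "(*)"] m)
    also have "\<dots> = (LINT L|\<mu>. ?S (\<lambda>x1 x2 x3 x4. oL L x1 * oL L x2 * oL L x3 * oL L x4))"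
      using int by (simp del: mult.assoc)
    also have "\<dots> = (LINT L|\<mu>. h A L * h B L * h C L * h D L)"
      unfolding h_def unfolding product4_expand by (simp add: mult_ac)
    finally show ?thesis .
  qed
  define T where "T = (\<lambda>Z i j. \<Sum>a<n. \<Sum>b<n. cnj (M a i) * Z a b * M b j)"
  have hT: "h (T Z) L = h Z (act n M ` L)" if L: "L \<in> space \<mu>" for Z L
  proof -
    obtain v where v: "L = complex_line v" "v \<in> unit_sphere n" using L sp unfolding proj_space_def by blast
    have vc: "v \<in> carrier_vec n" using v by (simp add: unit_sphere_iff)
    have "h Z (act n M ` L) = qf n Z (vec_index (act n M v))"
      unfolding v(1) act_line[OF vc] by (rule h_unit[OF act_sphere[OF M v(2)]])
    also have "\<dots> = qf n Z (mv n M (vec_index v))"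
      unfolding qf_def act_def by (intro ip_cong mat_mult_vec_mv vc fun_cong[OF mv_cong]) auto
    also have "\<dots> = h (T Z) L"
      unfolding qf_mv v(1) T_def by (rule h_unit[OF v(2), symmetric])
    finally show ?thesis ..
  qed
  have meas: "(\<lambda>L. act n M ` L) \<in> measurable \<mu> \<mu>"
    using line_act_measurable[OF M] measurable_cong_sets[OF st st] by blast
  let ?G = "\<lambda>L. h Z1 L * h Z2 L * h Z3 L * h Z4 L"
  have "design_sum N p w (\<lambda>v. qf n Z1 (mv n M v) * qf n Z2 (mv n M v) * qf n Z3 (mv n M v) * qf n Z4 (mv n M v)) =
      (LINT L|\<mu>. h (T Z1) L * h (T Z2) L * h (T Z3) L * h (T Z4) L)"
    unfolding qf_mv T_def by (rule main)
  also have "\<dots> = (LINT L|\<mu>. ?G (act n M ` L))"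
    by (intro Bochner_Integration.integral_cong refl) (simp add: hT)
  also have "\<dots> = (LINT L|distr \<mu> \<mu> (\<lambda>L. act n M ` L). ?G L)"
    by (rule integral_distr[symmetric]) (auto intro!: meas borel_measurable_times h_meas)
  also have "\<dots> = (LINT L|\<mu>. ?G L)" by (simp add: invariant_distr[OF inv M])
  also have "\<dots> = design_sum N p w (\<lambda>v. qf n Z1 v * qf n Z2 v * qf n Z3 v * qf n Z4 v)" by (rule main[symmetric])
  finally show ?thesis .
qed

section \<open>Moments of quadratic forms\<close>

text \<open>The derivative of \<open>v \<mapsto> \<langle>v, Z v\<rangle>\<close> along the infinitesimal rotation generated by \<open>x y\<^sup>*\<close>, up to
  a factor of modulus 1: the quadratic form of the commutator of \<open>Z\<close> and \<open>x y\<^sup>*\<close>.\<close>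

definition cf :: "nat \<Rightarrow> cmat \<Rightarrow> cvec \<Rightarrow> cvec \<Rightarrow> cvec \<Rightarrow> complex" where
  "cf n Z x y v = ip n y v * ip n v (mv n Z x) - ip n v x * ip n y (mv n Z v)"

lemma cf_add_left: "cf n Z (\<lambda>i. x i + x' i) y v = cf n Z x y v + cf n Z x' y v"
  by (simp add: cf_def mv_add ip_add_right algebra_simps)

lemma cf_add_right: "cf n Z x (\<lambda>i. y i + y' i) v = cf n Z x y v + cf n Z x y' v"
  by (simp add: cf_def ip_add_left algebra_simps)

lemma cf_scale_left: "cf n Z (\<lambda>i. c * x i) y v = c * cf n Z x y v"
  by (simp add: cf_def mv_scale ip_scale_right algebra_simps)

lemma cf_scale_right: "cf n Z x (\<lambda>i. c * y i) v = cnj c * cf n Z x y v"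
  by (simp add: cf_def ip_scale_left algebra_simps)

text \<open>The rotation multiplies the line of \<open>x\<close> by the phase \<open>c\<close> and
  fixes its orthogonal complement.\<close>

lemma rotation_unitary:
  assumes x: "sqn n x = 1" and c: "c * cnj c = 1"
  shows "unitary_fun n (\<lambda>i j. (if i = j then 1 else 0) + (c - 1) * x i * cnj (x j))"
  unfolding unitary_fun_def
proof (intro allI impI)
  fix i j assume ij: "i < n" "j < n"
  have x2: "(\<Sum>a<n. cnj (x a) * x a) = 1" using x ip_self[of n x] by (simp add: ip_def)
  let ?U = "\<lambda>i j. (if i = j then 1 else 0) + (c - 1) * x i * cnj (x j)"
  have "(\<Sum>a<n. cnj (?U a i) * ?U a j) =
      (\<Sum>a<n. (if a = i then (if i = j then 1 else 0) else 0) + (if a = i then (c - 1) * x i * cnj (x j) else 0)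
        + (if a = j then (cnj c - 1) * cnj (x j) * x i else 0)
        + (c - 1) * (cnj c - 1) * x i * cnj (x j) * (cnj (x a) * x a))"
    by (intro sum.cong refl) (auto simp: algebra_simps)
  also have "\<dots> = (if i = j then 1 else 0) + (c - 1) * x i * cnj (x j) + (cnj c - 1) * cnj (x j) * x i
        + (c - 1) * (cnj c - 1) * x i * cnj (x j)"
    unfolding sum.distrib using ij by (simp add: x2 flip: sum_distrib_left)
  also have "\<dots> = (if i = j then 1 else 0) + x i * cnj (x j) * (c * cnj c - 1)"
    by (simp add: algebra_simps)
  finally show "(\<Sum>a<n. cnj (?U a i) * ?U a j) = (if i = j then 1 else 0)" by (simp add: c)
qed

lemma mv_rotation:
  "i < n \<Longrightarrow> mv n (\<lambda>i j. (if i = j then 1 else 0) + (c - 1) * x i * cnj (x j)) v i = v i + ((c - 1) * ip n x v) * x i"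
proof -
  assume i: "i < n"
  have "mv n (\<lambda>i j. (if i = j then 1 else 0) + (c - 1) * x i * cnj (x j)) v i =
      (\<Sum>j<n. (if j = i then v j else 0) + (c - 1) * x i * (cnj (x j) * v j))"
    unfolding mv_def by (intro sum.cong refl) (auto simp: algebra_simps)
  also have "\<dots> = v i + ((c - 1) * ip n x v) * x i"
    using i by (simp add: sum.distrib ip_def sum_distrib_left mult_ac)
  finally show ?thesis .
qed

lemma qf_rotation:
  "qf n Z (mv n (\<lambda>i j. (if i = j then 1 else 0) + (c - 1) * x i * cnj (x j)) v) =
    qf n Z v + (c - 1) * (ip n x v * ip n v (mv n Z x)) + (cnj c - 1) * (ip n v x * ip n x (mv n Z v))
     + (c - 1) * (cnj c - 1) * (ip n x v * ip n v x * ip n x (mv n Z x))"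
proof -
  let ?s = "(c - 1) * ip n x v"
  have "qf n Z (mv n (\<lambda>i j. (if i = j then 1 else 0) + (c - 1) * x i * cnj (x j)) v) =
     qf n Z (\<lambda>i. v i + ?s * x i)"
    unfolding qf_def by (intro ip_cong fun_cong[OF mv_cong]) (simp_all only: mv_rotation)
  also have "\<dots> = qf n Z v + ?s * ip n v (mv n Z x) + cnj ?s * ip n x (mv n Z v) + cnj ?s * ?s * ip n x (mv n Z x)"
    unfolding qf_def mv_add mv_scale by (simp only: ip_add_left ip_add_right ip_scale_left ip_scale_right distrib_left mult.assoc add_ac complex_cnj_mult)
  finally show ?thesis by (simp add: cnj_ip algebra_simps)
qed

definition leibniz :: "nat \<Rightarrow> cmat \<Rightarrow> cmat \<Rightarrow> cmat \<Rightarrow> cmat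
    \<Rightarrow> cvec \<Rightarrow> cvec \<Rightarrow> cvec \<Rightarrow> complex" where
  "leibniz n Z1 Z2 Z3 Z4 x y v =
      cf n Z1 x y v * qf n Z2 v * qf n Z3 v * qf n Z4 v + qf n Z1 v * cf n Z2 x y v * qf n Z3 v * qf n Z4 v +
      qf n Z1 v * qf n Z2 v * cf n Z3 x y v * qf n Z4 v + qf n Z1 v * qf n Z2 v * qf n Z3 v * cf n Z4 x y v"

text \<open>Rotations through the phases exp (i s) leave the design average unchanged, so its
  derivative at s = 0 vanishes; by the product rule this derivative is i times the average of
  \<open>leibniz\<close>.\<close>

lemma design_derivation_unit:
  assumes des: "weighted_projective_design 4 n N p w" and x: "sqn n x = 1"
  shows "design_sum N p w (leibniz n Z1 Z2 Z3 Z4 x x) = 0"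
proof -
  \<comment> \<open>Writing the conjugate phase as exp (- i s) makes \<open>g\<close> holomorphic in
    a complex \<open>s\<close>, so the complex differentiation rules apply; for real
    \<open>s\<close> it is the rotated quadratic form.\<close>
  define g where "g = (\<lambda>Z v s. qf n Z v + (exp (\<i> * s) - 1) * (ip n x v * ip n v (mv n Z x)) + (exp (- (\<i> * s)) - 1) * (ip n v x * ip n x (mv n Z v))
     + (exp (\<i> * s) - 1) * (exp (- (\<i> * s)) - 1) * (ip n x v * ip n v x * ip n x (mv n Z x)))"
  have g0: "g Z v 0 = qf n Z v" for Z v by (simp add: g_def)
  have dg: "(g Z v has_field_derivative \<i> * cf n Z x x v) (at 0)" for Z v
    unfolding g_def by (rule derivative_eq_intros refl | simp)+ (simp add: cf_def algebra_simps)
  define G where "G = (\<lambda>s. design_sum N p w (\<lambda>v. g Z1 v s * g Z2 v s * g Z3 v s * g Z4 v s))"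
  have dG: "(G has_field_derivative design_sum N p w (\<lambda>v. \<i> * leibniz n Z1 Z2 Z3 Z4 x x v)) (at 0)"
    unfolding G_def design_sum_def
    by (rule DERIV_sum DERIV_cmult DERIV_cong[OF DERIV_mult[OF DERIV_mult[OF DERIV_mult[OF dg dg] dg] dg]])+
      (simp add: g0 leibniz_def algebra_simps)
  have Gc: "G (of_real t) = G 0" for t
  proof -
    define c where "c = exp (\<i> * of_real t)"
    have c': "cnj c = exp (- (\<i> * of_real t))" by (simp add: c_def exp_cnj)
    have "c * cnj c = 1" unfolding c' unfolding c_def by (simp flip: exp_add)
    from design_invariant[OF des rotation_unitary[OF x this], of Z1 Z2 Z3 Z4]
    show ?thesis
      unfolding qf_rotation unfolding c' unfolding c_def G_def g0 by (simp add: g_def)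
  qed
  have "((\<lambda>t. G (of_real t)) has_vector_derivative design_sum N p w (\<lambda>v. \<i> * leibniz n Z1 Z2 Z3 Z4 x x v)) (at 0)"
    using has_vector_derivative_real_field[of G _ 0 UNIV] dG by simp
  then have "((\<lambda>t::real. G 0) has_vector_derivative design_sum N p w (\<lambda>v. \<i> * leibniz n Z1 Z2 Z3 Z4 x x v)) (at 0)"
    by (simp only: Gc)
  then have "design_sum N p w (\<lambda>v. \<i> * leibniz n Z1 Z2 Z3 Z4 x x v) = 0"
    using vector_derivative_unique_at has_vector_derivative_const by blast
  moreover have "design_sum N p w (\<lambda>v. \<i> * leibniz n Z1 Z2 Z3 Z4 x x v) = \<i> * design_sum N p w (leibniz n Z1 Z2 Z3 Z4 x x)"
    by (simp add: design_sum_def sum_distrib_left algebra_simps)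
  ultimately show ?thesis by simp
qed

text \<open>Polarisation: the diagonal values at x + y and x + i y determine the off-diagonal
  ones.\<close>

lemma sesquilinear_zero:
  fixes H :: "cvec \<Rightarrow> cvec \<Rightarrow> complex"
  assumes add1: "\<And>x x' y. H (\<lambda>i. x i + x' i) y = H x y + H x' y"
    and add2: "\<And>x y y'. H x (\<lambda>i. y i + y' i) = H x y + H x y'"
    and sc1: "\<And>c x y. H (\<lambda>i. c * x i) y = c * H x y"
    and sc2: "\<And>c x y. H x (\<lambda>i. c * y i) = cnj c * H x y"
    and diag: "\<And>x. H x x = 0"
  shows "H x y = 0"
proof -
  have "H x y + H y x = 0"
    using diag[of "\<lambda>i. x i + y i"] by (simp add: add1 add2 diag)
  moreover have "H x y - H y x = 0"
    using diag[of "\<lambda>i. x i + \<i> * y i"] by (simp add: add1 add2 sc1 sc2 diag)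
  ultimately show ?thesis by simp
qed

text \<open>For distinct \<open>x\<close> and \<open>y\<close> the generator need not come from a
  unitary rotation, but the identity is sesquilinear in \<open>x\<close> and \<open>y\<close>, so it
  extends from the diagonal, where unit vectors give it and scaling removes the
  normalisation.\<close>

lemma design_derivation:
  assumes des: "weighted_projective_design 4 n N p w"
  shows "design_sum N p w (leibniz n Z1 Z2 Z3 Z4 x y) = 0"
proof (rule sesquilinear_zero[of "\<lambda>x y. design_sum N p w (leibniz n Z1 Z2 Z3 Z4 x y)"])
  let ?L = "leibniz n Z1 Z2 Z3 Z4"
  have lsc1: "?L (\<lambda>i. c * x i) y v = c * ?L x y v" for c x y v
    by (simp add: leibniz_def cf_scale_left algebra_simps)
  have lsc2: "?L x (\<lambda>i. c * y i) v = cnj c * ?L x y v" for c x y v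
    by (simp add: leibniz_def cf_scale_right algebra_simps)
  show "design_sum N p w (?L (\<lambda>i. x i + x' i) y) =
    design_sum N p w (?L x y) + design_sum N p w (?L x' y)" for x x' y
    unfolding design_sum_def sum.distrib[symmetric]
    by (intro sum.cong refl) (simp add: leibniz_def cf_add_left algebra_simps)
  show "design_sum N p w (?L x (\<lambda>i. y i + y' i)) =
    design_sum N p w (?L x y) + design_sum N p w (?L x y')" for x y y'
    unfolding design_sum_def sum.distrib[symmetric]
    by (intro sum.cong refl) (simp add: leibniz_def cf_add_right algebra_simps)
  show sc1: "design_sum N p w (?L (\<lambda>i. c * x i) y) = c * design_sum N p w (?L x y)" for c x y
    unfolding design_sum_def sum_distrib_left by (intro sum.cong refl) (simp add: lsc1)
  show sc2: "design_sum N p w (?L x (\<lambda>i. c * y i)) = cnj c * design_sum N p w (?L x y)" for c x y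
    unfolding design_sum_def sum_distrib_left by (intro sum.cong refl) (simp add: lsc2)
  show "design_sum N p w (?L x x) = 0" for x
  proof (cases "sqn n x = 0")
    case True
    then have 0: "ip n u x = 0" "mv n Z x = (\<lambda>i. 0)" "ip n x u = 0" for u Z
      using sqn_eq_0[OF True] by (auto simp: ip_def mv_def)
    then show ?thesis by (simp add: design_sum_def leibniz_def cf_def ip_def)
  next
    case False
    then have pos: "sqn n x > 0" using sqn_nonneg[of n x] by linarith
    let ?c = "of_real (1 / sqrt (sqn n x))"
    have "sqn n (\<lambda>i. ?c * x i) = 1"
      unfolding sqn_scale using pos by (simp add: norm_divide power_divide)
    from design_derivation_unit[OF des this, of Z1 Z2 Z3 Z4]
    have "?c * (cnj ?c * design_sum N p w (?L x x)) = 0"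
      unfolding sc1 sc2 by simp
    then show ?thesis using pos by simp
  qed
qed

lemma design_unit:
  assumes "weighted_projective_design 4 n N p w" "i < N"
  shows "sqn n (vec_index (w i)) = 1"
  using assms unit_sphere_iff[of "w i" n] by (auto simp: weighted_projective_design_def unit_sphere_def)

text \<open>Summing the derivation identity over \<open>x = e\<^sub>i\<close>, with first matrix \<open>r e\<^sub>i\<^sup>*\<close>, turns it into a
  recursion for moments.\<close>

lemma design_recursion:
  assumes des: "weighted_projective_design 4 n N p w"
  shows "design_sum N p w (\<lambda>v. (of_nat n * (ip n y v * ip n v r) - ip n y r) * qf n A v * qf n B v * qf n C v +
    ip n v r * ((ip n y v * qf n A v - ip n y (mv n A v)) * qf n B v * qf n C v +
      (ip n y v * qf n B v - ip n y (mv n B v)) * qf n A v * qf n C v +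
      (ip n y v * qf n C v - ip n y (mv n C v)) * qf n A v * qf n B v)) = 0"
    (is "design_sum N p w ?F = 0")
proof -
  \<comment> \<open>The quadratic form of \<open>?R i\<close> is \<open>ip n v r * v i\<close>; its
    factor \<open>v i\<close> is what contracts the sums over \<open>i\<close> below into quadratic
    forms of the other three matrices.\<close>
  let ?R = "\<lambda>i a b. r a * (if b = i then 1 else 0)"
  have mvR: "mv n (?R i) x = (\<lambda>a. x i * r a)" if "i < n" for i x
  proof
    fix a
    have "mv n (?R i) x a = (\<Sum>b<n. if b = i then r a * x b else 0)"
      unfolding mv_def by (intro sum.cong) auto
    then show "mv n (?R i) x a = x i * r a" using that by simp
  qed
  have qR: "qf n (?R i) v = ip n v r * v i" if "i < n" for i v
    using that by (simp add: qf_def mvR ip_scale_right)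
  \<comment> \<open>Over all \<open>i\<close> the first product is repeated n times, while the
    second sums to \<open>ip n y r\<close> because \<open>v\<close> has length 1.\<close>
  have cR: "cf n (?R i) (unitvec i) y v = ip n y v * ip n v r - cnj (v i) * v i * ip n y r" if "i < n" for i v
    using that by (simp add: cf_def mvR ip_scale_right ip_unitvec)
  have mvU: "mv n A (unitvec i) = (\<lambda>a. A a i)" if "i < n" for i A
  proof
    fix a
    have "mv n A (unitvec i) a = (\<Sum>b<n. if b = i then A a b else 0)"
      unfolding mv_def by (intro sum.cong) auto
    then show "mv n A (unitvec i) a = A a i" using that by simp
  qed
  have cA: "(\<Sum>i<n. v i * cf n A (unitvec i) y v) = ip n y v * qf n A v - ip n y (mv n A v)"
    if "sqn n v = 1" for A v
  proof -
    have "(\<Sum>i<n. v i * cf n A (unitvec i) y v) =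
        (\<Sum>i<n. ip n y v * (v i * ip n v (\<lambda>a. A a i)) - (cnj (v i) * v i) * ip n y (mv n A v))"
      by (intro sum.cong refl) (simp add: cf_def mvU ip_unitvec algebra_simps)
    also have "\<dots> = ip n y v * (\<Sum>i<n. v i * ip n v (\<lambda>a. A a i)) - ip n v v * ip n y (mv n A v)"
      by (simp add: sum_subtractf sum_distrib_left sum_distrib_right ip_def[of n v v])
    also have "(\<Sum>i<n. v i * ip n v (\<lambda>a. A a i)) = (\<Sum>i<n. \<Sum>a<n. cnj (v a) * (A a i * v i))"
      by (simp add: ip_def sum_distrib_left mult_ac)
    also have "\<dots> = (\<Sum>a<n. \<Sum>i<n. cnj (v a) * (A a i * v i))" by (rule sum.swap)
    also have "\<dots> = qf n A v" by (simp add: qf_def ip_def mv_def sum_distrib_left)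
    finally show ?thesis using that by (simp add: ip_self)
  qed
  have eq: "?F v =
    (\<Sum>i<n. leibniz n (?R i) A B C (unitvec i) y v)" if v: "sqn n v = 1" for v
  proof -
    have "(\<Sum>i<n. leibniz n (?R i) A B C (unitvec i) y v) =
       (\<Sum>i<n. (ip n y v * ip n v r - cnj (v i) * v i * ip n y r) * (qf n A v * qf n B v * qf n C v)
        + ip n v r * (v i * cf n A (unitvec i) y v) * (qf n B v * qf n C v)
        + ip n v r * (v i * cf n B (unitvec i) y v) * (qf n A v * qf n C v)
        + ip n v r * (v i * cf n C (unitvec i) y v) * (qf n A v * qf n B v))"
      by (intro sum.cong refl) (simp add: leibniz_def qR cR mult_ac)
    also have "\<dots> = (of_nat n * (ip n y v * ip n v r) - ip n v v * ip n y r) * (qf n A v * qf n B v * qf n C v)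
        + ip n v r * (\<Sum>i<n. v i * cf n A (unitvec i) y v) * (qf n B v * qf n C v)
        + ip n v r * (\<Sum>i<n. v i * cf n B (unitvec i) y v) * (qf n A v * qf n C v)
        + ip n v r * (\<Sum>i<n. v i * cf n C (unitvec i) y v) * (qf n A v * qf n B v)"
      unfolding sum.distrib sum_distrib_right[symmetric] sum_distrib_left[symmetric] sum_subtractf
      by (simp add: ip_def)
    finally show ?thesis unfolding cA[OF v] ip_self v by (simp add: algebra_simps)
  qed
  have "design_sum N p w ?F =
    design_sum N p w (\<lambda>v. \<Sum>i<n. leibniz n (?R i) A B C (unitvec i) y v)"
    unfolding design_sum_def by (intro sum.cong refl arg_cong2[where f = "(*)"] eq design_unit[OF des]) auto
  also have "\<dots> = (\<Sum>i<n. design_sum N p w (leibniz n (?R i) A B C (unitvec i) y))"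
    unfolding design_sum_def sum_distrib_left by (rule sum.swap)
  also have "\<dots> = 0" by (simp add: design_derivation[OF des])
  finally show ?thesis .
qed

text \<open>The identity matrix. Its quadratic form is 1 on unit vectors, so it pads products of
  fewer than four forms to degree four, and lower moments follow from the identity of degree
  four.\<close>

definition unit_mat :: "nat \<Rightarrow> nat \<Rightarrow> complex" where
  "unit_mat = (\<lambda>i j. if i = j then 1 else 0)"

lemma mv_unit_mat: "i < n \<Longrightarrow> mv n unit_mat v i = v i"
proof -
  assume i: "i < n"
  have "mv n unit_mat v i = (\<Sum>j<n. if j = i then v j else 0)"
    unfolding mv_def unit_mat_def by (intro sum.cong) auto
  then show ?thesis using i by simp
qed

lemma ip_unit_mat: "ip n y (mv n unit_mat v) = ip n y v"
  by (intro ip_cong) (auto simp: mv_unit_mat)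

lemma qf_unit_mat: "qf n unit_mat v = of_real (sqn n v)"
  by (simp add: qf_def ip_unit_mat ip_self)

definition mean :: "nat \<Rightarrow> (nat \<Rightarrow> real) \<Rightarrow> (nat \<Rightarrow> complex vec) \<Rightarrow> (cvec \<Rightarrow> real) \<Rightarrow> real" where
  "mean N p w F = (\<Sum>i<N. p i * F (vec_index (w i)))"

lemma design_sum_of_real:
  assumes "weighted_projective_design 4 n N p w" "\<And>v. sqn n v = 1 \<Longrightarrow> F v = of_real (G v)"
  shows "design_sum N p w F = of_real (mean N p w G)"
  unfolding design_sum_def mean_def of_real_sum of_real_mult
  using assms(2) design_unit[OF assms(1)] by (intro sum.cong refl) simp

lemma ip_mult_swap: "ip n x v * ip n v x = of_real (ip_sq n x v)"
  by (simp add: cnj_ip[of n x v, symmetric] mult_cnj_eq)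

text \<open>With y = r = x and the identity in the three remaining slots, every commutator term of
  the recursion vanishes.\<close>

lemma design_isotropic:
  assumes des: "weighted_projective_design 4 n N p w" and x: "sqn n x = 1"
  shows "real n * mean N p w (\<lambda>v. ip_sq n x v) = 1"
proof -
  have "complex_of_real (mean N p w (\<lambda>v. real n * ip_sq n x v - 1)) = 0"
    using design_recursion[OF des, of x x unit_mat unit_mat unit_mat]
    by (subst (asm) design_sum_of_real[OF des, where G = "\<lambda>v. real n * ip_sq n x v - 1"])
      (auto simp: ip_unit_mat qf_unit_mat ip_mult_swap ip_self x)
  then have "mean N p w (\<lambda>v. real n * ip_sq n x v - 1) = 0" by (simp only: of_real_eq_0_iff)
  moreover have "(\<Sum>i<N. p i) = 1" using des by (simp add: weighted_projective_design_def)
  ultimately show ?thesis by (simp add: mean_def right_diff_distrib sum_subtractf sum_distrib_left mult_ac)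
qed

section \<open>Second and fourth moments of a Hermitian form\<close>

lemma qf_spectral:
  assumes "spectral n Z e u" "hermitian n Z"
  shows "qf n Z v = of_real (\<Sum>l<n. e l * ip_sq n (u l) v)"
  unfolding qf_def spectral_ip[OF assms]
  by (simp add: cnj_ip[of n "u _" v, symmetric] mult.assoc mult_cnj_eq)

text \<open>With y = r = \<open>u l\<close> an eigenvector, \<open>ip n y (mv n Z v)\<close> is
  \<open>e l * ip n y v\<close>, so every term of the recursion is a function of \<open>X\<close>
  and \<open>Y\<close>. The factor k counts the copies of \<open>Z\<close> among the three remaining
  matrices, the others being the identity; at k = 0 the truncated exponent k - 1 is multiplied by
  0.\<close>

lemma spectral_moments:
  assumes des: "weighted_projective_design 4 n N p w" and sp: "spectral n Z e u" and h: "hermitian n Z"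
    and l: "l < n"
  defines "X \<equiv> \<lambda>v. ip_sq n (u l) v" and "Y \<equiv> \<lambda>v. \<Sum>k<n. e k * ip_sq n (u k) v"
  shows "k \<le> 3 \<Longrightarrow> (real n + k) * mean N p w (\<lambda>v. Y v ^ k * X v) =
    mean N p w (\<lambda>v. Y v ^ k) + k * e l * mean N p w (\<lambda>v. Y v ^ (k - 1) * X v)"
proof -
  have qY: "qf n Z v = of_real (Y v)" for v
    unfolding Y_def by (rule qf_spectral[OF sp h])
  have X: "ip n (u l) v * ip n v (u l) = of_real (X v)" "ip n v (u l) * ip n (u l) v = of_real (X v)" for v
    unfolding X_def ip_mult_swap[symmetric] by (simp_all add: mult.commute)
  have ul: "ip n (u l) (u l) = 1" using sp l by (simp add: spectral_def orthonormal_def)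
  note uZ = spectral_ip_left[OF sp l h]
  define T where "T = (\<lambda>Z v. ip n v (u l) * (ip n (u l) v * qf n Z v - ip n (u l) (mv n Z v)))"
  have TZ: "T Z v = of_real (X v * Y v - e l * X v)" for v
    unfolding T_def uZ qY by (simp add: algebra_simps X mult.assoc[symmetric])
  have TI: "T unit_mat v = of_real (X v * sqn n v - X v)" for v
    unfolding T_def ip_unit_mat qf_unit_mat by (simp add: algebra_simps X mult.assoc[symmetric])
  have rec: "design_sum N p w (\<lambda>v. of_real (real n * X v - 1) * qf n A v * qf n B v * qf n C v +
     (T A v * (qf n B v * qf n C v) + T B v * (qf n A v * qf n C v) + T C v * (qf n A v * qf n B v))) = 0" for A B C
    using design_recursion[OF des, of "u l" "u l" A B C] unfolding T_def X ul by (simp add: distrib_left mult.assoc)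
  let ?D = "\<lambda>(k::nat) v. (real n * X v - 1) * Y v ^ k + k * (X v * Y v - e l * X v) * Y v ^ (k - 1)"
  have lin: "mean N p w (?D k) =
    (real n + k) * mean N p w (\<lambda>v. Y v ^ k * X v) - (mean N p w (\<lambda>v. Y v ^ k) + k * e l * mean N p w (\<lambda>v. Y v ^ (k - 1) * X v))" for k :: nat
  proof (cases k)
    case 0
    then show ?thesis by (simp add: mean_def sum_distrib_left algebra_simps sum_subtractf)
  next
    case (Suc j)
    then show ?thesis
      by (simp add: mean_def sum_distrib_left algebra_simps sum_subtractf sum.distrib)
  qed
  have z: "mean N p w (?D k) = 0"
    if "design_sum N p w F = 0" "\<And>v. sqn n v = 1 \<Longrightarrow> F v = of_real (?D k v)"
    for F and k :: nat
    using design_sum_of_real[OF des that(2)] that(1) by simp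
  assume "k \<le> 3"
  then consider "k = 0" | "k = 1" | "k = 2" | "k = 3" by linarith
  then have "mean N p w (?D k) = 0"
  proof cases
    case 1
    show ?thesis by (rule z[OF rec[of unit_mat unit_mat unit_mat]]) (simp add: 1 TI qf_unit_mat)
  next
    case 2
    show ?thesis by (rule z[OF rec[of Z unit_mat unit_mat]]) (simp add: 2 TI TZ qf_unit_mat qY)
  next
    case 3
    show ?thesis by (rule z[OF rec[of Z Z unit_mat]]) (simp add: 3 TI TZ qf_unit_mat qY power2_eq_square algebra_simps)
  next
    case 4
    show ?thesis by (rule z[OF rec[of Z Z Z]]) (simp add: 4 TZ qY power3_eq_cube power2_eq_square algebra_simps)
  qed
  then show "(real n + k) * mean N p w (\<lambda>v. Y v ^ k * X v) =
    mean N p w (\<lambda>v. Y v ^ k) + k * e l * mean N p w (\<lambda>v. Y v ^ (k - 1) * X v)"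
    unfolding lin by simp
qed

text \<open>Multiplying the recursion by powers of \<open>e l\<close> and summing over
  \<open>l\<close> eliminates the individual eigenvectors: the moments \<open>M k\<close> are
  expressed through the power sums \<open>P k\<close> of the eigenvalues, with \<open>Q\<close> as
  intermediate quantity.\<close>

theorem design_moment_bounds:
  assumes des: "weighted_projective_design 4 n N p w" and n: "n \<ge> 1" and sp: "spectral n Z e u" and h: "hermitian n Z"
  defines "Y \<equiv> \<lambda>v. \<Sum>k<n. e k * ip_sq n (u k) v"
    and "s \<equiv> real n * (real n + 1)" and "q \<equiv> (\<Sum>k<n. e k)\<^sup>2 + (\<Sum>k<n. (e k)\<^sup>2)"
  shows "s * mean N p w (\<lambda>v. (Y v)\<^sup>2) = q"
    and "s\<^sup>2 * mean N p w (\<lambda>v. Y v ^ 4) \<le> 24 * q\<^sup>2"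
proof -
  define X where "X = (\<lambda>l v. ip_sq n (u l) v)"
  define M where "M = (\<lambda>k::nat. mean N p w (\<lambda>v. Y v ^ k))"
  define m where "m = (\<lambda>(k::nat) l. mean N p w (\<lambda>v. Y v ^ k * X l v))"
  define P where "P = (\<lambda>k::nat. \<Sum>l<n. e l ^ k)"
  have rec: "(real n + k) * m k l = M k + k * e l * m (k - 1) l" if "l < n" "k \<le> 3" for k l
    using spectral_moments[OF des sp h that] unfolding m_def M_def X_def Y_def by simp
  define Q where "Q = (\<lambda>k j. \<Sum>l<n. e l ^ j * m k l)"
  have MQ: "M (Suc k) = Q k 1" for k
  proof -
    have "Y v ^ Suc k = (\<Sum>l<n. e l * (Y v ^ k * X l v))" for v
      unfolding power_Suc by (subst Y_def) (simp add: X_def sum_distrib_left sum_distrib_right mult_ac)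
    then have "M (Suc k) = (\<Sum>i<N. \<Sum>l<n. e l * (p i * (Y (vec_index (w i)) ^ k * X l (vec_index (w i)))))"
      unfolding M_def mean_def by (simp add: sum_distrib_left mult_ac del: power_Suc)
    also have "\<dots> = (\<Sum>l<n. \<Sum>i<N. e l * (p i * (Y (vec_index (w i)) ^ k * X l (vec_index (w i)))))" by (rule sum.swap)
    finally show ?thesis by (simp add: Q_def m_def mean_def sum_distrib_left)
  qed
  have recQ: "(real n + k) * Q k j = M k * P j + k * Q (k - 1) (Suc j)" if "k \<le> 3" for k j
  proof -
    have "(real n + k) * Q k j = (\<Sum>l<n. e l ^ j * ((real n + k) * m k l))"
      by (simp add: Q_def sum_distrib_left mult_ac)
    also have "\<dots> = (\<Sum>l<n. M k * e l ^ j + k * (e l ^ Suc j * m (k - 1) l))"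
      using rec that by (intro sum.cong refl) (simp add: algebra_simps)
    finally show ?thesis by (simp add: Q_def P_def sum.distrib sum_distrib_left)
  qed
  have M0: "M 0 = 1"
    using des by (simp add: M_def mean_def weighted_projective_design_def)
  have Q0: "n * Q 0 j = P j" for j using recQ[of 0 j] M0 by simp
  have Q1: "s * Q 1 j = P 1 * P j + P (Suc j)" for j
  proof -
    have "s * Q 1 j = n * ((real n + 1) * Q 1 j)" by (simp add: s_def)
    also have "(real n + 1) * Q 1 j = M 1 * P j + Q 0 (Suc j)" using recQ[of 1 j] by simp
    also have "M 1 = Q 0 1" using MQ[of 0] by simp
    also have "n * (Q 0 1 * P j + Q 0 (Suc j)) = (n * Q 0 1) * P j + n * Q 0 (Suc j)" by (simp add: algebra_simps)
    finally show ?thesis unfolding Q0 .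
  qed
  have M2: "s * M 2 = (P 1)\<^sup>2 + P 2"
    using Q1[of 1] MQ[of 1] by (simp add: power2_eq_square numeral_2_eq_2)
  have Q2: "(real n + 2) * (s * Q 2 j) = (s * M 2) * P j + 2 * (P 1 * P (Suc j) + P (Suc (Suc j)))" for j
  proof -
    have "(real n + 2) * (s * Q 2 j) = s * ((real n + 2) * Q 2 j)" by simp
    also have "(real n + 2) * Q 2 j = M 2 * P j + 2 * Q 1 (Suc j)" using recQ[of 2 j] by simp
    also have "s * (M 2 * P j + 2 * Q 1 (Suc j)) = (s * M 2) * P j + 2 * (s * Q 1 (Suc j))" by (simp add: algebra_simps)
    finally show ?thesis unfolding Q1 .
  qed
  \<comment> \<open>The coefficients 1, 6, 3, 8, 6 count the permutations of four letters by cycle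
    type; their total is the 24 of the final bound.\<close>
  have M4: "(real n + 3) * ((real n + 2) * (s * M 4)) = P 1 ^ 4 + 6 * (P 1)\<^sup>2 * P 2 + 3 * (P 2)\<^sup>2 + 8 * P 1 * P 3 + 6 * P 4"
  proof -
    have "(real n + 3) * ((real n + 2) * (s * M 4)) = (real n + 2) * s * ((real n + 3) * Q 3 1)"
      using MQ[of 3] by simp
    also have "(real n + 3) * Q 3 1 = Q 2 1 * P 1 + 3 * Q 2 2"
      using recQ[of 3 1] MQ[of 2] by (simp add: numeral_2_eq_2 numeral_3_eq_3)
    also have "(real n + 2) * s * (Q 2 1 * P 1 + 3 * Q 2 2) =
        ((real n + 2) * (s * Q 2 1)) * P 1 + 3 * ((real n + 2) * (s * Q 2 2))" by (simp add: algebra_simps)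
    finally show ?thesis
      unfolding Q2 M2 by (simp add: numeral_eq_Suc algebra_simps)
  qed
  have s0: "s > 0" using n by (simp add: s_def)
  have P2: "P 2 \<ge> 0" unfolding P_def by (intro sum_nonneg) auto
  have P4: "P 4 \<le> (P 2)\<^sup>2"
  proof -
    have "P 4 = (\<Sum>l<n. ((e l)\<^sup>2) * (e l)\<^sup>2)" by (simp add: P_def power4_eq_xxxx power2_eq_square mult.assoc)
    also have "\<dots> \<le> (\<Sum>l<n. ((e l)\<^sup>2) * P 2)"
      unfolding P_def by (intro sum_mono mult_left_mono member_le_sum[where f = "\<lambda>l. (e l)\<^sup>2"]) auto
    finally show ?thesis by (simp add: P_def power2_eq_square[of "sum _ _"] sum_distrib_right)
  qed
  \<comment> \<open>The third power sum has no definite sign. It is absorbed term by term through 2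
    a b \<le> a^2 + b^2 with a = \<open>P 1 * e l\<close> and b =
    \<open>(e l)\<^sup>2\<close>.\<close>
  have P13: "2 * (P 1 * P 3) \<le> (P 1)\<^sup>2 * P 2 + P 4"
  proof -
    have P3: "P 3 = (\<Sum>l<n. e l ^ 3)" by (simp add: P_def)
    have "2 * (P 1 * P 3) = (\<Sum>l<n. 2 * (P 1 * e l) * (e l)\<^sup>2)"
      unfolding P3 by (simp add: sum_distrib_left power3_eq_cube power2_eq_square mult_ac)
    also have "\<dots> \<le> (\<Sum>l<n. (P 1 * e l)\<^sup>2 + ((e l)\<^sup>2)\<^sup>2)" by (intro sum_mono sum_squares_bound)
    also have "\<dots> = (P 1)\<^sup>2 * P 2 + P 4"
      unfolding sum.distrib power_mult_distrib sum_distrib_left[symmetric] by (simp add: P_def)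
    finally show ?thesis .
  qed
  have q: "q = (P 1)\<^sup>2 + P 2" by (simp add: q_def P_def)
  have "(real n + 3) * ((real n + 2) * (s * M 4)) \<le> 24 * q\<^sup>2"
  proof -
    have "P 1 ^ 4 + 6 * (P 1)\<^sup>2 * P 2 + 3 * (P 2)\<^sup>2 + 8 * P 1 * P 3 + 6 * P 4 \<le>
        P 1 ^ 4 + 10 * ((P 1)\<^sup>2 * P 2) + 13 * (P 2)\<^sup>2"
      using P13 P4 unfolding mult.assoc by linarith
    also have "\<dots> \<le> 24 * q\<^sup>2"
    proof -
      have "0 \<le> 23 * P 1 ^ 4 + 38 * ((P 1)\<^sup>2 * P 2) + 11 * (P 2)\<^sup>2" using P2 by (intro add_nonneg_nonneg mult_nonneg_nonneg) auto
      then show ?thesis unfolding q by (simp add: power2_sum algebra_simps)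
    qed
    finally show ?thesis using M4 by simp
  qed
  \<comment> \<open>The two outer factors are traded for \<open>s\<close>, so that the fourth moment
    carries the square of the normalisation of the second.\<close>
  moreover have "s * (s * M 4) \<le> (real n + 3) * ((real n + 2) * (s * M 4))"
  proof -
    have M4': "M 4 \<ge> 0" unfolding M_def mean_def
      using des by (intro sum_nonneg mult_nonneg_nonneg) (auto simp: weighted_projective_design_def)
    have "s \<le> (real n + 3) * (real n + 2)" unfolding s_def by (simp add: algebra_simps)
    then have "s * (s * M 4) \<le> ((real n + 3) * (real n + 2)) * (s * M 4)" using M4' s0 by (intro mult_right_mono) auto
    then show ?thesis by (simp add: mult.assoc)
  qed
  ultimately show "s\<^sup>2 * mean N p w (\<lambda>v. Y v ^ 4) \<le> 24 * q\<^sup>2"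
    by (simp add: M_def power2_eq_square mult.assoc)
  show "s * mean N p w (\<lambda>v. (Y v)\<^sup>2) = q" using M2 by (simp add: M_def q)
qed

section \<open>Signed sums of rank-one matrices\<close>

definition eigval :: "nat \<Rightarrow> cmat \<Rightarrow> nat \<Rightarrow> real" where
  "eigval n M = fst (SOME eu. spectral n M (fst eu) (snd eu))"

definition eigvec :: "nat \<Rightarrow> cmat \<Rightarrow> nat \<Rightarrow> nat \<Rightarrow> complex" where
  "eigvec n M = snd (SOME eu. spectral n M (fst eu) (snd eu))"

lemma spectral_eigval: "hermitian n M \<Longrightarrow> spectral n M (eigval n M) (eigvec n M)"
proof -
  assume "hermitian n M"
  then have "\<exists>eu. spectral n M (fst eu) (snd eu)" using spectral_exists by force
  from someI_ex[OF this] show ?thesis unfolding eigval_def eigvec_def .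
qed

lemma orthonormal_eigvec: "hermitian n M \<Longrightarrow> orthonormal n n (eigvec n M)"
  using spectral_eigval by (simp add: spectral_def)

text \<open>For Hermitian M this is the form of the q-th power of M at a, and
  \<open>spec_trace\<close> is the trace of that power: powers are taken of eigenvalues, never of
  matrices.\<close>

definition spec_moment :: "nat \<Rightarrow> cmat \<Rightarrow> nat \<Rightarrow> cvec \<Rightarrow> real" where
  "spec_moment n M q a = (\<Sum>l<n. eigval n M l ^ q * ip_sq n (eigvec n M l) a)"

definition spec_trace :: "nat \<Rightarrow> cmat \<Rightarrow> nat \<Rightarrow> real" where
  "spec_trace n M q = (\<Sum>l<n. eigval n M l ^ q)"

definition opn :: "nat \<Rightarrow> cmat \<Rightarrow> real" where
  "opn n M = Max ((\<lambda>l. \<bar>eigval n M l\<bar>) ` {..<n})"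

lemma abs_eigval_le_opn: "l < n \<Longrightarrow> \<bar>eigval n M l\<bar> \<le> opn n M"
  by (auto simp: opn_def intro!: Max_ge)

lemma opn_nonneg: "n \<ge> 1 \<Longrightarrow> 0 \<le> opn n M"
  using abs_eigval_le_opn[of 0 n M] by fastforce

lemma opn_power_le_trace:
  assumes "n \<ge> 1"
  shows "opn n M ^ (2 * q) \<le> spec_trace n M (2 * q)"
proof -
  have "opn n M \<in> (\<lambda>l. \<bar>eigval n M l\<bar>) ` {..<n}"
    unfolding opn_def using assms by (intro Max_in) (auto simp: lessThan_empty_iff)
  then obtain l where l: "l < n" "opn n M = \<bar>eigval n M l\<bar>" by auto
  have "opn n M ^ (2 * q) = eigval n M l ^ (2 * q)" unfolding l(2) by (rule power_even_abs) simp
  also have "\<dots> \<le> spec_trace n M (2 * q)"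
    unfolding spec_trace_def using l(1) by (intro member_le_sum[where f = "\<lambda>l. eigval n M l ^ (2 * q)"]) auto
  finally show ?thesis .
qed

text \<open>Bessel's inequality for the single vector \<open>v\<close>.\<close>

lemma ip_le_sqn:
  assumes "sqn n v = 1"
  shows "ip_sq n x v \<le> sqn n x"
proof -
  have "orthonormal n 1 (\<lambda>_. v)" using assms by (simp add: orthonormal_def ip_self)
  from orthonormal_residual(2)[OF this, of x] have "ip_sq n v x \<le> sqn n x"
    using sqn_nonneg[of n "\<lambda>i. x i - ip n v x * v i"] by simp
  moreover have "cmod (ip n v x) = cmod (ip n x v)" by (metis cnj_ip complex_mod_cnj)
  ultimately show ?thesis by simp
qed

lemma EE_affine:
  "finite (set_pmf p) \<Longrightarrow> EE p (\<lambda>z. 1 + c * (g z / b - 1)) = 1 + c * (EE p g / b - 1)"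
  by (simp add: integrable_measure_pmf_finite)

text \<open>The terms i and M - i are paired. Since \<open>x ^ i - y ^ i\<close> and
  \<open>x ^ (M - i) - y ^ (M - i)\<close> never have opposite signs, the two mixed terms add up to
  at most \<open>x ^ M + y ^ M\<close>.\<close>

lemma power_sum_le:
  fixes x y :: real
  assumes "x \<ge> 0" "y \<ge> 0"
  shows "(\<Sum>i<Suc M. y ^ (M - i) * x ^ i) \<le> (real M + 1) / 2 * (x ^ M + y ^ M)"
proof -
  let ?f = "\<lambda>i. y ^ (M - i) * x ^ i"
  have "?f i + ?f (M - i) \<le> x ^ M + y ^ M" if "i < Suc M" for i
  proof -
    have M: "x ^ M = x ^ i * x ^ (M - i)" "y ^ M = y ^ i * y ^ (M - i)"
      using that by (simp_all flip: power_add)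
    have "0 \<le> (x ^ i - y ^ i) * (x ^ (M - i) - y ^ (M - i))"
    proof (cases "x \<le> y")
      case True
      then show ?thesis using assms by (intro mult_nonpos_nonpos) (auto intro: power_mono)
    next
      case False
      then have "y \<le> x" by simp
      then show ?thesis using assms by (intro mult_nonneg_nonneg) (auto intro: power_mono)
    qed
    then show ?thesis using that unfolding M by (simp add: algebra_simps)
  qed
  then have "(\<Sum>i<Suc M. ?f i + ?f (M - i)) \<le> (\<Sum>i<Suc M. x ^ M + y ^ M)" by (intro sum_mono) auto
  moreover have "(\<Sum>i<Suc M. ?f (M - i)) = (\<Sum>i<Suc M. ?f i)"
    using sum.nat_diff_reindex[of ?f "Suc M"] by simp
  ultimately have "2 * (\<Sum>i<Suc M. ?f i) \<le> (real M + 1) * (x ^ M + y ^ M)"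
    by (simp add: sum.distrib add.commute del: sum.lessThan_Suc)
  then show ?thesis by (simp del: sum.lessThan_Suc)
qed

text \<open>By \<open>PQ\<close> the difference of the matrices is c times the rank-one projection
  onto \<open>a\<close>. Expanded in the eigenbases of P and Q together, the difference of powers
  splits off the factor x - y of two eigenvalues, and this factor times the overlap of the two
  eigenvectors is c times the product of their overlaps with \<open>a\<close>. The weights thereby
  become nonnegative and only mixed powers remain, for \<open>power_sum_le\<close>; evenness of
  \<open>M\<close> removes the absolute values.\<close>

lemma spec_moment_diff:
  assumes P: "hermitian n P" and Q: "hermitian n Q"
    and PQ: "\<And>f g. ip n f (mv n P g) - ip n f (mv n Q g) = of_real c * ip n f a * ip n a g"
    and a: "sqn n a = 1" and M: "even M"
  shows "\<bar>spec_moment n P (Suc M) a - spec_moment n Q (Suc M) a\<bar> \<le>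
    \<bar>c\<bar> * ((real M + 1) / 2) * (spec_moment n P M a + spec_moment n Q M a)"
proof -
  let ?x = "eigval n P" and ?u = "eigvec n P" and ?y = "eigval n Q" and ?v = "eigvec n Q"
  let ?\<alpha> = "\<lambda>k. ip_sq n (?u k) a" and ?\<beta> = "\<lambda>l. ip_sq n (?v l) a"
  let ?W = "\<lambda>k l. ip n a (?u k) * ip n (?u k) (?v l) * ip n (?v l) a"
  note sP = spectral_eigval[OF P] and sQ = spectral_eigval[OF Q]
  note oP = orthonormal_eigvec[OF P] and oQ = orthonormal_eigvec[OF Q]
  have \<alpha>: "of_real (?\<alpha> k) = ip n a (?u k) * ip n (?u k) a" for k
    by (simp add: cnj_ip[of n "?u k" a, symmetric] mult_cnj_eq)
  have \<beta>: "of_real (?\<beta> l) = ip n a (?v l) * ip n (?v l) a" for l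
    by (simp add: cnj_ip[of n "?v l" a, symmetric] mult_cnj_eq)
  have A: "of_real (spec_moment n P q a) = (\<Sum>k<n. \<Sum>l<n. of_real (?x k ^ q) * ?W k l)" for q
    unfolding spec_moment_def of_real_sum of_real_mult \<alpha>
    by (subst (2) parseval[OF oQ]) (simp add: sum_distrib_left mult_ac)
  have B: "of_real (spec_moment n Q q a) = (\<Sum>k<n. \<Sum>l<n. of_real (?y l ^ q) * ?W k l)" for q
    unfolding spec_moment_def of_real_sum of_real_mult \<beta>
    by (subst sum.swap, subst parseval[OF oP, of a]) (simp add: sum_distrib_left sum_distrib_right mult_ac)
  have step: "of_real (?x k - ?y l) * ip n (?u k) (?v l) = of_real c * ip n (?u k) a * ip n a (?v l)"
    if "k < n" "l < n" for k l
  proof -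
    note 1 = spectral_ip_left[OF sP that(1) P] and 2 = spectral_ip_right[OF sQ that(2)]
    show ?thesis using PQ[of "?u k" "?v l"] unfolding 1 2 by (simp add: algebra_simps)
  qed
  let ?S = "\<lambda>k l. \<Sum>i<Suc M. ?y l ^ (M - i) * ?x k ^ i"
  have "of_real (spec_moment n P (Suc M) a - spec_moment n Q (Suc M) a) =
      (\<Sum>k<n. \<Sum>l<n. of_real (?x k ^ Suc M - ?y l ^ Suc M) * ?W k l)"
    unfolding of_real_diff A B by (simp add: sum_subtractf algebra_simps)
  also have "\<dots> = (\<Sum>k<n. \<Sum>l<n. of_real (c * (?\<alpha> k * ?\<beta> l * ?S k l)))"
  proof (intro sum.cong refl)
    fix k l assume "k \<in> {..<n}" "l \<in> {..<n}"
    then have kl: "k < n" "l < n" by auto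
    have "?x k ^ Suc M - ?y l ^ Suc M = (?x k - ?y l) * ?S k l"
      using power_diff_sumr2[of "?x k" "Suc M" "?y l"] by simp
    then have "of_real (?x k ^ Suc M - ?y l ^ Suc M) * ?W k l =
        of_real (?S k l) * ip n a (?u k) * (of_real (?x k - ?y l) * ip n (?u k) (?v l)) * ip n (?v l) a"
      by (simp only: of_real_mult mult_ac)
    also have "\<dots> = of_real (c * (?\<alpha> k * ?\<beta> l * ?S k l))"
      unfolding step[OF kl] of_real_mult \<alpha> \<beta> by (simp only: mult_ac)
    finally show "of_real (?x k ^ Suc M - ?y l ^ Suc M) * ?W k l = of_real (c * (?\<alpha> k * ?\<beta> l * ?S k l))" .
  qed
  also have "\<dots> = of_real (c * (\<Sum>k<n. \<Sum>l<n. ?\<alpha> k * ?\<beta> l * ?S k l))"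
    by (simp only: of_real_sum of_real_mult sum_distrib_left)
  finally have eq: "spec_moment n P (Suc M) a - spec_moment n Q (Suc M) a = c * (\<Sum>k<n. \<Sum>l<n. ?\<alpha> k * ?\<beta> l * ?S k l)"
    using of_real_eq_iff by blast
  have Sb: "\<bar>?S k l\<bar> \<le> (real M + 1) / 2 * (?x k ^ M + ?y l ^ M)" for k l
  proof -
    have "\<bar>?S k l\<bar> \<le> (\<Sum>i<Suc M. \<bar>?y l ^ (M - i) * ?x k ^ i\<bar>)" by (rule sum_abs)
    also have "\<dots> = (\<Sum>i<Suc M. \<bar>?y l\<bar> ^ (M - i) * \<bar>?x k\<bar> ^ i)" by (simp only: abs_mult power_abs)
    also have "\<dots> \<le> (real M + 1) / 2 * (\<bar>?x k\<bar> ^ M + \<bar>?y l\<bar> ^ M)" by (rule power_sum_le) auto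
    finally show ?thesis using M by (simp only: power_even_abs)
  qed
  have "\<bar>\<Sum>k<n. \<Sum>l<n. ?\<alpha> k * ?\<beta> l * ?S k l\<bar> \<le> (\<Sum>k<n. \<Sum>l<n. \<bar>?\<alpha> k * ?\<beta> l * ?S k l\<bar>)"
    by (intro order.trans[OF sum_abs] sum_mono sum_abs)
  also have "\<dots> \<le> (\<Sum>k<n. \<Sum>l<n. ?\<alpha> k * ?\<beta> l * ((real M + 1) / 2 * (?x k ^ M + ?y l ^ M)))"
  proof (intro sum_mono)
    fix k l
    have nn: "0 \<le> ?\<alpha> k * ?\<beta> l" by simp
    show "\<bar>?\<alpha> k * ?\<beta> l * ?S k l\<bar> \<le> ?\<alpha> k * ?\<beta> l * ((real M + 1) / 2 * (?x k ^ M + ?y l ^ M))"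
      unfolding abs_mult[of "?\<alpha> k * ?\<beta> l"] abs_of_nonneg[OF nn] by (rule mult_left_mono[OF Sb nn])
  qed
  also have "\<dots> = (real M + 1) / 2 * ((\<Sum>k<n. ?x k ^ M * ?\<alpha> k) * (\<Sum>l<n. ?\<beta> l) + (\<Sum>k<n. ?\<alpha> k) * (\<Sum>l<n. ?y l ^ M * ?\<beta> l))"
    unfolding sum_product unfolding sum.distrib[symmetric] unfolding sum_distrib_left
    by (intro sum.cong refl) (simp only: algebra_simps)
  also have "\<dots> = (real M + 1) / 2 * (spec_moment n P M a + spec_moment n Q M a)"
    using parseval_sqn[OF oP, of a] parseval_sqn[OF oQ, of a] a by (simp add: spec_moment_def)
  finally show ?thesis unfolding eq abs_mult by (simp add: mult_left_mono mult.assoc)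
qed

definition rank1_sum :: "('a \<Rightarrow> nat \<Rightarrow> complex) \<Rightarrow> real \<Rightarrow> nat set \<Rightarrow> (nat \<Rightarrow> 'a \<times> real) \<Rightarrow> nat \<Rightarrow> nat \<Rightarrow> complex" where
  "rank1_sum f K A z = (\<lambda>i j. \<Sum>k\<in>A. of_real (snd (z k) * K) * (f (fst (z k)) i * cnj (f (fst (z k)) j)))"

lemma hermitian_rank1_sum: "hermitian n (rank1_sum f K A z)"
  by (simp add: hermitian_def rank1_sum_def mult_ac)

lemma ip_rank1_sum:
  "ip n x (mv n (rank1_sum f K A z) y) =
    (\<Sum>k\<in>A. of_real (snd (z k) * K) * (ip n x (f (fst (z k))) * ip n (f (fst (z k))) y))"
proof -
  have "mv n (rank1_sum f K A z) y = (\<lambda>i. \<Sum>k\<in>A. of_real (snd (z k) * K) * ip n (f (fst (z k))) y * f (fst (z k)) i)"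
    unfolding mv_def rank1_sum_def ip_def sum_distrib_right sum_distrib_left
    by (rule ext, subst sum.swap) (simp add: mult_ac)
  then show ?thesis
    by (simp only: ip_sum_right ip_scale_right) (simp only: mult_ac)
qed

lemma qf_rank1_sum:
  "qf n (rank1_sum f K A z) x = of_real (\<Sum>k\<in>A. snd (z k) * (K * ip_sq n x (f (fst (z k)))))"
  unfolding qf_def ip_rank1_sum of_real_sum
  by (intro sum.cong refl) (simp add: cnj_ip[of n x, symmetric] mult_cnj_eq)

text \<open>For positive \<open>K\<close>, the operator norm of the matrix sum with all signs equal
  to 1, as the supremum of its quadratic form.\<close>

definition gram_sup :: "nat \<Rightarrow> ('a \<Rightarrow> nat \<Rightarrow> complex) \<Rightarrow> real \<Rightarrow> nat set \<Rightarrow> (nat \<Rightarrow> 'a) \<Rightarrow> real" where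
  "gram_sup n f K A a = (SUP x\<in>{x. sqn n x = 1}. \<Sum>j\<in>A. K * ip_sq n x (f (a j)))"

section \<open>Khintchine's inequality for random signs and Rudelson's bound\<close>

lemma map_flip_pair: "map_pmf (apsnd uminus) (pair_pmf p rademacher) = pair_pmf p rademacher"
proof -
  have "map_pmf uminus rademacher = rademacher"
    unfolding rademacher_def by (subst map_pmf_of_set_inj) (auto simp: insert_commute)
  then show ?thesis by (simp flip: pair_map_pmf2)
qed

context
  fixes n :: nat and p :: "'a pmf" and f :: "'a \<Rightarrow> nat \<Rightarrow> complex" and K :: real and m :: nat and d0 :: "'a \<times> real"
  assumes fin: "finite (set_pmf p)" and unit: "\<And>a. a \<in> set_pmf p \<Longrightarrow> sqn n (f a) = 1"
    and K: "K > 0" and n: "n \<ge> 2" and m: "m \<ge> 1"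
begin

private abbreviation (input) "A \<equiv> {..<m}"
private abbreviation (input) "J \<equiv> Pi_pmf {..<m} d0 (\<lambda>_. pair_pmf p rademacher)"
private abbreviation (input) "X z \<equiv> rank1_sum f K {..<m} z"
private abbreviation (input) "\<Lambda> z \<equiv> gram_sup n f K {..<m} (\<lambda>j. fst (z j))"

lemma finJ: "finite (set_pmf J)"
  using fin by (intro finite_set_Pi_pmf) auto

lemma J_mem: "z \<in> set_pmf J \<Longrightarrow> j < m \<Longrightarrow> fst (z j) \<in> set_pmf p \<and> snd (z j) \<in> {1, -1}"
  by (auto simp: set_Pi_pmf PiE_dflt_def mem_Times_iff)

lemma gram_le:
  assumes z: "\<And>j. j < m \<Longrightarrow> a j \<in> set_pmf p" and x: "sqn n x = 1"
  shows "(\<Sum>j<m. K * ip_sq n x (f (a j))) \<le> gram_sup n f K A a"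
  unfolding gram_sup_def
proof (rule cSUP_upper[OF _ bdd_above_of_abs])
  show "x \<in> {x. sqn n x = 1}" using x by simp
  fix x assume x: "x \<in> {x. sqn n x = 1}"
  have "(\<Sum>j<m. K * ip_sq n x (f (a j))) \<le> (\<Sum>j<m. K * 1)"
    using K ip_le_sqn[OF unit[OF z], of _ x] x by (intro sum_mono mult_left_mono) auto
  moreover have "(\<Sum>j<m. K * ip_sq n x (f (a j))) \<ge> 0" using K by (intro sum_nonneg) auto
  ultimately show "\<bar>\<Sum>j<m. K * ip_sq n x (f (a j))\<bar> \<le> m * K" by simp
qed

lemma gram_pos:
  assumes z: "\<And>j. j < m \<Longrightarrow> a j \<in> set_pmf p"
  shows "gram_sup n f K A a > 0"
proof -
  have u: "sqn n (f (a 0)) = 1" using unit z m by simp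
  have "0 < K * ip_sq n (f (a 0)) (f (a 0))" using K by (simp add: ip_self u)
  also have "\<dots> \<le> (\<Sum>j<m. K * ip_sq n (f (a 0)) (f (a j)))"
    using m K by (intro member_le_sum[where f = "\<lambda>j. K * ip_sq n (f (a 0)) (f (a j))"]) auto
  also have "\<dots> \<le> gram_sup n f K A a" by (rule gram_le[OF z u])
  finally show ?thesis .
qed

lemma spec_trace_nonneg: "0 \<le> spec_trace n M (2 * q)"
  unfolding spec_trace_def by (intro sum_nonneg) (simp add: zero_le_even_power)

text \<open>One of the q + 1 factors under the trace is expanded into its rank-one summands, which
  exposes a sign linearly in each term.\<close>

lemma trace_expand: "spec_trace n (X z) (Suc q) = (\<Sum>j<m. snd (z j) * (K * spec_moment n (X z) q (f (fst (z j)))))"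
proof -
  have evl: "eigval n (X z) l = (\<Sum>j<m. snd (z j) * (K * ip_sq n (eigvec n (X z) l) (f (fst (z j)))))" if "l < n" for l
  proof -
    have "qf n (X z) (eigvec n (X z) l) = of_real (eigval n (X z) l)"
      unfolding qf_def spectral_ip_right[OF spectral_eigval[OF hermitian_rank1_sum] that]
      using orthonormal_eigvec[OF hermitian_rank1_sum[of n f K A z]] that by (simp add: orthonormal_def)
    then show ?thesis unfolding qf_rank1_sum by (simp only: of_real_eq_iff)
  qed
  have "spec_trace n (X z) (Suc q) = (\<Sum>l<n. eigval n (X z) l ^ q * eigval n (X z) l)"
    by (simp add: spec_trace_def mult.commute)
  also have "\<dots> = (\<Sum>l<n. eigval n (X z) l ^ q * (\<Sum>j<m. snd (z j) * (K * ip_sq n (eigvec n (X z) l) (f (fst (z j))))))"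
    by (intro sum.cong refl arg_cong2[where f = "(*)"] evl) auto
  also have "\<dots> = (\<Sum>j<m. \<Sum>l<n. eigval n (X z) l ^ q * (snd (z j) * (K * ip_sq n (eigvec n (X z) l) (f (fst (z j))))))"
    unfolding sum_distrib_left by (rule sum.swap)
  finally show ?thesis unfolding spec_moment_def sum_distrib_left by (simp only: mult_ac)
qed

text \<open>The left side is the trace of the q-th power of \<open>X z\<close> against the matrix
  sum without signs. For even q that power is positive, so the norm of the unsigned sum comes
  out.\<close>

lemma moment_sum_le:
  assumes z: "z \<in> set_pmf J" and q: "even q"
  shows "(\<Sum>j<m. K * spec_moment n (X z) q (f (fst (z j)))) \<le> \<Lambda> z * spec_trace n (X z) q"
proof -
  have "(\<Sum>j<m. K * spec_moment n (X z) q (f (fst (z j)))) =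
      (\<Sum>l<n. eigval n (X z) l ^ q * (\<Sum>j<m. K * ip_sq n (eigvec n (X z) l) (f (fst (z j)))))"
    unfolding spec_moment_def sum_distrib_left by (subst sum.swap) (simp add: mult_ac)
  also have "\<dots> \<le> (\<Sum>l<n. eigval n (X z) l ^ q * \<Lambda> z)"
    using q J_mem[OF z] orthonormal_eigvec[OF hermitian_rank1_sum[of n f K A z]]
    by (intro sum_mono mult_left_mono gram_le) (auto simp: zero_le_even_power orthonormal_def sqn_alt)
  also have "\<dots> = \<Lambda> z * spec_trace n (X z) q"
    unfolding spec_trace_def sum_distrib_left by (simp add: mult.commute)
  finally show ?thesis .
qed

lemma rank1_sum_flip_diff:
  assumes j: "j < m"
  shows "ip n x (mv n (X z) y) - ip n x (mv n (X (z(j := apsnd uminus (z j)))) y) =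
    of_real (2 * snd (z j) * K) * ip n x (f (fst (z j))) * ip n (f (fst (z j))) y"
proof -
  let ?t = "\<lambda>z k. of_real (snd (z k) * K) * (ip n x (f (fst (z k))) * ip n (f (fst (z k))) y)"
  let ?z = "z(j := apsnd uminus (z j))"
  have "(\<Sum>k<m. ?t z k) = ?t z j + (\<Sum>k\<in>A - {j}. ?t z k)" by (rule sum.remove) (use j in auto)
  moreover have "(\<Sum>k<m. ?t ?z k) = ?t ?z j + (\<Sum>k\<in>A - {j}. ?t ?z k)" by (rule sum.remove) (use j in auto)
  moreover have "(\<Sum>k\<in>A - {j}. ?t ?z k) = (\<Sum>k\<in>A - {j}. ?t z k)" by (intro sum.cong) auto
  ultimately have "(\<Sum>k<m. ?t z k) - (\<Sum>k<m. ?t ?z k) = ?t z j - ?t ?z j" by (simp only: add_diff_cancel_right)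
  then show ?thesis unfolding ip_rank1_sum by (simp add: algebra_simps)
qed

text \<open>Averaging over the sign of index j compares the odd moment of \<open>X z\<close> with
  that after a flip, a rank-one perturbation of size 2 K; \<open>spec_moment_diff\<close> bounds the
  difference by even moments. \<open>h\<close> is blind to flips and so stays outside this
  average.\<close>

lemma khintchine_step:
  assumes h: "\<And>z. h z \<ge> (0::real)" and hf: "\<And>z j. j < m \<Longrightarrow> h (z(j := apsnd uminus (z j))) = h z"
  shows "EE J (\<lambda>z. h z * spec_trace n (X z) (2 * Suc q)) \<le>
    K * (2 * real q + 1) * EE J (\<lambda>z. h z * \<Lambda> z * spec_trace n (X z) (2 * q))"
proof -
  let ?fl = "\<lambda>j z. z(j := apsnd uminus (z j))"
  let ?a = "\<lambda>z j. f (fst (z j))"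
  have flip: "EE J F = EE J (\<lambda>z. F (?fl j z))" if "j < m" for F j
    by (rule EE_Pi_flip) (use that fin map_flip_pair in auto)
  let ?G = "\<lambda>j z. h z * (snd (z j) * (K * spec_moment n (X z) (Suc (2 * q)) (?a z j)))"
  let ?H = "\<lambda>j z. h z * (K * spec_moment n (X z) (2 * q) (?a z j))"
  have step: "EE J (?G j) \<le> K * (2 * real q + 1) * EE J (?H j)" if j: "j < m" for j
  proof -
    have "?G j z + ?G j (?fl j z) \<le> K * (2 * real q + 1) * (?H j z + ?H j (?fl j z))" if z: "z \<in> set_pmf J" for z
    proof -
      let ?o = "spec_moment n (X z) (Suc (2 * q)) (?a z j) - spec_moment n (X (?fl j z)) (Suc (2 * q)) (?a z j)"
      let ?e = "spec_moment n (X z) (2 * q) (?a z j) + spec_moment n (X (?fl j z)) (2 * q) (?a z j)"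
      have a: "sqn n (?a z j) = 1" and s: "\<bar>snd (z j)\<bar> = 1" using J_mem[OF z j] unit by auto
      have "\<bar>?o\<bar> \<le>
        \<bar>2 * snd (z j) * K\<bar> * ((real (2 * q) + 1) / 2) * (?e)"
        by (rule spec_moment_diff, rule hermitian_rank1_sum, rule hermitian_rank1_sum, rule rank1_sum_flip_diff[OF j], rule a, simp)
      also have "\<dots> = K * (2 * real q + 1) * (?e)"
        using s K by (simp add: abs_mult)
      finally have "snd (z j) * (?o) \<le>
        K * (2 * real q + 1) * (?e)"
        using s by (auto simp: abs_if split: if_splits)
      then have "h z * K * (snd (z j) * (?o)) \<le>
        h z * K * (K * (2 * real q + 1) * (?e))"
        using h K by (intro mult_left_mono) auto
      then show ?thesis unfolding hf[OF j] by (simp add: algebra_simps)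
    qed
    then have "EE J (\<lambda>z. ?G j z + ?G j (?fl j z)) \<le> EE J (\<lambda>z. K * (2 * real q + 1) * (?H j z + ?H j (?fl j z)))"
      by (intro EE_mono finJ)
    then have "EE J (?G j) + EE J (\<lambda>z. ?G j (?fl j z)) \<le> K * (2 * real q + 1) * (EE J (?H j) + EE J (\<lambda>z. ?H j (?fl j z)))"
      unfolding EE_add[OF finJ] EE_scale .
    then show ?thesis unfolding flip[OF j, of "?G j", symmetric] flip[OF j, of "?H j", symmetric] by simp
  qed
  have "EE J (\<lambda>z. h z * spec_trace n (X z) (2 * Suc q)) = (\<Sum>j<m. EE J (?G j))"
    unfolding EE_sum[OF finJ, symmetric] using trace_expand[of _ "Suc (2 * q)"] by (simp add: sum_distrib_left)
  also have "\<dots> \<le> (\<Sum>j<m. K * (2 * real q + 1) * EE J (?H j))" by (intro sum_mono step) auto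
  also have "\<dots> = K * (2 * real q + 1) * EE J (\<lambda>z. h z * (\<Sum>j<m. K * spec_moment n (X z) (2 * q) (?a z j)))"
    unfolding sum_distrib_left[symmetric] EE_sum[OF finJ, symmetric] ..
  also have "\<dots> \<le> K * (2 * real q + 1) * EE J (\<lambda>z. h z * (\<Lambda> z * spec_trace n (X z) (2 * q)))"
    using K h moment_sum_le[of _ "2 * q"] by (intro mult_left_mono EE_mono finJ) auto
  finally show ?thesis by (simp add: mult.assoc)
qed

text \<open>\<open>\<Lambda>\<close> does not depend on the signs, so dividing by its powers allows signs and vectors to be averaged
  together.\<close>

lemma khintchine:
  assumes "q \<le> P"
  shows "EE J (\<lambda>z. spec_trace n (X z) (2 * q) / \<Lambda> z ^ q) \<le> real n * (2 * real P * K) ^ q"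
  using assms
proof (induction q)
  case 0
  then show ?case by (simp add: spec_trace_def)
next
  case (Suc q)
  \<comment> \<open>The absolute value makes the weight nonnegative at every \<open>z\<close>;
    positivity of \<open>\<Lambda> z\<close> is known only on the support.\<close>
  let ?h = "\<lambda>z. \<bar>1 / \<Lambda> z ^ Suc q\<bar>"
  have fst_upd: "(\<lambda>k. fst ((z(j := apsnd uminus (z j))) k)) = (\<lambda>k. fst (z k))" for z :: "nat \<Rightarrow> 'a \<times> real" and j
    by auto
  have pos: "\<Lambda> z > 0" if "z \<in> set_pmf J" for z
    using J_mem[OF that] by (intro gram_pos) auto
  have "EE J (\<lambda>z. spec_trace n (X z) (2 * Suc q) / \<Lambda> z ^ Suc q) = EE J (\<lambda>z. ?h z * spec_trace n (X z) (2 * Suc q))"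
    using pos by (intro EE_cong) (simp add: abs_of_pos)
  also have "\<dots> \<le> K * (2 * real q + 1) * EE J (\<lambda>z. ?h z * \<Lambda> z * spec_trace n (X z) (2 * q))"
    by (rule khintchine_step) (simp_all only: fst_upd abs_ge_zero)
  also have "EE J (\<lambda>z. ?h z * \<Lambda> z * spec_trace n (X z) (2 * q)) = EE J (\<lambda>z. spec_trace n (X z) (2 * q) / \<Lambda> z ^ q)"
  proof (rule EE_cong)
    fix z assume "z \<in> set_pmf J"
    from pos[OF this] show "?h z * \<Lambda> z * spec_trace n (X z) (2 * q) = spec_trace n (X z) (2 * q) / \<Lambda> z ^ q"
      by (simp add: abs_of_pos)
  qed
  also have "K * (2 * real q + 1) * EE J (\<lambda>z. spec_trace n (X z) (2 * q) / \<Lambda> z ^ q) \<le>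
      (2 * real P * K) * (real n * (2 * real P * K) ^ q)"
  proof (rule mult_mono)
    \<comment> \<open>Fixing \<open>P\<close> beforehand bounds every step by the same factor:
      \<open>Suc q \<le> P\<close> gives 2 q + 1 \<le> 2 P.\<close>
    show "K * (2 * real q + 1) \<le> 2 * real P * K" using Suc.prems K by simp
    show "EE J (\<lambda>z. spec_trace n (X z) (2 * q) / \<Lambda> z ^ q) \<le> real n * (2 * real P * K) ^ q"
      using Suc by simp
    show "0 \<le> EE J (\<lambda>z. spec_trace n (X z) (2 * q) / \<Lambda> z ^ q)"
      using pos by (intro EE_nonneg divide_nonneg_nonneg zero_le_power spec_trace_nonneg) (auto intro: less_imp_le)
  qed (use K in auto)
  finally show ?case by (simp add: mult_ac)
qed

text \<open>Let u be the mean norm and L the mean of \<open>\<Lambda>\<close>. Khintchine bounds the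
  mean of \<open>?Q\<close>, the squared norm over \<open>\<Lambda>\<close>, by \<open>B\<close>;
  symmetrisation gives L \<le> (3/2) m + 2 u; and u is at most R times the mean of \<open>?Q\<close>
  plus L / (4 R). Together they bound u by a quantity containing u / (2 R), which R \<ge> 1 allows
  to be absorbed.\<close>

theorem rudelson:
  assumes P: "P = nat \<lceil>ln (real n)\<rceil>" and B: "B = 2 * exp 1 * real P * K" "B \<le> real m"
    and iso: "\<And>x. sqn n x = 1 \<Longrightarrow> EE p (\<lambda>a. K * ip_sq n x (f a)) \<le> 3 / 2"
  shows "EE J (\<lambda>z. opn n (X z)) \<le> 3 * sqrt (real m * B)"
proof -
  have lnn: "ln (real n) > 0" using n by simp
  have P1: "P \<ge> 1" "ln (real n) \<le> P" unfolding P using lnn by linarith+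
  have B0: "B > 0" unfolding B(1) using K P1 by simp
  have pos: "\<Lambda> z > 0" if "z \<in> set_pmf J" for z
    using J_mem[OF that] by (intro gram_pos) auto
  let ?Q = "\<lambda>z. (opn n (X z))\<^sup>2 / \<Lambda> z"
  have Q0: "?Q z \<ge> 0" if "z \<in> set_pmf J" for z using pos[OF that] by simp
  have EQ: "EE J ?Q \<le> B"
  proof -
    \<comment> \<open>This is the reason for \<open>P\<close> of order ln n: the P-th root of the
      dimension factor n is at most e.\<close>
    have "real n = exp (ln (real n))" using n by simp
    also have "\<dots> \<le> exp (real P)" using P1 by simp
    finally have nP: "real n \<le> exp 1 ^ P" by (simp add: exp_of_nat_mult[symmetric])
    have "EE J (\<lambda>z. ?Q z ^ P) \<le> EE J (\<lambda>z. spec_trace n (X z) (2 * P) / \<Lambda> z ^ P)"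
    proof (rule EE_mono[OF finJ])
      fix z assume z: "z \<in> set_pmf J"
      have "?Q z ^ P = opn n (X z) ^ (2 * P) / \<Lambda> z ^ P" by (simp add: power_divide power_mult)
      also have "\<dots> \<le> spec_trace n (X z) (2 * P) / \<Lambda> z ^ P"
        using n pos[OF z] by (intro divide_right_mono opn_power_le_trace) auto
      finally show "?Q z ^ P \<le> spec_trace n (X z) (2 * P) / \<Lambda> z ^ P" .
    qed
    also have "\<dots> \<le> real n * (2 * real P * K) ^ P" by (rule khintchine) simp
    also have "\<dots> \<le> exp 1 ^ P * (2 * real P * K) ^ P" using nP K by (intro mult_right_mono) auto
    also have "\<dots> = B ^ P" by (simp add: B(1) power_mult_distrib[symmetric] mult_ac)
    finally have QP: "EE J (\<lambda>z. ?Q z ^ P) \<le> B ^ P" .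
    \<comment> \<open>The tangent of x^P at x = 1 (Bernoulli) replaces Jensen: a P-th moment of
      \<open>?Q z / B\<close> at most 1 forces a mean at most 1.\<close>
    have "EE J (\<lambda>z. 1 + real P * (?Q z / B - 1)) \<le> EE J (\<lambda>z. (1 / B ^ P) * ?Q z ^ P)"
    proof (rule EE_mono[OF finJ])
      fix z assume "z \<in> set_pmf J"
      then have "?Q z / B \<ge> 0" by (intro divide_nonneg_pos Q0 B0)
      then have "?Q z / B - 1 \<ge> -1" by linarith
      from Bernoulli_inequality[OF this, of P] show "1 + real P * (?Q z / B - 1) \<le> (1 / B ^ P) * ?Q z ^ P"
        by (simp add: power_divide power_mult_distrib mult.commute)
    qed
    also have "\<dots> \<le> 1" unfolding EE_scale using QP B0 by (simp add: divide_simps)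
    also have "EE J (\<lambda>z. 1 + real P * (?Q z / B - 1)) = 1 + real P * (EE J ?Q / B - 1)"
      by (rule EE_affine[OF finJ])
    finally have "real P * (EE J ?Q / B - 1) \<le> 0" by simp
    then have "EE J ?Q / B \<le> 1" using P1 by (simp add: mult_le_0_iff)
    then show ?thesis using B0 by (simp add: divide_simps)
  qed
  define u where "u = EE J (\<lambda>z. opn n (X z))"
  define L where "L = EE J \<Lambda>"
  let ?S = "{x. sqn n x = 1}"
  let ?Y = "\<lambda>x a. K * ip_sq n x (f a)"
  have S: "?S \<noteq> {}" using sqn_unitvec[of 0 n] n by (metis (mono_tags, lifting) empty_iff mem_Collect_eq not_less_eq_eq numeral_2_eq_2 less_le_trans zero_less_Suc)
  have Yb: "\<bar>?Y x a\<bar> \<le> K" if "x \<in> ?S" "a \<in> set_pmf p" for x a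
    using ip_le_sqn[OF unit[OF that(2)], of x] that K by (simp add: abs_mult)
  have LL: "L \<le> 3 / 2 * m + 2 * u"
  proof -
    \<comment> \<open>Symmetrisation bounds the mean minus the sample; with
      \<open>\<psi> = uminus\<close> it bounds the sample minus the mean.\<close>
    let ?W = "\<lambda>x a. 0 + (\<Sum>j<m. EE p (\<lambda>a. - ?Y x a) - - ?Y x (a j))"
    have "EE (Pi_pmf A (fst d0) (\<lambda>_. p)) (\<lambda>a. SUP x\<in>?S. ?W x a)
      \<le> EE J (\<lambda>z. SUP x\<in>?S. 0 + (\<Sum>j<m. 2 * 1 * snd (z j) * ?Y x (fst (z j))))"
      by (rule symmetrization_contraction[OF fin S Yb, where \<psi> = uminus and C = 0]) auto
    also have "\<dots> \<le> EE J (\<lambda>z. 2 * opn n (X z))"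
    proof (rule EE_mono[OF finJ], rule cSUP_least[OF S])
      fix z x assume z: "z \<in> set_pmf J" and x: "x \<in> ?S"
      have h: "hermitian n (X z)" by (rule hermitian_rank1_sum)
      have "complex_of_real (\<Sum>j<m. snd (z j) * ?Y x (fst (z j))) = of_real (\<Sum>l<n. eigval n (X z) l * ip_sq n (eigvec n (X z) l) x)"
        unfolding qf_rank1_sum[symmetric] by (rule qf_spectral[OF spectral_eigval[OF h] h])
      then have "(\<Sum>j<m. snd (z j) * ?Y x (fst (z j))) = (\<Sum>l<n. eigval n (X z) l * ip_sq n (eigvec n (X z) l) x)"
        using of_real_eq_iff by blast
      also have "\<dots> \<le> (\<Sum>l<n. opn n (X z) * ip_sq n (eigvec n (X z) l) x)"
        using abs_eigval_le_opn[of _ n "X z"] by (intro sum_mono mult_right_mono) (auto intro: abs_le_D1)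
      also have "\<dots> = opn n (X z)"
        using parseval_sqn[OF orthonormal_eigvec[OF h], of x] x by (simp flip: sum_distrib_left)
      finally show "0 + (\<Sum>j<m. 2 * 1 * snd (z j) * ?Y x (fst (z j))) \<le> 2 * opn n (X z)"
        by (simp add: sum_distrib_left[symmetric] mult.assoc)
    qed
    also have "\<dots> = 2 * u" by (simp add: u_def)
    finally have 1: "EE (Pi_pmf A (fst d0) (\<lambda>_. p)) (\<lambda>a. SUP x\<in>?S. ?W x a) \<le> 2 * u" .
    have finP: "finite (set_pmf (Pi_pmf A (fst d0) (\<lambda>_. p)))" using fin by (intro finite_set_Pi_pmf) auto
    have "L = EE (Pi_pmf A (fst d0) (\<lambda>_. p)) (gram_sup n f K A)"
      unfolding L_def using EE_Pi_fst[of A "fst d0" p "gram_sup n f K A" "snd d0" rademacher] by simp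
    also have "\<dots> \<le> EE (Pi_pmf A (fst d0) (\<lambda>_. p)) (\<lambda>a. 3 / 2 * m + (SUP x\<in>?S. ?W x a))"
    proof (rule EE_mono[OF finP])
      fix a assume a: "a \<in> set_pmf (Pi_pmf A (fst d0) (\<lambda>_. p))"
      have aj: "a j \<in> set_pmf p" if "j < m" for j using a that by (auto simp: set_Pi_pmf PiE_dflt_def)
      show "gram_sup n f K A a \<le> 3 / 2 * m + (SUP x\<in>?S. ?W x a)"
        unfolding gram_sup_def
      proof (rule cSUP_least[OF S])
        fix x assume x: "x \<in> ?S"
        have EY: "\<bar>EE p (?Y x)\<bar> \<le> K" if "x \<in> ?S" for x
        proof -
          have "EE p (?Y x) \<le> EE p (\<lambda>_. K)" using Yb[OF that] by (intro EE_mono fin) (meson abs_le_D1)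
          moreover have "EE p (?Y x) \<ge> 0" using K by (intro EE_nonneg) auto
          ultimately show ?thesis by simp
        qed
        have "(\<Sum>j<m. ?Y x (a j)) = (\<Sum>j<m. EE p (?Y x)) + ?W x a"
          by (simp add: sum_subtractf sum_negf)
        also have "\<dots> \<le> 3 / 2 * m + (SUP x\<in>?S. ?W x a)"
        proof (rule add_mono)
          have "(\<Sum>j<m. EE p (?Y x)) \<le> (\<Sum>j<m. 3 / 2)" using x by (intro sum_mono iso) simp
          then show "(\<Sum>j<m. EE p (?Y x)) \<le> 3 / 2 * m" by (simp add: mult.commute)
          show "?W x a \<le> (SUP x\<in>?S. ?W x a)"
          proof (rule cSUP_upper[OF x bdd_above_of_abs])
            fix x assume x: "x \<in> ?S"
            have "\<bar>EE p (\<lambda>a. - ?Y x a) - - ?Y x (a j)\<bar> \<le> 2 * K" if "j < m" for j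
              unfolding Bochner_Integration.integral_minus using EY[OF x] Yb[OF x aj[OF that]] by linarith
            then have "\<bar>\<Sum>j<m. EE p (\<lambda>a. - ?Y x a) - - ?Y x (a j)\<bar> \<le> (\<Sum>j<m. 2 * K)"
              by (intro order.trans[OF sum_abs] sum_mono) auto
            then show "\<bar>?W x a\<bar> \<le> m * (2 * K)" by simp
          qed
        qed
        finally show "(\<Sum>j<m. ?Y x (a j)) \<le> 3 / 2 * m + (SUP x\<in>?S. ?W x a)" .
      qed
    qed
    also have "\<dots> \<le> 3 / 2 * m + 2 * u" unfolding EE_add[OF finP] EE_const using 1 by simp
    finally show ?thesis .
  qed
  \<comment> \<open>The balance point: both \<open>R * B\<close> and \<open>m / R\<close> equal
    \<open>sqrt (m * B)\<close>.\<close>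
  define R where "R = sqrt (real m / B)"
  have m0: "real m > 0" using m by simp
  have R1: "R \<ge> 1" unfolding R_def using B(2) B0 by (simp add: divide_simps)
  have R2: "R\<^sup>2 * B = m" unfolding R_def using B0 m0 by simp
  have RB: "sqrt (real m * B) = R * B"
    by (rule real_sqrt_unique) (use R1 B0 R2 in \<open>auto simp: power_mult_distrib power2_eq_square\<close>)
  have u0: "u \<ge> 0" unfolding u_def using n by (intro EE_nonneg opn_nonneg) auto
  have "u \<le> EE J (\<lambda>z. R * ?Q z + (1 / (4 * R)) * \<Lambda> z)"
    unfolding u_def
  proof (rule EE_mono[OF finJ])
    fix z assume z: "z \<in> set_pmf J"
    let ?o = "opn n (X z)"
    \<comment> \<open>The weighted inequality between arithmetic and geometric mean for
      \<open>?Q z\<close> and \<open>\<Lambda> z\<close>, whose product is the squared norm.\<close>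
    have "0 \<le> (2 * R * ?o - \<Lambda> z)\<^sup>2" by simp
    then have "4 * R * \<Lambda> z * ?o \<le> 4 * R\<^sup>2 * ?o\<^sup>2 + (\<Lambda> z)\<^sup>2" by (simp add: power2_eq_square algebra_simps)
    then show "?o \<le> R * ?Q z + (1 / (4 * R)) * \<Lambda> z"
      using pos[OF z] R1 by (simp add: field_simps power2_eq_square)
  qed
  also have "\<dots> = R * EE J ?Q + (1 / (4 * R)) * L"
    unfolding EE_add[OF finJ] EE_scale L_def ..
  also have "\<dots> \<le> R * B + (1 / (4 * R)) * (3 / 2 * m + 2 * u)"
    using EQ LL R1 by (intro add_mono mult_left_mono) auto
  also have "\<dots> = R * B + (3 / 8) * (R * B) + u / (2 * R)"
    using R1 by (simp add: R2[symmetric] field_simps power2_eq_square)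
  also have "u / (2 * R) \<le> u / 2" using u0 R1 by (intro divide_left_mono) auto
  finally have "u \<le> R * B + (3 / 8) * (R * B) + u / 2" by simp
  moreover have "R * B > 0" using R1 B0 by simp
  ultimately have "u \<le> 3 * (R * B)" by linarith
  then show ?thesis unfolding u_def RB .
qed

end

section \<open>Nuclear norm and its descent directions\<close>

abbreviation entries :: "complex mat \<Rightarrow> nat \<Rightarrow> nat \<Rightarrow> complex" where
  "entries X \<equiv> \<lambda>i j. X $$ (i, j)"

section \<open>Nuclear norm and rank in terms of eigenvalues\<close>

lemma hermitian_matsD:
  assumes "X \<in> hermitian_mats n"
  shows "X \<in> carrier_mat n n" "hermitian n (entries X)"
proof -
  show X: "X \<in> carrier_mat n n" using assms by (simp add: hermitian_mats_def)
  have adj: "mat_adjoint X = X" using assms by (simp add: hermitian_mats_def)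
  show "hermitian n (entries X)"
    unfolding hermitian_def
  proof (intro allI impI)
    fix i j assume "i < n" "j < n"
    then have "mat_adjoint X $$ (j, i) = cnj (X $$ (i, j))"
      using X by (simp add: mat_adjoint_def mat_of_rows_def)
    then show "X $$ (j, i) = cnj (X $$ (i, j))" using adj by simp
  qed
qed

lemma spectral_entries:
  assumes "spectral n M e u" "hermitian n M" "i < n" "j < n"
  shows "M i j = (\<Sum>l<n. of_real (e l) * u l i * cnj (u l j))"
proof -
  have "mv n M (unitvec j) i = (\<Sum>b<n. if b = j then M i b else 0)"
    unfolding mv_def by (intro sum.cong) auto
  then have "M i j = ip n (unitvec i) (mv n M (unitvec j))"
    using assms(3,4) by (simp add: ip_unitvec_left)
  also have "\<dots> = (\<Sum>l<n. of_real (e l) * u l i * cnj (u l j))"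
    unfolding spectral_ip[OF assms(1,2)] using assms(3,4) by (simp add: ip_unitvec_left ip_unitvec)
  finally show ?thesis .
qed

lemma orthonormal_columns:
  assumes "orthonormal n n u" "i < n" "j < n"
  shows "(\<Sum>l<n. u l i * cnj (u l j)) = (if i = j then 1 else 0)"
  using orthonormal_complete[OF assms(1,2), of "unitvec j"] assms(2,3)
  by (simp add: ip_unitvec mult.commute)

lemma proots_linear_prod:
  fixes f :: "'b \<Rightarrow> 'a::idom"
  shows "proots (\<Prod>x\<leftarrow>xs. [:- f x, 1:]) = mset (map f xs)"
proof (induction xs)
  case (Cons x xs)
  have "(\<Prod>x\<leftarrow>xs. [:- f x, 1:]) \<noteq> 0" by (auto simp: prod_list_zero_iff)
  then show ?case using Cons by (simp add: proots_mult del: mult_pCons_left)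
qed simp

text \<open>X is its own adjoint and \<open>X * X\<close> is similar to the diagonal matrix of
  squared eigenvalues, so these are the roots of its characteristic polynomial with multiplicity,
  and the singular values are their square roots.\<close>

lemma nuclear_norm_spectral:
  assumes X: "X \<in> hermitian_mats n" and sp: "spectral n (entries X) e u"
  shows "nuclear_norm X = (\<Sum>l<n. \<bar>e l\<bar>)"
proof -
  note Xc = hermitian_matsD(1)[OF X] and h = hermitian_matsD(2)[OF X]
  have on: "orthonormal n n u" using sp by (simp add: spectral_def)
  define U where "U = mat n n (\<lambda>(i, l). u l i)"
  define V where "V = mat n n (\<lambda>(l, i). cnj (u l i))"
  define D where "D = mat n n (\<lambda>(i, j). if i = j then complex_of_real ((e i)\<^sup>2) else 0)"
  have VU: "V * U = 1\<^sub>m n"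
    using on by (intro eq_matI) (auto simp: U_def V_def scalar_prod_def atLeast0LessThan orthonormal_def ip_def)
  have UV: "U * V = 1\<^sub>m n"
    using orthonormal_columns[OF on]
    by (intro eq_matI) (auto simp: U_def V_def scalar_prod_def atLeast0LessThan)
  have UD: "U * D = mat n n (\<lambda>(i, l). u l i * of_real ((e l)\<^sup>2))"
    by (intro eq_matI) (auto simp: U_def D_def scalar_prod_def atLeast0LessThan if_distrib cong: if_cong)
  have XX: "X * X = U * D * V"
  proof (rule eq_matI)
    fix i j assume "i < dim_row (U * D * V)" "j < dim_col (U * D * V)"
    then have ij: "i < n" "j < n" by (auto simp: U_def V_def)
    have "(X * X) $$ (i, j) = (\<Sum>a<n. X $$ (i, a) * X $$ (a, j))"
      using ij Xc by (auto simp: scalar_prod_def atLeast0LessThan)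
    also have "\<dots> = (\<Sum>a<n. \<Sum>l<n. of_real (e l) * cnj (u l j) * (X $$ (i, a) * u l a))"
      using spectral_entries[OF sp h _ ij(2)] by (intro sum.cong refl) (simp add: sum_distrib_left mult_ac)
    also have "\<dots> = (\<Sum>l<n. \<Sum>a<n. of_real (e l) * cnj (u l j) * (X $$ (i, a) * u l a))" by (rule sum.swap)
    also have "\<dots> = (\<Sum>l<n. of_real (e l) * cnj (u l j) * mv n (entries X) (u l) i)"
      by (simp add: mv_def sum_distrib_left)
    also have "\<dots> = (\<Sum>l<n. u l i * of_real ((e l)\<^sup>2) * cnj (u l j))"
      using sp ij by (intro sum.cong refl) (simp add: spectral_def power2_eq_square mult_ac)
    also have "\<dots> = (U * D * V) $$ (i, j)"
      unfolding UD using ij by (simp add: V_def scalar_prod_def atLeast0LessThan)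
    finally show "(X * X) $$ (i, j) = (U * D * V) $$ (i, j)" .
  qed (use Xc in \<open>auto simp: U_def V_def\<close>)
  have Dc: "D \<in> carrier_mat n n" by (simp add: D_def)
  have "similar_mat_wit (X * X) D U V"
    by (rule similar_mat_witI[OF UV VU XX]) (use Xc in \<open>auto simp: U_def V_def D_def\<close>)
  then have "similar_mat (X * X) D" unfolding similar_mat_def by blast
  then have "char_poly (X * X) = char_poly D" by (rule char_poly_similar)
  also have "\<dots> = (\<Prod>a \<leftarrow> diag_mat D. [:- a, 1:])"
    by (rule char_poly_upper_triangular[OF Dc]) (auto simp: D_def upper_triangular_def)
  also have "diag_mat D = map (\<lambda>i. of_real ((e i)\<^sup>2)) [0..<n]"
    by (auto simp: diag_mat_def D_def)
  also have "(\<Prod>a \<leftarrow> map (\<lambda>i. of_real ((e i)\<^sup>2)) [0..<n]. [:- a, 1:]) =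
      (\<Prod>i \<leftarrow> [0..<n]. [:- of_real ((e i)\<^sup>2), 1:])" by (simp add: o_def)
  finally have pr: "proots (char_poly (X * X)) = mset (map (\<lambda>i. of_real ((e i)\<^sup>2)) [0..<n])"
    by (simp only: proots_linear_prod)
  have "nuclear_norm X = sum_list (map (\<lambda>i. \<bar>e i\<bar>) [0..<n])"
    using X unfolding nuclear_norm_def singular_values_def hermitian_mats_def
    by (simp add: pr o_def flip: sum_mset_sum_list mset_map del: mset_map of_real_power)
  then show ?thesis by (simp add: interv_sum_list_conv_sum_set_nat atLeast0LessThan)
qed

text \<open>The rank is the size of a maximal independent set \<open>S\<close> of columns, whose
  span contains every column. Eigenvectors of nonzero eigenvalues are X applied to multiples of
  themselves, hence lie in that span; being independent, they number at most \<open>card S\<close>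
  by Steinitz exchange.\<close>

lemma rank_ge_nonzero_eigenvalues:
  assumes X: "X \<in> hermitian_mats n" and sp: "spectral n (entries X) e u"
  shows "card {l. l < n \<and> e l \<noteq> 0} \<le> vec_space.rank n X"
proof -
  interpret vec_space "TYPE(complex)" n .
  note Xc = hermitian_matsD(1)[OF X]
  let ?R = "{l. l < n \<and> e l \<noteq> 0}"
  let ?C = "set (cols X)"
  have Cc: "?C \<subseteq> carrier_vec n" using cols_dim Xc by blast
  have "lin_indpt {}" by (rule finite_lin_indpt2) auto
  then obtain S where S: "finite S" "maximal S (\<lambda>T. T \<subseteq> ?C \<and> lin_indpt T)"
    using maximal_exists_superset[of ?C "\<lambda>T. T \<subseteq> ?C \<and> lin_indpt T" "{}"] by auto
  have rank: "rank X = card S" by (rule rank_card_indpt[OF Xc S(2)])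
  have SC: "S \<subseteq> ?C" "lin_indpt S" and maxS: "\<And>B. S \<subseteq> B \<Longrightarrow> B \<subseteq> ?C \<Longrightarrow> lin_indpt B \<Longrightarrow> B = S"
    using S(2) unfolding maximal_def by blast+
  have Sc: "S \<subseteq> carrier_vec n" using SC Cc by blast
  have col_span: "c \<in> span S" if c: "c \<in> ?C" for c
  proof (cases "c \<in> S")
    case True
    then show ?thesis using in_own_span[of S] Sc by auto
  next
    case False
    then have "lin_dep (S \<union> {c})" using maxS[of "S \<union> {c}"] SC(1) c by blast
    then show ?thesis using lin_dep_iff_in_span[of S c] Sc SC(2) False c Cc by auto
  qed
  have comb: "vec n (\<lambda>i. \<Sum>j<k. c j * X $$ (i, j)) \<in> span S" if "k \<le> n" for k c
    using that
  proof (induction k)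
    case 0
    have "vec n (\<lambda>i. \<Sum>j<0. c j * X $$ (i, j)) = 0\<^sub>v n" by (intro eq_vecI) auto
    moreover have "0\<^sub>v n \<in> span S" by (rule in_spanI[of _ "\<lambda>_. 0" "{}"]) (auto simp: lincomb_def)
    ultimately show ?case by simp
  next
    case (Suc k)
    have "col X k \<in> ?C" using Suc.prems Xc by (auto simp: cols_def)
    then have "c k \<cdot>\<^sub>v col X k \<in> span S" using col_span Sc by (intro smult_in_span) auto
    moreover have "vec n (\<lambda>i. \<Sum>j<k. c j * X $$ (i, j)) \<in> span S" using Suc by simp
    ultimately have "vec n (\<lambda>i. \<Sum>j<k. c j * X $$ (i, j)) + c k \<cdot>\<^sub>v col X k \<in> span S"
      using span_add1[OF Sc] by auto
    moreover have "vec n (\<lambda>i. \<Sum>j<k. c j * X $$ (i, j)) + c k \<cdot>\<^sub>v col X k = vec n (\<lambda>i. \<Sum>j<Suc k. c j * X $$ (i, j))"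
      using Suc.prems Xc by (intro eq_vecI) auto
    ultimately show ?case by simp
  qed
  let ?v = "\<lambda>l. vec n (u l)"
  have ipv: "ip n (vec_index (?v k)) (vec_index (?v l)) = (if k = l then 1 else 0)" if "k < n" "l < n" for k l
  proof -
    have "ip n (vec_index (?v k)) (vec_index (?v l)) = ip n (u k) (u l)" by (intro ip_cong) auto
    then show ?thesis using sp that by (simp add: spectral_def orthonormal_def)
  qed
  have inj: "inj_on ?v ?R"
  proof (rule inj_onI)
    fix k l assume "k \<in> ?R" "l \<in> ?R" and eq: "?v k = ?v l"
    then have "k < n" "l < n" by auto
    then have "(if k = l then 1 else 0) = (1::complex)" using ipv[of k l] ipv[of l l] unfolding eq by simp
    then show "k = l" by (simp split: if_splits)
  qed
  have vspan: "?v l \<in> span S" if "l \<in> ?R" for l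
  proof -
    have "?v l = vec n (\<lambda>i. \<Sum>j<n. (u l j / of_real (e l)) * X $$ (i, j))"
    proof (intro eq_vecI)
      fix i assume "i < dim_vec (vec n (\<lambda>i. \<Sum>j<n. (u l j / of_real (e l)) * X $$ (i, j)))"
      then have i: "i < n" by simp
      have "(\<Sum>j<n. (u l j / of_real (e l)) * X $$ (i, j)) = mv n (entries X) (u l) i / of_real (e l)"
        by (simp add: mv_def sum_divide_distrib mult.commute)
      also have "\<dots> = u l i" using sp that i by (simp add: spectral_def)
      finally show "?v l $ i = vec n (\<lambda>i. \<Sum>j<n. (u l j / of_real (e l)) * X $$ (i, j)) $ i" using i by simp
    qed auto
    then show ?thesis using comb[of n "\<lambda>j. u l j / of_real (e l)"] by (simp del: times_divide_eq_left)
  qed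
  have indpt: "lin_indpt (?v ` ?R)"
  proof (rule finite_lin_indpt2)
    show "finite (?v ` ?R)" by simp
    show "?v ` ?R \<subseteq> carrier_vec n" by auto
    fix a assume "lincomb a (?v ` ?R) = 0\<^sub>v n"
    then have 0: "(\<Sum>x\<in>?v ` ?R. a x * x $ i) = 0" if "i < n" for i
      using that lincomb_index[of i "?v ` ?R" a] by fastforce
    show "\<forall>v\<in>?v ` ?R. a v = 0"
    proof
      fix v assume "v \<in> ?v ` ?R"
      then obtain l where l: "l \<in> ?R" "v = ?v l" by auto
      have "0 = ip n (vec_index v) (\<lambda>i. \<Sum>x\<in>?v ` ?R. a x * x $ i)" unfolding ip_def using 0 by simp
      also have "\<dots> = (\<Sum>x\<in>?v ` ?R. a x * ip n (vec_index v) (vec_index x))"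
        by (simp add: ip_sum_right ip_scale_right)
      also have "\<dots> = (\<Sum>k\<in>?R. a (?v k) * ip n (vec_index (?v l)) (vec_index (?v k)))"
        unfolding sum.reindex[OF inj] l(2) by simp
      also have "\<dots> = (\<Sum>k\<in>?R. if k = l then a (?v k) else 0)"
        using l(1) by (intro sum.cong refl) (auto simp: ipv simp del: index_vec)
      also have "\<dots> = a v" using l by simp
      finally show "a v = 0" by simp
    qed
  qed
  have "\<exists>C. finite C \<and> int (card C) \<le> int (card S) - int (card (?v ` ?R))"
  proof -
    have sub: "?v ` ?R \<subseteq> span S" using vspan by blast
    have "finite (?v ` ?R)" by simp
    from replacement[OF this S(1) _ indpt sub] Sc show ?thesis by auto
  qed
  then have "card (?v ` ?R) \<le> card S" by auto
  then show ?thesis unfolding rank card_image[OF inj] .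
qed

section \<open>Squared Frobenius norm and trace pairing in an orthonormal basis\<close>

definition fro :: "nat \<Rightarrow> cmat \<Rightarrow> real" where
  "fro n M = (\<Sum>i<n. \<Sum>j<n. (cmod (M i j))\<^sup>2)"

definition trace_prod :: "nat \<Rightarrow> cmat \<Rightarrow> cmat \<Rightarrow> complex" where
  "trace_prod n M H = (\<Sum>i<n. \<Sum>j<n. M i j * H j i)"

lemma fro_nonneg: "0 \<le> fro n M"
  unfolding fro_def by (intro sum_nonneg) auto

text \<open>Parseval twice: on the images of the basis vectors, and on the conjugated rows of
  \<open>M\<close>.\<close>

lemma fro_basis:
  assumes on: "orthonormal n n u"
  shows "fro n M = (\<Sum>k<n. \<Sum>l<n. ip_sq n (u l) (mv n M (u k)))"
proof -
  have "(\<Sum>k<n. \<Sum>l<n. ip_sq n (u l) (mv n M (u k))) = (\<Sum>k<n. sqn n (mv n M (u k)))"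
    by (simp add: parseval_sqn[OF on, symmetric])
  also have "\<dots> = (\<Sum>i<n. \<Sum>k<n. (cmod (mv n M (u k) i))\<^sup>2)" unfolding sqn_def by (rule sum.swap)
  also have "\<dots> = (\<Sum>i<n. sqn n (\<lambda>j. cnj (M i j)))"
  proof (intro sum.cong refl)
    fix i
    have "mv n M (u k) i = cnj (ip n (u k) (\<lambda>j. cnj (M i j)))" for k
      by (simp add: mv_def ip_def mult.commute)
    then show "(\<Sum>k<n. (cmod (mv n M (u k) i))\<^sup>2) = sqn n (\<lambda>j. cnj (M i j))"
      by (simp add: parseval_sqn[OF on, of "\<lambda>j. cnj (M i j)"])
  qed
  finally show ?thesis by (simp add: fro_def sqn_def)
qed

lemma fro_spectral:
  assumes sp: "spectral n M e u"
  shows "fro n M = (\<Sum>l<n. (e l)\<^sup>2)"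
proof -
  have on: "orthonormal n n u" using sp by (simp add: spectral_def)
  have "ip n (u l) (mv n M (u k)) = (if k = l then of_real (e k) else 0)" if "k < n" "l < n" for k l
    using on that spectral_ip_right[OF sp that(1)] by (auto simp: orthonormal_def)
  then have "fro n M = (\<Sum>k<n. \<Sum>l<n. if k = l then (e k)\<^sup>2 else 0)"
    unfolding fro_basis[OF on] by (intro sum.cong refl) auto
  then show ?thesis by simp
qed

lemma trace_basis:
  assumes on: "orthonormal n n u"
  shows "(\<Sum>k<n. ip n (u k) (mv n M (u k))) = (\<Sum>i<n. M i i)"
proof -
  have "(\<Sum>k<n. ip n (u k) (mv n M (u k))) = (\<Sum>k<n. \<Sum>a<n. \<Sum>b<n. M a b * (u k b * cnj (u k a)))"
    by (simp add: ip_def mv_def sum_distrib_left mult_ac)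
  also have "\<dots> = (\<Sum>a<n. \<Sum>k<n. \<Sum>b<n. M a b * (u k b * cnj (u k a)))" by (rule sum.swap)
  also have "\<dots> = (\<Sum>a<n. \<Sum>b<n. \<Sum>k<n. M a b * (u k b * cnj (u k a)))" by (intro sum.cong refl sum.swap)
  also have "\<dots> = (\<Sum>a<n. \<Sum>b<n. if b = a then M a b else 0)"
    unfolding sum_distrib_left[symmetric] using orthonormal_columns[OF on] by (intro sum.cong refl) auto
  finally show ?thesis by simp
qed

lemma trace_prod_basis:
  assumes on: "orthonormal n n u" and D: "hermitian n D"
  shows "trace_prod n D H = (\<Sum>k<n. \<Sum>l<n. ip n (u k) (mv n D (u l)) * ip n (u l) (mv n H (u k)))"
proof -
  let ?T = "\<lambda>i k. \<Sum>j<n. D i j * H j k"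
  have "mv n ?T x i = mv n D (mv n H x) i" for x i
    unfolding mv_def sum_distrib_left sum_distrib_right by (subst sum.swap) (simp add: mult.assoc)
  then have T: "mv n ?T x = mv n D (mv n H x)" for x by blast
  have "trace_prod n D H = (\<Sum>k<n. ip n (u k) (mv n D (mv n H (u k))))"
    using trace_basis[OF on, of ?T] by (simp add: trace_prod_def T)
  also have "\<dots> = (\<Sum>k<n. \<Sum>l<n. ip n (mv n D (u k)) (u l) * ip n (u l) (mv n H (u k)))"
    unfolding ip_hermitian[OF D] by (intro sum.cong refl parseval[OF on])
  finally show ?thesis unfolding ip_hermitian[OF D] .
qed

lemma trace_prod_rank1_sum:
  "trace_prod n D (rank1_sum f K A z) = (\<Sum>k\<in>A. of_real (snd (z k) * K) * qf n D (f (fst (z k))))"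
proof -
  have "trace_prod n D (rank1_sum f K A z) =
    (\<Sum>i<n. \<Sum>j<n. \<Sum>k\<in>A. of_real (snd (z k) * K) * (cnj (f (fst (z k)) i) * (D i j * f (fst (z k)) j)))"
    by (simp add: trace_prod_def rank1_sum_def sum_distrib_left mult_ac)
  also have "\<dots> = (\<Sum>i<n. \<Sum>k\<in>A. \<Sum>j<n. of_real (snd (z k) * K) * (cnj (f (fst (z k)) i) * (D i j * f (fst (z k)) j)))"
    by (intro sum.cong refl sum.swap)
  also have "\<dots> = (\<Sum>k\<in>A. \<Sum>i<n. \<Sum>j<n. of_real (snd (z k) * K) * (cnj (f (fst (z k)) i) * (D i j * f (fst (z k)) j)))"
    by (rule sum.swap)
  finally show ?thesis by (simp add: qf_def ip_def mv_def sum_distrib_left)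
qed

lemma qf_le_opn:
  assumes h: "hermitian n H"
  shows "\<bar>Re (qf n H x)\<bar> \<le> opn n H * sqn n x" "qf n H x = of_real (Re (qf n H x))"
    "sqn n (mv n H x) \<le> (opn n H)\<^sup>2 * sqn n x"
proof -
  let ?e = "eigval n H" and ?u = "eigvec n H"
  note sp = spectral_eigval[OF h] and on = orthonormal_eigvec[OF h]
  have q: "qf n H x = of_real (\<Sum>l<n. ?e l * ip_sq n (?u l) x)" by (rule qf_spectral[OF sp h])
  then show "qf n H x = of_real (Re (qf n H x))" by simp
  have "\<bar>\<Sum>l<n. ?e l * ip_sq n (?u l) x\<bar> \<le> (\<Sum>l<n. opn n H * ip_sq n (?u l) x)"
    by (intro order.trans[OF sum_abs] sum_mono) (auto simp: abs_mult intro!: mult_right_mono abs_eigval_le_opn)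
  then show "\<bar>Re (qf n H x)\<bar> \<le> opn n H * sqn n x"
    unfolding q parseval_sqn[OF on, of x] by (simp add: sum_distrib_left)
  have "sqn n (mv n H x) = (\<Sum>l<n. (?e l)\<^sup>2 * ip_sq n (?u l) x)"
    unfolding parseval_sqn[OF on, of "mv n H x"] by (intro sum.cong refl) (simp add: spectral_ip_left[OF sp _ h] norm_mult power_mult_distrib)
  also have "\<dots> \<le> (\<Sum>l<n. (opn n H)\<^sup>2 * ip_sq n (?u l) x)"
    using abs_eigval_le_opn[of _ n H] by (intro sum_mono mult_right_mono) (auto intro: power2_le_iff_abs_le[THEN iffD2] abs_ge_zero order_trans simp: power2_le_iff_abs_le)
  finally show "sqn n (mv n H x) \<le> (opn n H)\<^sup>2 * sqn n x"
    unfolding parseval_sqn[OF on, of x] by (simp add: sum_distrib_left)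
qed

section \<open>Trace bounds on descent directions\<close>

lemma sum_le_L2:
  fixes a b :: "'i \<Rightarrow> real"
  shows "(\<Sum>i\<in>I. \<bar>a i * b i\<bar>) \<le> sqrt (\<Sum>i\<in>I. (a i)\<^sup>2) * sqrt (\<Sum>i\<in>I. (b i)\<^sup>2)"
  using L2_set_mult_ineq[of a b I] by (simp add: L2_set_def abs_mult)

text \<open>Duality with the certificate \<open>h sgn M + P H P\<close>, \<open>P\<close> the projection onto the kernel of \<open>M\<close>, bounds the
  part of \<open>tr (D H)\<close> on the kernel; the remaining part has rank at most \<open>2 r\<close>.\<close>

lemma descent_trace_bound:
  assumes spM: "spectral n M e u" and hM: "hermitian n M" and spB: "spectral n B f v" and hB: "hermitian n B"
    and le: "(\<Sum>l<n. \<bar>f l\<bar>) \<le> (\<Sum>l<n. \<bar>e l\<bar>)" and r: "card {l. l < n \<and> e l \<noteq> 0} \<le> r"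
    and hH: "hermitian n H" and h: "0 \<le> h" and q: "\<And>x. \<bar>Re (qf n H x)\<bar> \<le> h * sqn n x"
    and s: "\<And>x. sqn n (mv n H x) \<le> h\<^sup>2 * sqn n x"
  defines "D \<equiv> \<lambda>i j. B i j - M i j"
  shows "Re (trace_prod n D H) \<le> 3 * sqrt r * sqrt (fro n D) * h"
proof -
  have on: "orthonormal n n u" using spM by (simp add: spectral_def)
  have onv: "orthonormal n n v" using spB by (simp add: spectral_def)
  have hD: "hermitian n D"
    unfolding hermitian_def D_def
  proof (intro allI impI)
    fix i j assume "i < n" "j < n"
    then have "B j i = cnj (B i j)" "M j i = cnj (M i j)" using hM hB unfolding hermitian_def by blast+
    then show "B j i - M j i = cnj (B i j - M i j)" by simp
  qed
  \<comment> \<open>The eigenvectors indexed by \<open>R\<close>, at most r of them, span the range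
    of \<open>M\<close>; those indexed by \<open>N\<close> span its kernel.\<close>
  define R where "R = {l. l < n \<and> e l \<noteq> 0}"
  define N where "N = {..<n} - R"
  have fin: "finite R" "finite N" by (auto simp: R_def N_def)
  have RN: "R \<union> N = {..<n}" "R \<inter> N = {}" "R \<subseteq> {..<n}" "N \<subseteq> {..<n}" by (auto simp: R_def N_def)
  have sumRN: "(\<Sum>l<n. g l) = (\<Sum>l\<in>R. g l) + (\<Sum>l\<in>N. g l)" for g :: "nat \<Rightarrow> 'x::comm_monoid_add"
    unfolding RN(1)[symmetric] using fin RN(2) by (rule sum.union_disjoint)
  let ?c = "\<lambda>l x. ip n (u l) x"
  let ?h = "\<lambda>k l. ip n (u k) (mv n H (u l))" and ?d = "\<lambda>k l. ip n (u k) (mv n D (u l))"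
  define P where "P = (\<lambda>x i. \<Sum>l\<in>N. ?c l x * u l i)"
  \<comment> \<open>The quadratic form of the certificate. Only this form is used; the matrix itself
    is never built.\<close>
  define G where "G = (\<lambda>x. h * (\<Sum>l\<in>R. sgn (e l) * (cmod (?c l x))\<^sup>2) + Re (qf n H (P x)))"
  have cP: "?c k (P x) = (if k \<in> N then ?c k x else 0)" if "k < n" for k x
  proof -
    have "?c k (P x) = (\<Sum>l\<in>N. ?c l x * ip n (u k) (u l))"
      by (simp add: P_def ip_sum_right ip_scale_right)
    also have "\<dots> = (\<Sum>l\<in>N. if l = k then ?c l x else 0)"
      using on that RN(4) by (intro sum.cong refl) (auto simp: orthonormal_def)
    finally show ?thesis using fin by simp
  qed
  have sP: "sqn n (P x) = (\<Sum>l\<in>N. (cmod (?c l x))\<^sup>2)" for x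
  proof -
    have "sqn n (P x) = (\<Sum>l<n. if l \<in> N then (cmod (?c l x))\<^sup>2 else 0)"
      unfolding parseval_sqn[OF on, of "P x"] by (intro sum.cong refl) (simp add: cP)
    also have "\<dots> = (\<Sum>l\<in>{..<n} \<inter> N. (cmod (?c l x))\<^sup>2)" by (simp add: sum.inter_restrict)
    also have "{..<n} \<inter> N = N" using RN(4) by blast
    finally show ?thesis .
  qed
  have Gb: "\<bar>G x\<bar> \<le> h * sqn n x" for x
  proof -
    have "\<bar>\<Sum>l\<in>R. sgn (e l) * (cmod (?c l x))\<^sup>2\<bar> \<le> (\<Sum>l\<in>R. (cmod (?c l x))\<^sup>2)"
      by (intro order.trans[OF sum_abs] sum_mono) (auto simp: abs_mult sgn_if)
    then have "\<bar>h * (\<Sum>l\<in>R. sgn (e l) * (cmod (?c l x))\<^sup>2)\<bar> \<le> h * (\<Sum>l\<in>R. (cmod (?c l x))\<^sup>2)"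
      using h by (simp add: abs_mult mult_left_mono)
    moreover have "\<bar>Re (qf n H (P x))\<bar> \<le> h * (\<Sum>l\<in>N. (cmod (?c l x))\<^sup>2)" using q[of "P x"] by (simp add: sP)
    ultimately have "\<bar>G x\<bar> \<le> h * (\<Sum>l\<in>R. (cmod (?c l x))\<^sup>2) + h * (\<Sum>l\<in>N. (cmod (?c l x))\<^sup>2)"
      unfolding G_def by linarith
    then show ?thesis unfolding parseval_sqn[OF on, of x] sumRN by (simp add: distrib_left)
  qed
  have qP: "qf n H (P x) = (\<Sum>k\<in>N. \<Sum>l\<in>N. ?h k l * (cnj (?c k x) * ?c l x))" for x
    unfolding qf_def P_def mv_sum mv_scale ip_sum_left ip_sum_right ip_scale_left ip_scale_right sum_distrib_left
    by (simp add: mult_ac)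
  have Bf: "ip n (u l) (mv n B (u k)) = (\<Sum>j<n. of_real (f j) * (?c l (v j) * cnj (?c k (v j))))" for k l
    unfolding spectral_ip[OF spB hB] by (simp add: cnj_ip mult_ac)
  have BD: "ip n (u l) (mv n B (u k)) = (if l = k then of_real (e k) else 0) + ?d l k" if "k < n" "l < n" for k l
  proof -
    have "mv n B x i = mv n M x i + mv n D x i" for x i
      by (simp add: mv_def D_def sum_subtractf algebra_simps)
    then have "mv n B (u k) = (\<lambda>i. mv n M (u k) i + mv n D (u k) i)" by blast
    then have "ip n (u l) (mv n B (u k)) = ip n (u l) (mv n M (u k)) + ?d l k" by (simp add: ip_add_right)
    then show ?thesis using on that spectral_ip_right[OF spM that(1)] by (auto simp: orthonormal_def)
  qed
  \<comment> \<open>The trace of \<open>B\<close> times the certificate, computed in the eigenbasis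
    of \<open>B\<close> on the left and, through B = M + D, in that of \<open>M\<close> on the
    right.\<close>
  have S: "of_real (\<Sum>j<n. f j * G (v j)) =
      of_real (h * (\<Sum>l\<in>R. \<bar>e l\<bar>)) + of_real h * (\<Sum>l\<in>R. of_real (sgn (e l)) * ?d l l)
      + (\<Sum>k\<in>N. \<Sum>l\<in>N. ?h k l * ?d l k)"
  proof -
    have reP: "of_real (Re (qf n H x)) = qf n H x" for x using qf_le_opn(2)[OF hH] by simp
    have "of_real (\<Sum>j<n. f j * G (v j)) =
        of_real h * (\<Sum>j<n. \<Sum>l\<in>R. of_real (sgn (e l)) * (of_real (f j) * (?c l (v j) * cnj (?c l (v j)))))
        + (\<Sum>j<n. of_real (f j) * qf n H (P (v j)))"
      unfolding G_def of_real_sum of_real_mult of_real_add reP distrib_left sum.distrib sum_distrib_left mult_cnj_eq of_real_power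
      by (simp add: mult_ac)
    also have "(\<Sum>j<n. \<Sum>l\<in>R. of_real (sgn (e l)) * (of_real (f j) * (?c l (v j) * cnj (?c l (v j))))) =
        (\<Sum>l\<in>R. of_real (sgn (e l)) * ip n (u l) (mv n B (u l)))"
      unfolding Bf sum_distrib_left by (rule sum.swap)
    also have "\<dots> = (\<Sum>l\<in>R. of_real \<bar>e l\<bar> + of_real (sgn (e l)) * ?d l l)"
    proof (intro sum.cong refl)
      fix l assume "l \<in> R"
      then have l: "l < n" using RN by auto
      have "complex_of_real (sgn (e l)) * of_real (e l) = of_real \<bar>e l\<bar>"
        unfolding of_real_mult[symmetric] by (simp add: sgn_if abs_if)
      then show "of_real (sgn (e l)) * ip n (u l) (mv n B (u l)) = of_real \<bar>e l\<bar> + of_real (sgn (e l)) * ?d l l"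
        unfolding BD[OF l l] by (simp add: distrib_left)
    qed
    also have "(\<Sum>j<n. of_real (f j) * qf n H (P (v j))) =
        (\<Sum>j<n. \<Sum>k\<in>N. \<Sum>l\<in>N. ?h k l * (of_real (f j) * (?c l (v j) * cnj (?c k (v j)))))"
      unfolding qP sum_distrib_left by (simp add: mult_ac)
    also have "\<dots> = (\<Sum>k\<in>N. \<Sum>j<n. \<Sum>l\<in>N. ?h k l * (of_real (f j) * (?c l (v j) * cnj (?c k (v j)))))"
      by (rule sum.swap)
    also have "\<dots> = (\<Sum>k\<in>N. \<Sum>l\<in>N. ?h k l * ip n (u l) (mv n B (u k)))"
      unfolding Bf sum_distrib_left by (intro sum.cong refl sum.swap)
    also have "\<dots> = (\<Sum>k\<in>N. \<Sum>l\<in>N. ?h k l * ?d l k)"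
    proof (intro sum.cong refl)
      fix k l assume "k \<in> N" "l \<in> N"
      then show "?h k l * ip n (u l) (mv n B (u k)) = ?h k l * ?d l k"
        using BD[of k l] by (auto simp: N_def R_def)
    qed
    finally show ?thesis by (simp add: sum.distrib distrib_left)
  qed
  let ?F = "sqrt (fro n D)"
  have dle: "(\<Sum>x\<in>T. (cmod (?d (fst x) (snd x)))\<^sup>2) \<le> fro n D" if T: "T \<subseteq> {..<n} \<times> {..<n}" for T
  proof -
    have "(\<Sum>x\<in>T. (cmod (?d (fst x) (snd x)))\<^sup>2) \<le> (\<Sum>x\<in>{..<n} \<times> {..<n}. (cmod (?d (fst x) (snd x)))\<^sup>2)"
      using T by (intro sum_mono2) auto
    also have "\<dots> = fro n D"
      unfolding fro_basis[OF on] by (subst sum.swap) (simp add: sum.cartesian_product case_prod_beta)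
    finally show ?thesis .
  qed
  have cR: "real (card R) \<le> real r" using r by (simp add: R_def)
  have NN: "Re (\<Sum>k\<in>N. \<Sum>l\<in>N. ?h k l * ?d l k) \<le> h * (sqrt r * ?F)"
  proof -
    \<comment> \<open>The certificate's form is at most h on unit vectors, so the trace is at most h
      times the nuclear norm of \<open>B\<close>, hence of \<open>M\<close>. The latter cancels
      against the first term of \<open>S\<close>, which leaves the kernel block bounded by the
      diagonal of \<open>D\<close> on \<open>R\<close>.\<close>
    have "(\<Sum>j<n. f j * G (v j)) \<le> (\<Sum>j<n. \<bar>f j\<bar> * h)"
    proof (intro sum_mono)
      fix j assume "j \<in> {..<n}"
      then have "sqn n (v j) = 1" using onv by (simp add: orthonormal_def sqn_alt)
      then have "\<bar>G (v j)\<bar> \<le> h" using Gb[of "v j"] by simp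
      then have "\<bar>f j * G (v j)\<bar> \<le> \<bar>f j\<bar> * h" unfolding abs_mult by (intro mult_left_mono) auto
      then show "f j * G (v j) \<le> \<bar>f j\<bar> * h" by linarith
    qed
    also have "\<dots> = h * (\<Sum>j<n. \<bar>f j\<bar>)" by (simp add: sum_distrib_left mult.commute)
    also have "\<dots> \<le> h * (\<Sum>l<n. \<bar>e l\<bar>)" using le h by (rule mult_left_mono)
    also have "(\<Sum>l<n. \<bar>e l\<bar>) = (\<Sum>l\<in>R. \<bar>e l\<bar>)"
    proof -
      have "(\<Sum>l\<in>N. \<bar>e l\<bar>) = 0" by (intro sum.neutral) (auto simp: N_def R_def)
      then show ?thesis by (simp add: sumRN)
    qed
    finally have "Re (of_real (\<Sum>j<n. f j * G (v j))) \<le> h * (\<Sum>l\<in>R. \<bar>e l\<bar>)" by simp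
    then have "Re (\<Sum>k\<in>N. \<Sum>l\<in>N. ?h k l * ?d l k) \<le> - (h * (\<Sum>l\<in>R. sgn (e l) * Re (?d l l)))"
      unfolding S by simp
    also have "\<dots> \<le> h * (\<Sum>l\<in>R. \<bar>1 * cmod (?d l l)\<bar>)"
    proof -
      have "- (\<Sum>l\<in>R. sgn (e l) * Re (?d l l)) = (\<Sum>l\<in>R. - (sgn (e l) * Re (?d l l)))" by (simp add: sum_negf)
      also have "\<dots> \<le> (\<Sum>l\<in>R. \<bar>1 * cmod (?d l l)\<bar>)"
      proof (intro sum_mono)
        fix l
        show "- (sgn (e l) * Re (?d l l)) \<le> \<bar>1 * cmod (?d l l)\<bar>"
          using abs_Re_le_cmod[of "?d l l"] by (auto simp: sgn_if)
      qed
      finally have "h * - (\<Sum>l\<in>R. sgn (e l) * Re (?d l l)) \<le> h * (\<Sum>l\<in>R. \<bar>1 * cmod (?d l l)\<bar>)"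
        using h by (rule mult_left_mono)
      then show ?thesis by simp
    qed
    also have "\<dots> \<le> h * (sqrt (\<Sum>l\<in>R. 1\<^sup>2) * sqrt (\<Sum>l\<in>R. (cmod (?d l l))\<^sup>2))"
      by (intro mult_left_mono sum_le_L2 h)
    also have "\<dots> \<le> h * (sqrt r * ?F)"
    proof (intro mult_left_mono mult_mono h real_sqrt_le_mono)
      show "(\<Sum>l\<in>R. 1\<^sup>2) \<le> real r" using cR by simp
      have "(\<Sum>l\<in>R. (cmod (?d l l))\<^sup>2) = (\<Sum>x\<in>(\<lambda>l. (l, l)) ` R. (cmod (?d (fst x) (snd x)))\<^sup>2)"
        by (subst sum.reindex) (auto simp: inj_on_def)
      also have "\<dots> \<le> fro n D" using RN by (intro dle) auto
      finally show "(\<Sum>l\<in>R. (cmod (?d l l))\<^sup>2) \<le> fro n D" .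
    qed (auto intro!: sum_nonneg real_sqrt_ge_zero)
    finally show ?thesis .
  qed
  \<comment> \<open>Index pairs with at least one member in \<open>R\<close>: they select at most r
    rows and r columns of \<open>H\<close>, each of squared length at most
    \<open>h\<^sup>2\<close>.\<close>
  define T where "T = {..<n} \<times> {..<n} - N \<times> N"
  let ?g = "\<lambda>x. ?d (fst x) (snd x) * ?h (snd x) (fst x)"
  have tr: "trace_prod n D H = (\<Sum>k\<in>N. \<Sum>l\<in>N. ?h k l * ?d l k) + (\<Sum>x\<in>T. ?g x)"
  proof -
    have "trace_prod n D H = (\<Sum>x\<in>{..<n} \<times> {..<n}. ?g x)"
      unfolding trace_prod_basis[OF on hD] by (simp add: sum.cartesian_product case_prod_beta)
    also have "\<dots> = (\<Sum>x\<in>T. ?g x) + (\<Sum>x\<in>N \<times> N. ?g x)"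
      unfolding T_def using RN(4) by (intro sum.subset_diff) auto
    also have "(\<Sum>x\<in>N \<times> N. ?g x) = (\<Sum>k\<in>N. \<Sum>l\<in>N. ?h k l * ?d l k)"
      by (subst sum.swap) (simp add: sum.cartesian_product case_prod_beta mult.commute)
    finally show ?thesis by simp
  qed
  have hk: "(\<Sum>l<n. (cmod (?h l k))\<^sup>2) \<le> h\<^sup>2" if "k < n" for k
  proof -
    have "(\<Sum>l<n. (cmod (?h l k))\<^sup>2) = sqn n (mv n H (u k))" by (rule parseval_sqn[OF on, symmetric])
    also have "\<dots> \<le> h\<^sup>2 * sqn n (u k)" by (rule s)
    finally show ?thesis using on that by (simp add: orthonormal_def sqn_alt)
  qed
  have hsym: "cmod (?h l k) = cmod (?h k l)" for k l
    using cnj_ip[of n "u l" "mv n H (u k)"] ip_hermitian[OF hH, of "u k" "u l"] by (metis complex_mod_cnj)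
  have hT: "(\<Sum>x\<in>T. (cmod (?h (snd x) (fst x)))\<^sup>2) \<le> 2 * (r * h\<^sup>2)"
  proof -
    have "(\<Sum>x\<in>T. (cmod (?h (snd x) (fst x)))\<^sup>2) \<le> (\<Sum>x\<in>R \<times> {..<n} \<union> {..<n} \<times> R. (cmod (?h (snd x) (fst x)))\<^sup>2)"
      unfolding T_def using fin RN by (intro sum_mono2) auto
    also have "\<dots> \<le> (\<Sum>x\<in>R \<times> {..<n}. (cmod (?h (snd x) (fst x)))\<^sup>2) + (\<Sum>x\<in>{..<n} \<times> R. (cmod (?h (snd x) (fst x)))\<^sup>2)"
      using fin by (subst sum.union_inter[symmetric]) (auto intro!: sum_nonneg)
    also have "(\<Sum>x\<in>R \<times> {..<n}. (cmod (?h (snd x) (fst x)))\<^sup>2) = (\<Sum>k\<in>R. \<Sum>l<n. (cmod (?h l k))\<^sup>2)"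
      by (simp add: sum.cartesian_product case_prod_beta)
    also have "(\<Sum>x\<in>{..<n} \<times> R. (cmod (?h (snd x) (fst x)))\<^sup>2) = (\<Sum>l<n. \<Sum>k\<in>R. (cmod (?h l k))\<^sup>2)"
      unfolding hsym[of "snd _" "fst _"] by (simp add: sum.cartesian_product case_prod_beta)
    also have "\<dots> = (\<Sum>k\<in>R. \<Sum>l<n. (cmod (?h l k))\<^sup>2)" by (rule sum.swap)
    also have "(\<Sum>k\<in>R. \<Sum>l<n. (cmod (?h l k))\<^sup>2) \<le> (\<Sum>k\<in>R. h\<^sup>2)" using hk RN by (intro sum_mono) auto
    also have "\<dots> = real (card R) * h\<^sup>2" by simp
    also have "\<dots> \<le> real r * h\<^sup>2" using cR by (intro mult_right_mono) auto
    finally show ?thesis by simp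
  qed
  have "Re (\<Sum>x\<in>T. ?g x) \<le> (\<Sum>x\<in>T. \<bar>cmod (?d (fst x) (snd x)) * cmod (?h (snd x) (fst x))\<bar>)"
    unfolding Re_sum by (intro sum_mono) (metis abs_Re_le_cmod abs_le_D1 abs_norm_cancel norm_mult)
  also have "\<dots> \<le> sqrt (\<Sum>x\<in>T. (cmod (?d (fst x) (snd x)))\<^sup>2) * sqrt (\<Sum>x\<in>T. (cmod (?h (snd x) (fst x)))\<^sup>2)"
    by (rule sum_le_L2)
  also have "\<dots> \<le> ?F * sqrt (2 * (r * h\<^sup>2))"
    using dle[of T] hT by (intro mult_mono real_sqrt_le_mono) (auto simp: T_def intro!: sum_nonneg real_sqrt_ge_zero fro_nonneg)
  \<comment> \<open>Here sqrt 2 is rounded up to 2; with the share 1 of the kernel block this makes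
    the 3 of the statement.\<close>
  also have "\<dots> \<le> ?F * (2 * (sqrt r * h))"
  proof (intro mult_left_mono real_le_lsqrt)
    show "2 * (real r * h\<^sup>2) \<le> (2 * (sqrt (real r) * h))\<^sup>2" by (simp add: power_mult_distrib)
  qed (use h in \<open>auto intro: fro_nonneg\<close>)
  finally have "Re (\<Sum>x\<in>T. ?g x) \<le> 2 * (h * (sqrt r * ?F))" by (simp add: mult_ac)
  then have "Re (trace_prod n D H) \<le> 3 * (h * (sqrt r * ?F))" unfolding tr using NN by simp
  then show ?thesis by (simp add: mult_ac)
qed

text \<open>The absolute value comes from applying the bound to H and to its negative. That bound
  takes a free parameter \<open>h\<close>, so \<open>opn n H\<close> serves both signs and the
  eigenvalues chosen for H and its negative need no comparison.\<close>

theorem descent_cone: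
  assumes X: "X \<in> hermitian_mats n" and Z: "Z \<in> hermitian_mats n" and le: "nuclear_norm Z \<le> nuclear_norm X"
    and r: "vec_space.rank n X \<le> r" and hH: "hermitian n H" and n: "n \<ge> 1"
  defines "D \<equiv> \<lambda>i j. Z $$ (i, j) - X $$ (i, j)"
  shows "\<bar>Re (trace_prod n D H)\<bar> \<le> 3 * sqrt r * sqrt (fro n D) * opn n H"
proof -
  note hX = hermitian_matsD(2)[OF X] and hZ = hermitian_matsD(2)[OF Z]
  note spX = spectral_eigval[OF hX] and spZ = spectral_eigval[OF hZ]
  have nuc: "(\<Sum>l<n. \<bar>eigval n (entries Z) l\<bar>) \<le> (\<Sum>l<n. \<bar>eigval n (entries X) l\<bar>)"
    using le nuclear_norm_spectral[OF X spX] nuclear_norm_spectral[OF Z spZ] by simp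
  have card: "card {l. l < n \<and> eigval n (entries X) l \<noteq> 0} \<le> r"
    using rank_ge_nonzero_eigenvalues[OF X spX] r by simp
  note bound = descent_trace_bound[OF spX hX spZ hZ nuc card _ opn_nonneg[OF n], folded D_def]
  let ?H = "\<lambda>i j. - H i j"
  have hm: "hermitian n ?H"
    unfolding hermitian_def
  proof (intro allI impI)
    fix i j assume "i < n" "j < n"
    then have "H j i = cnj (H i j)" using hH unfolding hermitian_def by blast
    then show "- H j i = cnj (- H i j)" by simp
  qed
  have mvm: "mv n ?H x = (\<lambda>i. - mv n H x i)" for x by (simp add: mv_def sum_negf)
  have qm: "qf n ?H x = - qf n H x" for x unfolding qf_def mvm by (simp add: ip_def sum_negf)
  have sm: "sqn n (mv n ?H x) = sqn n (mv n H x)" for x unfolding mvm by (simp add: sqn_def)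
  have tm: "trace_prod n D ?H = - trace_prod n D H" by (simp add: trace_prod_def sum_negf)
  have "Re (trace_prod n D H) \<le> 3 * sqrt r * sqrt (fro n D) * opn n H"
    by (rule bound[OF hH qf_le_opn(1,3)[OF hH]])
  moreover have "Re (trace_prod n D ?H) \<le> 3 * sqrt r * sqrt (fro n D) * opn n H"
    by (rule bound[OF hm]) (use qf_le_opn(1,3)[OF hH] in \<open>simp_all add: qm sm\<close>)
  ultimately show ?thesis unfolding tm by simp
qed

section \<open>Stable recovery\<close>

text \<open>Zero up to \<bar>t\<bar> = 1/4, one from \<bar>t\<bar> = 1/2 on, with slope 4 between: a
  Lipschitz substitute for the indicator of a large measurement.\<close>

definition ramp :: "real \<Rightarrow> real" where
  "ramp t = max 0 (min 1 (4 * \<bar>t\<bar> - 1))"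

lemma ramp_bounds: "0 \<le> ramp t" "ramp t \<le> 1" "ramp t \<le> 16 * t\<^sup>2"
proof -
  show "0 \<le> ramp t" "ramp t \<le> 1" by (auto simp: ramp_def)
  show "ramp t \<le> 16 * t\<^sup>2"
  proof (cases "\<bar>t\<bar> \<le> 1 / 4")
    case True
    then have "ramp t = 0" by (simp add: ramp_def)
    then show ?thesis by simp
  next
    case False
    then have "(1 / 4)\<^sup>2 \<le> \<bar>t\<bar>\<^sup>2" by (intro power_mono) auto
    then show ?thesis using \<open>ramp t \<le> 1\<close> by (simp add: power2_eq_square)
  qed
qed

lemma ramp_lipschitz: "\<bar>ramp x - ramp y\<bar> \<le> 4 * \<bar>x - y\<bar>"
  unfolding ramp_def by (auto simp: max_def min_def abs_if split: if_splits)

text \<open>A polynomial minorant of the ramp gives the Paley-Zygmund inequality by taking expectations.\<close>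

lemma ramp_ge_quartic:
  assumes M: "M \<ge> 1"
  shows "(t\<^sup>2 - M / 4) / (16 * M) - t ^ 4 / (1024 * M\<^sup>2) \<le> ramp t"
proof (cases "t\<^sup>2 < M / 4")
  case True
  then have "(t\<^sup>2 - M / 4) / (16 * M) \<le> 0" using M by (intro divide_nonpos_nonneg) auto
  moreover have "0 \<le> t ^ 4 / (1024 * M\<^sup>2)" by simp
  ultimately show ?thesis using ramp_bounds(1)[of t] by linarith
next
  case False
  then have "(1 / 2)\<^sup>2 \<le> \<bar>t\<bar>\<^sup>2" using M by (simp add: power2_eq_square)
  then have "1 / 2 \<le> \<bar>t\<bar>" by (rule power2_le_imp_le) simp
  then have 1: "ramp t = 1" by (simp add: ramp_def)
  \<comment> \<open>With a = \<open>t\<^sup>2 / (32 * M)\<close> the left side is 2 a - a^2 - 1/64,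
    a concave parabola with maximum below 1.\<close>
  have "(t\<^sup>2 - M / 4) / (16 * M) - t ^ 4 / (1024 * M\<^sup>2) = 1 - (1 - t\<^sup>2 / (32 * M))\<^sup>2 - 1 / 64"
    using M by (simp add: field_simps power2_eq_square power4_eq_xxxx)
  then show ?thesis unfolding 1 using zero_le_power2[of "1 - t\<^sup>2 / (32 * M)"] by linarith
qed

text \<open>Averaging the minorant leaves (3/4)/16 - 24/1024 = 3/128, from which \<open>M\<close>
  has cancelled.\<close>

lemma EE_ramp_ge:
  assumes fin: "finite (set_pmf p)" and M: "M \<ge> 1"
    and 2: "EE p (\<lambda>a. (Y a)\<^sup>2) = M" and 4: "EE p (\<lambda>a. Y a ^ 4) \<le> 24 * M\<^sup>2"
  shows "3 / 128 \<le> EE p (\<lambda>a. ramp (Y a))"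
proof -
  have "EE p (\<lambda>a. ((Y a)\<^sup>2 - M / 4) / (16 * M) - Y a ^ 4 / (1024 * M\<^sup>2)) =
      (EE p (\<lambda>a. (Y a)\<^sup>2) - M / 4) / (16 * M) - EE p (\<lambda>a. Y a ^ 4) / (1024 * M\<^sup>2)"
    using fin by (simp add: integrable_measure_pmf_finite)
  also have "\<dots> \<ge> (M - M / 4) / (16 * M) - (24 * M\<^sup>2) / (1024 * M\<^sup>2)"
    unfolding 2 using 4 by (intro diff_left_mono divide_right_mono) auto
  also have "(M - M / 4) / (16 * M) - (24 * M\<^sup>2) / (1024 * M\<^sup>2) = 3 / 128"
    using M by (simp add: field_simps)
  finally have "3 / 128 \<le> EE p (\<lambda>a. ((Y a)\<^sup>2 - M / 4) / (16 * M) - Y a ^ 4 / (1024 * M\<^sup>2))" .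
  also have "\<dots> \<le> EE p (\<lambda>a. ramp (Y a))" by (intro EE_mono fin ramp_ge_quartic M)
  finally show ?thesis .
qed

section \<open>Draws from the design and normalised descent directions\<close>

lemma draw_pmf_props:
  assumes des: "weighted_projective_design 4 n N p w"
  shows "EE (draw_pmf N p w) F = (\<Sum>i<N. p i * F (w i))" "set_pmf (draw_pmf N p w) \<subseteq> w ` {..<N}"
proof -
  have p: "\<forall>i<N. p i \<ge> 0" "(\<Sum>i<N. p i) = 1" using des by (auto simp: weighted_projective_design_def)
  let ?q = "embed_pmf (\<lambda>i. if i < N then p i else 0)"
  note pm = pmf_draw_index[OF p]
  have set: "set_pmf ?q \<subseteq> {..<N}" by (auto simp: set_pmf_iff pm split: if_splits)
  have "EE (draw_pmf N p w) F = EE ?q (\<lambda>i. F (w i))" by (simp add: draw_pmf_def)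
  also have "\<dots> = (\<Sum>i<N. pmf ?q i *\<^sub>R F (w i))" using set by (intro integral_measure_pmf) auto
  also have "\<dots> = (\<Sum>i<N. p i * F (w i))" by (intro sum.cong) (auto simp: pm)
  finally show "EE (draw_pmf N p w) F = (\<Sum>i<N. p i * F (w i))" .
  show "set_pmf (draw_pmf N p w) \<subseteq> w ` {..<N}" using set by (auto simp: draw_pmf_def)
qed

lemma measurement_map_index:
  assumes "Z \<in> carrier_mat n n" "a j \<in> carrier_vec n" "j < m"
  shows "measurement_map n m a Z $ j = sqrt (real n * (real n + 1)) * Re (qf n (entries Z) (vec_index (a j)))"
proof -
  have "trace_mat (Z * measurement_mat n (a j)) =
      (\<Sum>i<n. \<Sum>k<n. Z $$ (i, k) * (of_real (sqrt (real n * (real n + 1))) * (a j $ k * cnj (a j $ i))))"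
    unfolding trace_mat_def measurement_mat_def outer_self_def using assms
    by (auto simp: scalar_prod_def atLeast0LessThan intro!: sum.cong)
  also have "\<dots> = of_real (sqrt (real n * (real n + 1))) * qf n (entries Z) (vec_index (a j))"
    by (simp add: qf_def ip_def mv_def sum_distrib_left mult_ac)
  finally show ?thesis using assms(3) by (simp add: measurement_map_def)
qed

text \<open>The only property of normalised descent directions that the small ball method uses.\<close>

definition descent_dirs :: "nat \<Rightarrow> nat \<Rightarrow> cmat set" where
  "descent_dirs n r = {D. hermitian n D \<and> fro n D = 1 \<and>
     (\<forall>H. hermitian n H \<longrightarrow> \<bar>Re (trace_prod n D H)\<bar> \<le> 3 * sqrt r * opn n H)}"

text \<open>The suprema of the small ball argument are real-valued and carry information only over a
  nonempty set. The projection onto the first coordinate is a witness.\<close>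

lemma descent_dirs_nonempty:
  assumes n: "n \<ge> 1" and r: "r \<ge> 1"
  shows "descent_dirs n r \<noteq> {}"
proof -
  let ?D = "\<lambda>i j. unitvec 0 i * unitvec 0 j"
  have "?D \<in> descent_dirs n r"
    unfolding descent_dirs_def
  proof (intro CollectI conjI allI impI)
    show "hermitian n ?D" by (simp add: hermitian_def)
    have "fro n ?D = (\<Sum>i<n. \<Sum>j<n. if j = 0 then (if i = 0 then 1 else 0) else 0)"
      unfolding fro_def by (intro sum.cong refl) auto
    also have "\<dots> = 1" using n by simp
    finally show "fro n ?D = 1" .
    fix H assume H: "hermitian n H"
    have "trace_prod n ?D H = (\<Sum>i<n. \<Sum>j<n. cnj (unitvec 0 j) * (H j i * unitvec 0 i))"
      unfolding trace_prod_def by (intro sum.cong refl) auto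
    also have "\<dots> = qf n H (unitvec 0)"
      unfolding qf_def ip_def mv_def sum_distrib_left by (rule sum.swap)
    finally have "\<bar>Re (trace_prod n ?D H)\<bar> \<le> opn n H"
      using qf_le_opn(1)[OF H, of "unitvec 0"] n by (simp add: sqn_unitvec)
    also have "\<dots> \<le> 3 * sqrt r * opn n H"
    proof -
      have "1 \<le> sqrt r" using r by simp
      then have "1 \<le> 3 * sqrt r" by linarith
      then show ?thesis using opn_nonneg[OF n, of H] mult_right_mono[of 1 "3 * sqrt r" "opn n H"] by simp
    qed
    finally show "\<bar>Re (trace_prod n ?D H)\<bar> \<le> 3 * sqrt r * opn n H" .
  qed
  then show ?thesis by blast
qed

lemma opn_le_sqrt_fro:
  assumes h: "hermitian n D" and n: "n \<ge> 1"
  shows "opn n D \<le> sqrt (fro n D)"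
proof -
  have "(opn n D)\<^sup>2 \<le> fro n D"
    using opn_power_le_trace[OF n, of D 1] by (simp add: spec_trace_def fro_spectral[OF spectral_eigval[OF h]])
  then show ?thesis by (rule real_le_rsqrt)
qed

lemma SUP_diff_le:
  fixes g g' :: "'d \<Rightarrow> real"
  assumes S: "S \<noteq> {}" and b: "\<And>D. D \<in> S \<Longrightarrow> \<bar>g' D\<bar> \<le> C" and d: "\<And>D. D \<in> S \<Longrightarrow> g D - g' D \<le> c"
  shows "(SUP D\<in>S. g D) - (SUP D\<in>S. g' D) \<le> c"
proof -
  have "(SUP D\<in>S. g D) \<le> (SUP D\<in>S. g' D) + c"
  proof (rule cSUP_least[OF S])
    fix D assume D: "D \<in> S"
    have "g' D \<le> (SUP D\<in>S. g' D)" by (rule cSUP_upper[OF D bdd_above_of_abs[OF b]])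
    then show "g D \<le> (SUP D\<in>S. g' D) + c" using d[OF D] by linarith
  qed
  then show ?thesis by simp
qed

text \<open>Budget per measurement: the mean of \<open>ramp\<close> is at least 3/128, the mean
  uniform deviation costs 1/256 and its fluctuation another 1/256, which leaves 1/64; division by
  the 16 of \<open>ramp_bounds\<close> gives 1/1024.\<close>

lemma descent_lower_bound:
  fixes n N r m :: nat and p :: "nat \<Rightarrow> real" and w :: "nat \<Rightarrow> complex vec"
  assumes des: "weighted_projective_design 4 n N p w" and n: "n \<ge> 2" and r: "r \<ge> 1"
    and m: "real m \<ge> 8000000000 * real n * real r * ln (real n)"
  defines "K \<equiv> sqrt (real n * (real n + 1))"
  shows "1 - exp (- (1 / 32768) * real m) \<le> measure_pmf.prob (draws_pmf m n N p w)
    {a. \<forall>D \<in> descent_dirs n r. real m / 1024 \<le> (\<Sum>j<m. (K * Re (qf n D (vec_index (a j))))\<^sup>2)}"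
proof -
  let ?d = "draw_pmf N p w" and ?f = "vec_index :: complex vec \<Rightarrow> nat \<Rightarrow> complex"
  let ?P = "Pi_pmf {..<m} (0\<^sub>v n) (\<lambda>_. ?d)"
  let ?J = "Pi_pmf {..<m} (0\<^sub>v n, 0) (\<lambda>_. pair_pmf ?d rademacher)"
  let ?S = "descent_dirs n r" and ?X = "rank1_sum ?f K {..<m}"
  define Y where "Y = (\<lambda>D a. K * Re (qf n D (?f a)))"
  have n1: "n \<ge> 1" and n2: "real n \<ge> 2" using n by auto
  have K: "K > 0" and K2: "K\<^sup>2 = real n * (real n + 1)" using n by (auto simp: K_def)
  have ln2: "ln (2::real) \<ge> 2 / 3" using ln2_ge_two_thirds by simp
  have lnn: "ln (real n) \<ge> 2 / 3" using ln2 n2 ln_mono[of 2 "real n"] by linarith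
  have r1: "real r \<ge> 1" using r by simp
  have m0: "real m > 0"
  proof -
    have "0 < 8000000000 * real n * real r * ln (real n)" using n2 r1 lnn by simp
    then show ?thesis using m by linarith
  qed
  then have m1: "m \<ge> 1" by simp
  have setd: "set_pmf ?d \<subseteq> w ` {..<N}" and Ed: "EE ?d F = (\<Sum>i<N. p i * F (w i))" for F
    using draw_pmf_props[OF des] by auto
  have fin: "finite (set_pmf ?d)" using setd finite_subset by blast
  have unit: "sqn n (?f a) = 1" if "a \<in> set_pmf ?d" for a using setd that design_unit[OF des] by blast
  have finJ: "finite (set_pmf ?J)" using fin by (intro finite_set_Pi_pmf) auto
  have S: "?S \<noteq> {}" by (rule descent_dirs_nonempty[OF n1 r])
  have Yb: "\<bar>Y D a\<bar> \<le> K" if "D \<in> ?S" "a \<in> set_pmf ?d" for D a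
  proof -
    have h: "hermitian n D" and "fro n D = 1" using that by (auto simp: descent_dirs_def)
    then have "opn n D \<le> 1" using opn_le_sqrt_fro[OF h n1] by simp
    then have "\<bar>Re (qf n D (?f a))\<bar> \<le> 1" using qf_le_opn(1)[OF h, of "?f a"] unit[OF that(2)] by simp
    then show ?thesis using K by (simp add: Y_def abs_mult)
  qed
  have small_ball: "3 / 128 \<le> EE ?d (\<lambda>a. ramp (Y D a))" if D: "D \<in> ?S" for D
  proof -
    have h: "hermitian n D" and fr: "fro n D = 1" using D by (auto simp: descent_dirs_def)
    note sp = spectral_eigval[OF h]
    define y where "y = (\<lambda>v. \<Sum>k<n. eigval n D k * ip_sq n (eigvec n D k) v)"
    define M where "M = (\<Sum>k<n. eigval n D k)\<^sup>2 + (\<Sum>k<n. (eigval n D k)\<^sup>2)"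
    have Yy: "Y D a = K * y (?f a)" for a unfolding Y_def qf_spectral[OF sp h] y_def by simp
    have M1: "M \<ge> 1" using fro_spectral[OF sp] fr by (simp add: M_def)
    have "EE ?d (\<lambda>a. (Y D a)\<^sup>2) = K\<^sup>2 * mean N p w (\<lambda>v. (y v)\<^sup>2)"
      unfolding Ed Yy mean_def power_mult_distrib by (simp add: sum_distrib_left mult_ac)
    then have 2: "EE ?d (\<lambda>a. (Y D a)\<^sup>2) = M"
      using design_moment_bounds(1)[OF des n1 sp h] by (simp add: K2 y_def M_def)
    have "EE ?d (\<lambda>a. Y D a ^ 4) = (K\<^sup>2)\<^sup>2 * mean N p w (\<lambda>v. y v ^ 4)"
      unfolding Ed Yy mean_def power_mult_distrib by (simp add: sum_distrib_left mult_ac)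
    then have 4: "EE ?d (\<lambda>a. Y D a ^ 4) \<le> 24 * M\<^sup>2"
      using design_moment_bounds(2)[OF des n1 sp h] by (simp add: K2 y_def M_def)
    show ?thesis by (rule EE_ramp_ge[OF fin M1 2 4])
  qed
  let ?g = "\<lambda>a D. 0 + (\<Sum>j<m. EE ?d (\<lambda>x. ramp (Y D x)) - ramp (Y D (a j)))"
  define F where "F = (\<lambda>a. SUP D\<in>?S. ?g a D)"
  have Er: "0 \<le> EE ?d (\<lambda>x. ramp (Y D x))" "EE ?d (\<lambda>x. ramp (Y D x)) \<le> 1" for D
    using EE_mono[OF fin, of "\<lambda>x. ramp (Y D x)" "\<lambda>_. 1"] ramp_bounds by (auto intro: EE_nonneg)
  have gb: "\<bar>?g a D\<bar> \<le> real m" for D a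
  proof -
    have "\<bar>EE ?d (\<lambda>x. ramp (Y D x)) - ramp (Y D (a j))\<bar> \<le> 1" for j
      using Er[of D] ramp_bounds[of "Y D (a j)"] by linarith
    then have "\<bar>\<Sum>j<m. EE ?d (\<lambda>x. ramp (Y D x)) - ramp (Y D (a j))\<bar> \<le> (\<Sum>j<m. 1)"
      by (intro order.trans[OF sum_abs] sum_mono)
    then show ?thesis by simp
  qed
  define P where "P = nat \<lceil>ln (real n)\<rceil>"
  define B where "B = 2 * exp 1 * real P * K"
  \<comment> \<open>Since ln n \<ge> 2/3, rounding up in \<open>P\<close> costs at most the factor
    5/2; moreover e \<le> 3 and K \<le> (3/2) n, so the constant is 2 * 3 * (5/2) * (3/2).\<close>
  have Bb: "B \<le> 45 / 2 * (real n * ln (real n))"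
  proof -
    have "real P \<le> ln (real n) + 1" unfolding P_def using lnn by linarith
    then have P: "real P \<le> 5 / 2 * ln (real n)" using lnn by linarith
    have "K \<le> 3 / 2 * real n"
      unfolding K_def using n2 by (intro real_le_lsqrt) (auto simp: power2_eq_square algebra_simps)
    then have "2 * exp 1 * real P * K \<le> 2 * 3 * (5 / 2 * ln (real n)) * (3 / 2 * real n)"
      using P K exp_le lnn by (intro mult_mono) auto
    then show ?thesis by (simp add: B_def mult.commute[of "ln _"])
  qed
  have nl: "0 \<le> real n * ln (real n)" using n2 lnn by simp
  \<comment> \<open>The constant is 72^2 * 256^2: 72 = 24 * 3 is the factor in the bound on the mean
    deviation and m / 256 its target. Times 45/2 it is 7644119040, rounded up in the hypothesis on
    m.\<close>
  have rB: "339738624 * (real r * B) \<le> real m"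
  proof -
    have "339738624 * (real r * B) \<le> 339738624 * (real r * (45 / 2 * (real n * ln (real n))))"
      using Bb r1 by (intro mult_left_mono) auto
    also have "\<dots> = 7644119040 * (real r * (real n * ln (real n)))" by simp
    also have "\<dots> \<le> 8000000000 * (real r * (real n * ln (real n)))" using nl by (intro mult_right_mono) auto
    also have "\<dots> \<le> real m" using m by (simp add: mult_ac)
    finally show ?thesis .
  qed
  have B0: "B \<ge> 0" unfolding B_def using K by simp
  have Bm: "B \<le> real m"
  proof -
    have "1 * B \<le> real r * B" using r1 B0 by (intro mult_right_mono)
    then show ?thesis using rB B0 by linarith
  qed
  have iso: "EE ?d (\<lambda>a. K * ip_sq n x (?f a)) \<le> 3 / 2" if x: "sqn n x = 1" for x
  proof -
    have "EE ?d (\<lambda>a. K * ip_sq n x (?f a)) = K * mean N p w (\<lambda>v. ip_sq n x v)"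
      unfolding Ed mean_def by (simp add: sum_distrib_left mult_ac)
    also have "\<dots> = K / n" using design_isotropic[OF des x] n2 by (simp add: field_simps)
    also have "\<dots> \<le> 3 / 2"
    proof -
      have "K \<le> 3 / 2 * real n"
        unfolding K_def using n2 by (intro real_le_lsqrt) (auto simp: power2_eq_square algebra_simps)
      then show ?thesis using n2 by (simp add: field_simps)
    qed
    finally show ?thesis .
  qed
  have EF: "EE ?P F \<le> real m / 256"
  proof -
    have "EE ?P F \<le> EE ?J (\<lambda>z. SUP D\<in>?S. 0 + (\<Sum>j<m. 2 * 4 * snd (z j) * Y D (fst (z j))))"
      unfolding F_def by (rule symmetrization_contraction[OF fin S Yb _ ramp_lipschitz, where C = 0]) auto
    \<comment> \<open>24 = 2 * 4 * 3: symmetrisation, slope of \<open>ramp\<close>, and the trace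
      bound defining \<open>descent_dirs\<close>.\<close>
    also have "\<dots> \<le> EE ?J (\<lambda>z. (24 * sqrt r) * opn n (?X z))"
    proof (rule EE_mono[OF finJ], rule cSUP_least[OF S])
      fix z D assume D: "D \<in> ?S"
      have "Re (trace_prod n D (?X z)) = (\<Sum>j<m. snd (z j) * Y D (fst (z j)))"
        unfolding trace_prod_rank1_sum Re_sum Y_def
        by (intro sum.cong refl) (simp add: mult.assoc)
      moreover have "\<bar>Re (trace_prod n D (?X z))\<bar> \<le> 3 * sqrt r * opn n (?X z)"
        using D hermitian_rank1_sum unfolding descent_dirs_def by blast
      ultimately have "(\<Sum>j<m. snd (z j) * Y D (fst (z j))) \<le> 3 * sqrt r * opn n (?X z)" by simp
      moreover have "0 + (\<Sum>j<m. 2 * 4 * snd (z j) * Y D (fst (z j))) = 8 * (\<Sum>j<m. snd (z j) * Y D (fst (z j)))"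
        by (simp add: sum_distrib_left mult.assoc)
      ultimately show "0 + (\<Sum>j<m. 2 * 4 * snd (z j) * Y D (fst (z j))) \<le> (24 * sqrt r) * opn n (?X z)"
        by simp
    qed
    also have "\<dots> = (24 * sqrt r) * EE ?J (\<lambda>z. opn n (?X z))" by (rule EE_scale)
    also have "\<dots> \<le> (24 * sqrt r) * (3 * sqrt (real m * B))"
      by (intro mult_left_mono rudelson[OF fin unit K n m1 P_def B_def Bm iso]) auto
    also have "\<dots> = sqrt (5184 * (real r * B) * real m)"
    proof -
      have "sqrt 5184 = (72::real)" by (rule real_sqrt_unique) auto
      then show ?thesis by (simp add: real_sqrt_mult)
    qed
    also have "\<dots> \<le> real m / 256"
    proof (rule real_le_lsqrt)
      have "5184 * (real r * B) * real m \<le> (real m / 65536) * real m"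
        using rB by (intro mult_right_mono) auto
      then show "5184 * (real r * B) * real m \<le> (real m / 256)\<^sup>2" by (simp add: power2_eq_square)
    qed simp
    finally show ?thesis .
  qed
  \<comment> \<open>Changing one draw changes one value of \<open>ramp\<close>, which lies between 0
    and 1, so bounded differences hold with constant 1. The exponent is 2 m / 256^2 = m /
    32768.\<close>
  have dev: "measure_pmf.prob ?P {a. F a \<ge> EE ?P F + real m / 256} \<le> exp (- 2 * (real m / 256)\<^sup>2 / (1\<^sup>2 * real (card {..<m})))"
  proof (rule mcdiarmid)
    show "{..<m} \<noteq> {}" using m1 by (simp add: lessThan_empty_iff)
    fix a j y assume "a \<in> set_pmf ?P" "j \<in> {..<m}" "y \<in> set_pmf ?d"
    then have j: "j < m" by simp
    have g: "?g (a(j := y)) D - ?g a D = ramp (Y D (a j)) - ramp (Y D y)" for D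
    proof -
      have "?g b D = (EE ?d (\<lambda>x. ramp (Y D x)) - ramp (Y D (b j))) + (\<Sum>j\<in>{..<m} - {j}. EE ?d (\<lambda>x. ramp (Y D x)) - ramp (Y D (b j)))" for b
        using j by (simp add: sum.remove[of "{..<m}" j])
      moreover have "(\<Sum>k\<in>{..<m} - {j}. EE ?d (\<lambda>x. ramp (Y D x)) - ramp (Y D ((a(j := y)) k))) =
         (\<Sum>k\<in>{..<m} - {j}. EE ?d (\<lambda>x. ramp (Y D x)) - ramp (Y D (a k)))" by (intro sum.cong) auto
      ultimately show ?thesis by simp
    qed
    have "F (a(j := y)) - F a \<le> 1"
      unfolding F_def
    proof (rule SUP_diff_le[OF S gb])
      show "?g (a(j := y)) D - ?g a D \<le> 1" for D
        unfolding g using ramp_bounds[of "Y D (a j)"] ramp_bounds[of "Y D y"] by linarith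
    qed
    moreover have "F a - F (a(j := y)) \<le> 1"
      unfolding F_def
    proof (rule SUP_diff_le[OF S gb])
      show "?g a D - ?g (a(j := y)) D \<le> 1" for D
        using g[of D] ramp_bounds[of "Y D (a j)"] ramp_bounds[of "Y D y"] by linarith
    qed
    ultimately show "\<bar>F (a(j := y)) - F a\<bar> \<le> 1" by linarith
  qed (use fin m0 in auto)
  have "exp (- 2 * (real m / 256)\<^sup>2 / (1\<^sup>2 * real (card {..<m}))) = exp (- (1 / 32768) * real m)"
    using m0 by (simp add: power2_eq_square)
  then have "1 - exp (- (1 / 32768) * real m) \<le> 1 - measure_pmf.prob ?P {a. F a \<ge> EE ?P F + real m / 256}"
    using dev by (simp only: diff_left_mono)
  also have "\<dots> = measure_pmf.prob ?P (- {a. F a \<ge> EE ?P F + real m / 256})"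
    using measure_pmf.prob_compl[of "{a. F a \<ge> EE ?P F + real m / 256}" ?P] by (simp add: Compl_eq_Diff_UNIV)
  also have "\<dots> \<le> measure_pmf.prob ?P
    {a. \<forall>D \<in> ?S. real m / 1024 \<le> (\<Sum>j<m. (K * Re (qf n D (?f (a j))))\<^sup>2)}"
  proof (rule measure_pmf.finite_measure_mono)
    show "- {a. F a \<ge> EE ?P F + real m / 256} \<subseteq> {a. \<forall>D \<in> ?S. real m / 1024 \<le> (\<Sum>j<m. (K * Re (qf n D (?f (a j))))\<^sup>2)}"
    proof (intro subsetI CollectI ballI)
      fix a D assume "a \<in> - {a. F a \<ge> EE ?P F + real m / 256}" and D: "D \<in> ?S"
      then have Fa: "F a \<le> real m / 128" using EF by simp
      have "?g a D \<le> F a"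
        unfolding F_def by (rule cSUP_upper[OF D bdd_above_of_abs[OF gb]])
      then have "real m * EE ?d (\<lambda>x. ramp (Y D x)) - (\<Sum>j<m. ramp (Y D (a j))) \<le> real m / 128"
        using Fa by (simp add: sum_subtractf)
      moreover have "real m * (3 / 128) \<le> real m * EE ?d (\<lambda>x. ramp (Y D x))"
        using small_ball[OF D] by (intro mult_left_mono) auto
      ultimately have "real m / 64 \<le> (\<Sum>j<m. ramp (Y D (a j)))" by simp
      also have "\<dots> \<le> (\<Sum>j<m. 16 * (Y D (a j))\<^sup>2)" by (intro sum_mono ramp_bounds)
      also have "\<dots> = 16 * (\<Sum>j<m. (Y D (a j))\<^sup>2)" by (simp add: sum_distrib_left)
      finally show "real m / 1024 \<le> (\<Sum>j<m. (K * Re (qf n D (?f (a j))))\<^sup>2)" by (simp add: Y_def)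
    qed
  qed simp
  finally show ?thesis by (simp add: draws_pmf_def)
qed

text \<open>The deterministic part. Its factor 64 is sqrt 1024 from the lower bound times 2 from the
  triangle inequality. The case of zero error is separate because the error is normalised to a
  descent direction.\<close>

lemma recovery:
  fixes a :: "nat \<Rightarrow> complex vec"
  defines "K \<equiv> \<lambda>n::nat. sqrt (real n * (real n + 1))"
  assumes a: "\<And>j. j < m \<Longrightarrow> a j \<in> carrier_vec n" and n: "n \<ge> 1" and m: "m \<ge> 1"
    and lower: "\<And>D. D \<in> descent_dirs n r \<Longrightarrow> real m / 1024 \<le> (\<Sum>j<m. (K n * Re (qf n D (vec_index (a j))))\<^sup>2)"
    and X: "X \<in> hermitian_mats n" and r: "vec_space.rank n X \<le> r"
    and \<epsilon>: "\<epsilon> \<in> carrier_vec m" "l2_norm \<epsilon> \<le> \<eta>"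
    and sol: "nuclear_norm_solution n m a (measurement_map n m a X + \<epsilon>) \<eta> X'"
  shows "frobenius_norm (X - X') \<le> 64 * \<eta> / sqrt (real m)"
proof -
  let ?A = "measurement_map n m a"
  let ?b = "?A X + \<epsilon>" and ?N = "L2_set (\<lambda>j. ?A X' $ j - ?A X $ j) {..<m}"
  note Xc = hermitian_matsD(1)[OF X]
  have dimA: "dim_vec (?A Z) = m" for Z by (simp add: measurement_map_def)
  have X': "X' \<in> hermitian_mats n" and feas: "l2_norm (?A X' - ?b) \<le> \<eta>"
    and min: "\<And>Z. Z \<in> hermitian_mats n \<Longrightarrow> l2_norm (?A Z - ?b) \<le> \<eta> \<Longrightarrow> nuclear_norm X' \<le> nuclear_norm Z"
    using sol unfolding nuclear_norm_solution_def is_arg_min_def by (auto simp: not_less)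
  note Xc' = hermitian_matsD(1)[OF X']
  have "l2_norm (?A X - ?b) = l2_norm \<epsilon>"
    unfolding l2_norm_def L2_set_def using \<epsilon>(1) by (intro arg_cong[of _ _ sqrt] sum.cong) (auto simp: dimA)
  then have le: "nuclear_norm X' \<le> nuclear_norm X" using \<epsilon>(2) by (intro min X) simp
  define D where "D = (\<lambda>i j. X' $$ (i, j) - X $$ (i, j))"
  define c where "c = sqrt (fro n D)"
  have fr: "frobenius_norm (X - X') = c"
  proof -
    have "frobenius_norm (X - X') = sqrt (\<Sum>x\<in>{..<n} \<times> {..<n}. (cmod (D (fst x) (snd x)))\<^sup>2)"
      using Xc Xc' unfolding frobenius_norm_def L2_set_def
      by (intro arg_cong[of _ _ sqrt] sum.cong) (auto simp: D_def norm_minus_commute)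
    then show ?thesis by (simp add: c_def fro_def sum.cartesian_product case_prod_beta)
  qed
  have \<eta>: "\<eta> \<ge> 0" using \<epsilon>(2) by (auto simp: l2_norm_def intro: order_trans[OF L2_set_nonneg])
  have sm: "sqrt (real m) > 0" using m by simp
  show ?thesis
  proof (cases "c = 0")
    case True
    then show ?thesis using fr \<eta> sm by simp
  next
    case False
    then have c: "c > 0" using fro_nonneg[of n D] by (simp add: c_def)
    have c2: "c\<^sup>2 = fro n D" using fro_nonneg[of n D] by (simp add: c_def)
    let ?E = "\<lambda>i j. of_real (1 / c) * D i j"
    have "?E \<in> descent_dirs n r"
      unfolding descent_dirs_def
    proof (intro CollectI conjI allI impI)
      show "hermitian n ?E"
        unfolding hermitian_def
      proof (intro allI impI)
        fix i j assume ij: "i < n" "j < n"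
        have "X $$ (j, i) = cnj (X $$ (i, j))" "X' $$ (j, i) = cnj (X' $$ (i, j))"
          using hermitian_matsD(2)[OF X] hermitian_matsD(2)[OF X'] ij unfolding hermitian_def by blast+
        then show "?E j i = cnj (?E i j)" by (simp add: D_def)
      qed
      have "fro n ?E = (1 / c)\<^sup>2 * fro n D"
        using c by (simp add: fro_def norm_mult norm_divide power_mult_distrib power_divide sum_divide_distrib)
      also have "\<dots> = 1" unfolding c2[symmetric] using c by (simp add: power_divide)
      finally show "fro n ?E = 1" .
      fix H assume H: "hermitian n H"
      have "trace_prod n ?E H = of_real (1 / c) * trace_prod n D H"
        by (simp add: trace_prod_def sum_distrib_left sum_divide_distrib)
      then have "\<bar>Re (trace_prod n ?E H)\<bar> = \<bar>Re (trace_prod n D H)\<bar> / c"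
        using c by (simp add: Re_divide_of_real)
      also have "\<dots> \<le> (3 * sqrt r * c * opn n H) / c"
        using descent_cone[OF X X' le r H n] c by (intro divide_right_mono) (auto simp: D_def c_def)
      finally show "\<bar>Re (trace_prod n ?E H)\<bar> \<le> 3 * sqrt r * opn n H" using c by simp
    qed
    from lower[OF this] have "real m / 1024 \<le> (\<Sum>j<m. (K n * Re (qf n ?E (vec_index (a j))))\<^sup>2)" .
    also have "\<dots> = (\<Sum>j<m. ((1 / c) * (?A X' $ j - ?A X $ j))\<^sup>2)"
    proof (intro sum.cong refl)
      fix j assume "j \<in> {..<m}"
      then have j: "j < m" by simp
      let ?v = "vec_index (a j)"
      have "mv n ?E ?v = (\<lambda>i. of_real (1 / c) * (mv n (entries X') ?v i - mv n (entries X) ?v i))"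
        by (rule ext) (simp add: mv_def D_def sum_subtractf algebra_simps sum_divide_distrib diff_divide_distrib)
      then have "qf n ?E ?v = of_real (1 / c) * (qf n (entries X') ?v - qf n (entries X) ?v)"
        unfolding qf_def by (simp only: ip_scale_right ip_diff_right)
      then have "K n * Re (qf n ?E ?v) = (1 / c) * (?A X' $ j - ?A X $ j)"
        unfolding measurement_map_index[where a = a, OF Xc' a[OF j] j] measurement_map_index[where a = a, OF Xc a[OF j] j] K_def
        by (simp add: Re_divide_of_real right_diff_distrib)
      then show "(K n * Re (qf n ?E ?v))\<^sup>2 = ((1 / c) * (?A X' $ j - ?A X $ j))\<^sup>2" by simp
    qed
    also have "\<dots> = (1 / c)\<^sup>2 * (\<Sum>j<m. (?A X' $ j - ?A X $ j)\<^sup>2)"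
      unfolding power_mult_distrib sum_distrib_left ..
    also have "\<dots> = (?N / c)\<^sup>2"
      by (simp add: L2_set_def power_divide sum_nonneg)
    finally have "sqrt (real m / 1024) \<le> ?N / c"
      using c by (intro real_le_lsqrt) auto
    moreover have "sqrt (real m / 1024) = sqrt (real m) / 32"
      by (simp add: real_sqrt_divide)
    ultimately have 1: "sqrt (real m) / 32 * c \<le> ?N"
      using c by (simp add: field_simps)
    have "?N = L2_set (\<lambda>j. (?A X' - ?b) $ j + \<epsilon> $ j) {..<m}"
      using \<epsilon>(1) dimA by (intro L2_set_cong refl) auto
    also have "\<dots> \<le> L2_set (\<lambda>j. (?A X' - ?b) $ j) {..<m} + L2_set (\<lambda>j. \<epsilon> $ j) {..<m}" by (rule L2_set_triangle_ineq)
    also have "L2_set (\<lambda>j. (?A X' - ?b) $ j) {..<m} = l2_norm (?A X' - ?b)"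
      using \<epsilon>(1) by (simp add: l2_norm_def L2_set_def dimA)
    also have "L2_set (\<lambda>j. \<epsilon> $ j) {..<m} = l2_norm \<epsilon>" using \<epsilon>(1) by (simp add: l2_norm_def L2_set_def)
    finally have "sqrt (real m) / 32 * c \<le> 2 * \<eta>" using 1 feas \<epsilon>(2) by linarith
    then show ?thesis unfolding fr using sm by (simp add: field_simps)
  qed
qed

theorem theorem3:
  "\<exists>C4 C5 C6 :: real. C4 > 0 \<and> C5 > 0 \<and> C6 > 0 \<and>
     (\<forall>(n::nat) (N::nat) (p :: nat \<Rightarrow> real) (w :: nat \<Rightarrow> complex vec) (r::nat) (m::nat).
        n \<ge> 2 \<longrightarrow> weighted_projective_design 4 n N p w \<longrightarrow> 1 \<le> r \<longrightarrow> r \<le> n \<longrightarrow>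
        real m \<ge> C4 * real n * real r * ln (real n) \<longrightarrow>
        measure_pmf.prob (draws_pmf m n N p w)
          {a. \<forall>X \<in> hermitian_mats n. vec_space.rank n X \<le> r \<longrightarrow>
                (\<forall>\<eta>\<ge>0. \<forall>\<epsilon> \<in> carrier_vec m. l2_norm \<epsilon> \<le> \<eta> \<longrightarrow>
                  (let b = measurement_map n m a X + \<epsilon> in
                   \<forall>X'. nuclear_norm_solution n m a b \<eta> X' \<longrightarrow>
                     frobenius_norm (X - X') \<le> C6 * \<eta> / sqrt (real m)))}
        \<ge> 1 - exp (- C5 * real m))"
proof (rule exI[of _ 8000000000], rule exI[of _ "1 / 32768"], rule exI[of _ 64], intro conjI allI impI)
  fix n N :: nat and p :: "nat \<Rightarrow> real" and w :: "nat \<Rightarrow> complex vec" and r m :: nat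
  assume n: "2 \<le> n" and des: "weighted_projective_design 4 n N p w" and r: "1 \<le> r"
    and m: "8000000000 * real n * real r * ln (real n) \<le> real m"
  let ?P = "draws_pmf m n N p w"
  let ?good = "{a. \<forall>D \<in> descent_dirs n r. real m / 1024 \<le> (\<Sum>j<m. (sqrt (real n * (real n + 1)) * Re (qf n D (vec_index (a j))))\<^sup>2)}"
  let ?goal = "{a. \<forall>X \<in> hermitian_mats n. vec_space.rank n X \<le> r \<longrightarrow>
                (\<forall>\<eta>\<ge>0. \<forall>\<epsilon> \<in> carrier_vec m. l2_norm \<epsilon> \<le> \<eta> \<longrightarrow>
                  (let b = measurement_map n m a X + \<epsilon> in
                   \<forall>X'. nuclear_norm_solution n m a b \<eta> X' \<longrightarrow>
                     frobenius_norm (X - X') \<le> 64 * \<eta> / sqrt (real m)))}"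
  have "0 < 8000000000 * real n * real r * ln (real n)" using n r by simp
  then have m1: "m \<ge> 1" using m by (cases m) auto
  have "1 - exp (- (1 / 32768) * real m) \<le> measure_pmf.prob ?P ?good"
    by (rule descent_lower_bound[OF des n r m])
  also have "\<dots> \<le> measure_pmf.prob ?P ?goal"
  \<comment> \<open>The inclusion is shown on the support only: there the draws are design vectors,
    hence of dimension n, as \<open>recovery\<close> requires.\<close>
  proof (rule measure_pmf.finite_measure_mono_AE)
    have "a \<in> ?goal" if supp: "a \<in> set_pmf ?P" and good: "a \<in> ?good" for a
    proof -
      have car: "a j \<in> carrier_vec n" if j: "j < m" for j
      proof -
        have "a j \<in> set_pmf (draw_pmf N p w)"
          using supp j by (auto simp: draws_pmf_def set_Pi_pmf PiE_dflt_def)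
        then show ?thesis
          using draw_pmf_props(2)[OF des] des by (auto simp: weighted_projective_design_def)
      qed
      have lower: "real m / 1024 \<le> (\<Sum>j<m. (sqrt (real n * (real n + 1)) * Re (qf n D (vec_index (a j))))\<^sup>2)"
        if "D \<in> descent_dirs n r" for D using good that by blast
      have n1: "n \<ge> 1" using n by simp
      show ?thesis
        unfolding Let_def
        by (intro CollectI ballI allI impI) (rule recovery[OF car n1 m1 lower])
    qed
    then show "AE a in measure_pmf ?P. a \<in> ?good \<longrightarrow> a \<in> ?goal"
      unfolding AE_measure_pmf_iff by blast
  qed simp
  finally show "1 - exp (- (1 / 32768) * real m) \<le> measure_pmf.prob ?P ?goal" .
qed simp_all

end
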